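(* For every $n\ge3$ and $k\ge0$, $$\mathcal W_n^{(k)}\simeq\bigoplus_{\substack{r_1+\cdots+r_n=k\\ r_i\ge0}}\left(V_{r_1+3,r_1}\otimes\cdots\otimes V_{r_n+3,r_n}\right)^{SL(3,\mathbb C)}$$ as complex vector spaces, and $$\dim_{\mathbb C}\mathcal W_n^{(k)}=\sum_{\substack{r_1+\cdots+r_n=k\\ r_i\ge0}}\left[s_{(k+n,k+n,k+n)}\right]\prod_{i=1}^n s_{(2r_i+3,r_i)},$$ where $[s_\lambda]f$ denotes the coefficient of the Schur polynomial $s_\lambda$ in the expansion of the symmetric polynomial $f$ in the Schur basis.
   Context: All Schur polynomials are in three variables $x_1,x_2,x_3$, and $s_{(2r+3,r)}$ means $s_{(2r+3,r,0)}$. $V_{a,b}$ denotes the irreducible $SL(3,\mathbb C)$-representation with highest weight $a\omega_1+b\omega_2$ ($V_{1,0}=\mathbb C^3$, $V_{0,1}=(\mathbb C^3)^*$). $\mathcal M_n=\{(A_i,\ell_i)_{i=1}^n\in(\mathbb C^3\oplus(\mathbb C^3)^* )^n\mid \ell_iA_i=0,\ i=1,\dots,n\}$, with coordinate ring $\mathbb C[\mathcal M_n]$. $SL(3,\mathbb C)$ acts by $A_i\mapsto GA_i$, $\ell_i\mapsto\ell_iG^{-1}$, and $\mathbb T_n=(\mathbb C^\times)^n$ acts by $A_i\mapsto t_iA_i$, $\ell_i\mapsto t_i^{-1}\ell_i$. Define $$\mathcal W_n=\{H\in\mathbb C[\mathcal M_n]^{SL(3,\mathbb C)}\mid H(\mathbf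 t\cdot z)=(t_1\cdots t_n)^{-3}H(z)\ \ \forall\,\mathbf t=(t_1,\dots,t_n)\in\mathbb T_n\}.$$ $\mathcal W_n^{(k)}$ is the homogeneous component of $\mathcal W_n$ of $C$-degree $k$, i.e. the subspace of elements homogeneous of total degree $k$ in the coordinates of the vectors $A_1,\dots,A_n$ (this grading is well defined since the equations $\ell_iA_i=0$ are bihomogeneous; the name comes from the fact that $\mathcal W_n$ is spanned by monomials in $\det(\ell_i,\ell_j,\ell_k)$ and $C_{ij}=\ell_iA_j$, for which this degree is the number of factors $C_{ij}$). *)

theory Defs
  imports
    "HOL-Analysis.Analysis"
    "HOL-Library.Function_Algebras"
    "HOL-Library.Poly_Mapping"
begin

section \<open>Spaces of complex-valued functions\<close>

text \<open>
  Every complex vector space below is a linear subspace of some function space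
  \<open>'a \<Rightarrow> complex\<close>; in particular the space with basis indexed by \<open>I \<subseteq> 'a\<close> is the set of functions
  vanishing outside \<open>I\<close>.
\<close>

definition fscale :: "complex \<Rightarrow> ('a \<Rightarrow> complex) \<Rightarrow> 'a \<Rightarrow> complex"
  where "fscale c f = (\<lambda>x. c * f x)"

interpretation fun_space: vector_space fscale
  by unfold_locales (auto simp: fscale_def fun_eq_iff algebra_simps)

text \<open>
  A linear map between subspaces extends to the ambient spaces, so asking for a linear map of the
  ambient spaces that restricts to a bijection loses nothing.
\<close>

definition lin_isomorphic :: "('a \<Rightarrow> complex) set \<Rightarrow> ('b \<Rightarrow> complex) set \<Rightarrow> bool"
    (infix \<open>\<cong>\<^sub>l\<close> 50)
  where "S \<cong>\<^sub>l T \<longleftrightarrow> (\<exists>\<phi>. Vector_Spaces.linear fscale fscale \<phi> \<and> bij_betw \<phi> S T)"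

definition finite_dimensional :: "('a \<Rightarrow> complex) set \<Rightarrow> bool"
  where "finite_dimensional S \<longleftrightarrow> (\<exists>B. finite B \<and> fun_space.span B = S)"

text \<open>The direct sum of a family indexed by a finite set \<open>I\<close>; the \<open>i\<close>-th component of \<open>x\<close> is
  \<open>\<lambda>a. x (i, a)\<close>.\<close>

definition direct_sum :: "'i set \<Rightarrow> ('i \<Rightarrow> ('a \<Rightarrow> complex) set) \<Rightarrow> ('i \<times> 'a \<Rightarrow> complex) set"
  where "direct_sum I S =
    {x. (\<forall>i\<in>I. (\<lambda>a. x (i, a)) \<in> S i) \<and> (\<forall>i a. i \<notin> I \<longrightarrow> x (i, a) = 0)}"


section \<open>Multivariate polynomials\<close>

type_synonym ('v, 'c) mpolynomial = "('v \<Rightarrow>\<^sub>0 nat) \<Rightarrow>\<^sub>0 'c"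

definition eval_poly :: "('v \<Rightarrow> complex) \<Rightarrow> ('v, complex) mpolynomial \<Rightarrow> complex"
  where "eval_poly x p =
    (\<Sum>m\<in>Poly_Mapping.keys p. Poly_Mapping.lookup p m *
       (\<Prod>v\<in>Poly_Mapping.keys m. x v ^ Poly_Mapping.lookup m v))"

definition poly_vars :: "('v, 'c::zero) mpolynomial \<Rightarrow> 'v set"
  where "poly_vars p = (\<Union>m\<in>Poly_Mapping.keys p. Poly_Mapping.keys m)"


section \<open>Representations of \<open>SL(3,\<complex>)\<close>\<close>

definition SL3 :: "(complex^3^3) set"
  where "SL3 = {G. det G = 1}"

text \<open>
  A finite-dimensional representation in coordinates: a finite set \<open>idx\<close> indexing a basis, and the
  matrix entries of the action of a group element with respect to this basis.
\<close>

record 'i sl3_rep =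
  idx :: "'i set"
  entry :: "complex^3^3 \<Rightarrow> 'i \<Rightarrow> 'i \<Rightarrow> complex"

definition rep_space :: "'i sl3_rep \<Rightarrow> ('i \<Rightarrow> complex) set"
  where "rep_space R = {v. \<forall>i. i \<notin> idx R \<longrightarrow> v i = 0}"

definition rep_act :: "'i sl3_rep \<Rightarrow> complex^3^3 \<Rightarrow> ('i \<Rightarrow> complex) \<Rightarrow> 'i \<Rightarrow> complex"
  where "rep_act R G v = (\<lambda>i. if i \<in> idx R then \<Sum>j\<in>idx R. entry R G i j * v j else 0)"

text \<open>Representations of the algebraic group: the matrix entries are regular functions on
  \<open>SL(3,\<complex>)\<close>, i.e. polynomials in the nine entries of the group element.\<close>

definition is_rep :: "'i sl3_rep \<Rightarrow> bool"
  where "is_rep R \<longleftrightarrow>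
    finite (idx R) \<and>
    (\<forall>v\<in>rep_space R. rep_act R (mat 1) v = v) \<and>
    (\<forall>G\<in>SL3. \<forall>H\<in>SL3. \<forall>v\<in>rep_space R. rep_act R (G ** H) v = rep_act R G (rep_act R H v)) \<and>
    (\<forall>i\<in>idx R. \<forall>j\<in>idx R. \<exists>p :: (3 \<times> 3, complex) mpolynomial.
        \<forall>G\<in>SL3. entry R G i j = eval_poly (\<lambda>(a, b). G $ a $ b) p)"

definition irreducible_rep :: "'i sl3_rep \<Rightarrow> bool"
  where "irreducible_rep R \<longleftrightarrow>
    is_rep R \<and> rep_space R \<noteq> {0} \<and>
    (\<forall>S \<subseteq> rep_space R. fun_space.subspace S \<and> (\<forall>G\<in>SL3. rep_act R G ` S \<subseteq> S)
        \<longrightarrow> S = {0} \<or> S = rep_space R)"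

definition upper_unipotent :: "(complex^3^3) set"
  where "upper_unipotent =
    {G. (\<forall>i. G $ i $ i = 1) \<and> G $ 2 $ 1 = 0 \<and> G $ 3 $ 1 = 0 \<and> G $ 3 $ 2 = 0}"

definition diag3 :: "complex^3 \<Rightarrow> complex^3^3"
  where "diag3 t = (\<chi> i j. if i = j then t $ i else 0)"

text \<open>
  Highest weight \<open>a \<omega>\<^sub>1 + b \<omega>\<^sub>2\<close> with respect to the upper triangular Borel subgroup. On
  \<open>diag(t\<^sub>1, t\<^sub>2, t\<^sub>3)\<close> with \<open>t\<^sub>1 t\<^sub>2 t\<^sub>3 = 1\<close> the fundamental weights are \<open>\<omega>\<^sub>1 = t\<^sub>1\<close> and
  \<open>\<omega>\<^sub>2 = t\<^sub>1 t\<^sub>2\<close>, so that \<open>(1, 0)\<close> belongs to \<open>\<complex>\<^sup>3\<close> and \<open>(0, 1)\<close> to its dual.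
\<close>

definition highest_weight_vector :: "'i sl3_rep \<Rightarrow> nat \<Rightarrow> nat \<Rightarrow> ('i \<Rightarrow> complex) \<Rightarrow> bool"
  where "highest_weight_vector R a b v \<longleftrightarrow>
    v \<in> rep_space R \<and> v \<noteq> 0 \<and>
    (\<forall>G\<in>upper_unipotent. rep_act R G v = v) \<and>
    (\<forall>t. t $ 1 * t $ 2 * t $ 3 = 1 \<longrightarrow>
       rep_act R (diag3 t) v = fscale ((t $ 1) ^ a * (t $ 1 * t $ 2) ^ b) v)"

text \<open>This property determines the representation \<open>V\<^sub>a\<^sub>,\<^sub>b\<close> up to isomorphism.\<close>

definition irrep_with_highest_weight :: "'i sl3_rep \<Rightarrow> nat \<Rightarrow> nat \<Rightarrow> bool"
  where "irrep_with_highest_weight R a b \<longleftrightarrow>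
    irreducible_rep R \<and> (\<exists>v. highest_weight_vector R a b v)"

text \<open>\<open>R 0 \<otimes> \<dots> \<otimes> R (n - 1)\<close>: the pure tensors of basis vectors are indexed by multi-indices,
  and the group acts by the Kronecker product of the matrices.\<close>

definition tensor_rep :: "nat \<Rightarrow> (nat \<Rightarrow> 'i sl3_rep) \<Rightarrow> (nat \<Rightarrow> 'i) sl3_rep"
  where "tensor_rep n R =
    \<lparr> idx = (\<Pi>\<^sub>E i\<in>{..<n}. idx (R i)),
      entry = (\<lambda>G I J. \<Prod>i<n. entry (R i) G (I i) (J i)) \<rparr>"

definition rep_invariants :: "'i sl3_rep \<Rightarrow> ('i \<Rightarrow> complex) set"
  where "rep_invariants R = {v \<in> rep_space R. \<forall>G\<in>SL3. rep_act R G v = v}"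


section \<open>The variety \<open>\<M>\<^sub>n\<close> and the spaces \<open>\<W>\<^sub>n\<^sup>(\<^sup>k\<^sup>)\<close>\<close>

text \<open>A point is a sequence of pairs \<open>(A\<^sub>i, \<ell>\<^sub>i)\<close>, with \<open>i < n\<close> in place of \<open>1 \<le> i \<le> n\<close>,
  extended by zero.\<close>

type_synonym config = "nat \<Rightarrow> (complex^3) \<times> (complex^3)"

abbreviation vec_of :: "config \<Rightarrow> nat \<Rightarrow> complex^3"
  where "vec_of z i \<equiv> fst (z i)"

abbreviation covec_of :: "config \<Rightarrow> nat \<Rightarrow> complex^3"
  where "covec_of z i \<equiv> snd (z i)"

definition M_variety :: "nat \<Rightarrow> config set"
  where "M_variety n =
    {z. (\<forall>i<n. (\<Sum>j\<in>UNIV. covec_of z i $ j * vec_of z i $ j) = 0) \<and> (\<forall>i\<ge>n. z i = 0)}"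

definition SL3_act :: "complex^3^3 \<Rightarrow> config \<Rightarrow> config"
  where "SL3_act G z = (\<lambda>i. (G *v vec_of z i, covec_of z i v* matrix_inv G))"

definition torus_act :: "(nat \<Rightarrow> complex) \<Rightarrow> config \<Rightarrow> config"
  where "torus_act t z = (\<lambda>i. (t i *s vec_of z i, inverse (t i) *s covec_of z i))"

datatype coord = Vec nat 3 | Covec nat 3

fun coord_value :: "config \<Rightarrow> coord \<Rightarrow> complex"
  where
    "coord_value z (Vec i j) = vec_of z i $ j"
  | "coord_value z (Covec i j) = covec_of z i $ j"

definition coords :: "nat \<Rightarrow> coord set"
  where "coords n = {Vec i j | i j. i < n} \<union> {Covec i j | i j. i < n}"

definition ambient_polys :: "nat \<Rightarrow> (coord, complex) mpolynomial set"
  where "ambient_polys n = {p. poly_vars p \<subseteq> coords n}"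

text \<open>Regular functions on \<open>\<M>\<^sub>n\<close> are restrictions of polynomials; they are extended by zero
  outside \<open>\<M>\<^sub>n\<close> so that equality of functions is equality on \<open>\<M>\<^sub>n\<close>.\<close>

definition restrict_to_M :: "nat \<Rightarrow> (coord, complex) mpolynomial \<Rightarrow> config \<Rightarrow> complex"
  where "restrict_to_M n p = (\<lambda>z. if z \<in> M_variety n then eval_poly (coord_value z) p else 0)"

definition coordinate_ring :: "nat \<Rightarrow> (config \<Rightarrow> complex) set"
  where "coordinate_ring n = restrict_to_M n ` ambient_polys n"

definition W_space :: "nat \<Rightarrow> (config \<Rightarrow> complex) set"
  where "W_space n =
    {H \<in> coordinate_ring n.
       (\<forall>G\<in>SL3. \<forall>z\<in>M_variety n. H (SL3_act G z) = H z) \<and>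
       (\<forall>t. (\<forall>i<n. t i \<noteq> 0) \<longrightarrow>
          (\<forall>z\<in>M_variety n. H (torus_act t z) = (\<Prod>i<n. t i) powi (-3) * H z))}"

fun vec_weight :: "coord \<Rightarrow> nat"
  where
    "vec_weight (Vec i j) = 1"
  | "vec_weight (Covec i j) = 0"

definition vec_degree :: "(coord \<Rightarrow>\<^sub>0 nat) \<Rightarrow> nat"
  where "vec_degree m = (\<Sum>v\<in>Poly_Mapping.keys m. vec_weight v * Poly_Mapping.lookup m v)"

definition C_homogeneous :: "nat \<Rightarrow> (coord, complex) mpolynomial \<Rightarrow> bool"
  where "C_homogeneous k p \<longleftrightarrow> (\<forall>m\<in>Poly_Mapping.keys p. vec_degree m = k)"

definition W_graded :: "nat \<Rightarrow> nat \<Rightarrow> (config \<Rightarrow> complex) set"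
  where "W_graded n k =
    W_space n \<inter> restrict_to_M n ` {p \<in> ambient_polys n. C_homogeneous k p}"

definition compositions :: "nat \<Rightarrow> nat \<Rightarrow> (nat \<Rightarrow> nat) set"
  where "compositions n k = {r \<in> {..<n} \<rightarrow>\<^sub>E UNIV. (\<Sum>i<n. r i) = k}"


section \<open>Schur polynomials in three variables\<close>

definition cells :: "nat list \<Rightarrow> (nat \<times> nat) set"
  where "cells lam = {(i, j). i < length lam \<and> j < lam ! i}"

definition semistandard_tableaux :: "nat list \<Rightarrow> (nat \<times> nat \<Rightarrow> nat) set"
  where "semistandard_tableaux lam =
    {T \<in> cells lam \<rightarrow>\<^sub>E {1, 2, 3}.
       (\<forall>i j. (i, j) \<in> cells lam \<and> (i, Suc j) \<in> cells lam \<longrightarrow> T (i, j) \<le> T (i, Suc j)) \<and>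
       (\<forall>i j. (i, j) \<in> cells lam \<and> (Suc i, j) \<in> cells lam \<longrightarrow> T (i, j) < T (Suc i, j))}"

text \<open>The variables are \<open>x\<^sub>1, x\<^sub>2, x\<^sub>3\<close>; a tableau \<open>T\<close> contributes \<open>\<Prod>\<^sub>c x\<^sub>T\<^sub>(\<^sub>c\<^sub>)\<close>.\<close>

definition schur :: "nat list \<Rightarrow> (nat, int) mpolynomial"
  where "schur lam =
    (\<Sum>T\<in>semistandard_tableaux lam.
       Poly_Mapping.single (\<Sum>c\<in>cells lam. Poly_Mapping.single (T c) 1) 1)"

definition partitions3 :: "nat list set"
  where "partitions3 = {[a, b, c] | a b c. b \<le> a \<and> c \<le> b}"

text \<open>\<open>frag_cmul\<close> is the scalar multiplication of the integral polynomials.\<close>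

interpretation int_poly: module frag_cmul
  by unfold_locales (auto simp: frag_cmul_distrib frag_cmul_distrib2)

text \<open>The Schur polynomials of \<open>partitions3\<close> are linearly independent and pairwise distinct, so the
  coefficient of \<open>s\<^sub>\<lambda>\<close> is the value of the coordinate function \<open>representation\<close> at the basis
  element \<open>s\<^sub>\<lambda>\<close>.\<close>

definition schur_coeff :: "nat list \<Rightarrow> (nat, int) mpolynomial \<Rightarrow> int"
  where "schur_coeff lam f = int_poly.representation (schur ` partitions3) f (schur lam)"

end

theory Submission
  imports Defs
begin

text \<open>On the cone \<open>\<ell> A = 0\<close> in \<open>\<complex>\<^sup>3 \<oplus> (\<complex>\<^sup>3)\<^sup>*\<close> the functions of degree \<open>a\<close> in \<open>\<ell>\<close> and \<open>b\<close> in \<open>A\<close> form a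
  copy of \<open>V\<^bsub>a,b\<^esub>\<close>: the cone is essentially the orbit of a pair of highest weight vectors, and for an
  irreducible \<open>V\<close> of highest weight \<open>(a, b)\<close> the relations among the translates of the highest weight
  vector are those among the translates of \<open>\<Delta>\<^sub>1\<^sup>a \<Delta>\<^sub>2\<^sup>b\<close>, with \<open>\<Delta>\<^sub>i\<close> the leading principal minors,
  because the big cell is dense. Hence the multihomogeneous pieces of the coordinate ring of
  \<open>\<M>\<^sub>n\<close> are tensor products of such representations, and torus weight \<open>-3\<close> together with \<open>C\<close>-degree \<open>k\<close>
  selects the bidegrees \<open>(r\<^sub>i + 3, r\<^sub>i)\<close> with \<open>\<Sum> r\<^sub>i = k\<close>.

  For the dimension, all representations embed in tensor powers of \<open>\<complex>\<^sup>3\<close> and its dual, where the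
  conjugate transpose of a matrix acts as the adjoint operator, so that orthogonal complements of
  invariant subspaces are invariant and the products decompose into irreducibles. The weights of the
  standard monomials on the cone are those of Gelfand--Tsetlin patterns, that is of semistandard
  tableaux, so counting weights identifies the multiplicities with the Schur coefficients of
  \<open>\<Prod> s\<^bsub>(2r\<^sub>i+3, r\<^sub>i)\<^esub>\<close>.\<close>

section \<open>Linear algebra in function spaces\<close>

text \<open>The two claims take different routes. The isomorphism starts from arbitrary irreducibles
  \<open>V a b\<close>, of which only irreducibility and a highest weight vector are known; limits
  along one-parameter subgroups, justified by continuity of the matrix entries, take the place of
  Lie algebras. The dimension formula mentions no family \<open>V\<close> and is derived from
  concrete tensor powers. Complete reducibility is obtained there without integration over a compact
  group: conjugate transposition preserves \<open>SL3\<close>, and on tensor powers it acts as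
  Hermitian adjunction.

  The torus of \<open>SL3\<close> sees weights only modulo (1, 1, 1). Inverses such as 1/x = y z are
  therefore written with nonnegative exponents, and every weight is a triple of naturals of fixed
  total degree. The dual of the standard representation has degree 2, a factor of bidegree (r + 3,
  r) has degree (r + 3) + 2 r = 3 r + 3, and a product over a composition of k has degree 3 (k + n).
  Hence the trivial summands are those of highest weight (k + n, k + n, k + n), the shape in the
  formula.\<close>

interpretation fun_pair: vector_space_pair fscale fscale
  by unfold_locales

lemma fscale_apply: "fscale c f x = c * f x"
  by (simp add: fscale_def)

lemma sum_fun_apply: "(\<Sum>i\<in>I. f i) x = (\<Sum>i\<in>I. f i x)" for f :: "'i \<Rightarrow> 'a \<Rightarrow> complex"
  by (induction I rule: infinite_finite_induct) auto

text \<open>Independence of a family rather than of a set: weights are attached to the indices, and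
  a repeated vector counts as a dependence.\<close>

definition indep_fam :: "'j set \<Rightarrow> ('j \<Rightarrow> 'a \<Rightarrow> complex) \<Rightarrow> bool"
  where "indep_fam J g \<longleftrightarrow> (\<forall>c. (\<forall>x. (\<Sum>j\<in>J. c j * g j x) = 0) \<longrightarrow> (\<forall>j\<in>J. c j = 0))"

definition is_basis :: "'j set \<Rightarrow> ('j \<Rightarrow> 'a \<Rightarrow> complex) \<Rightarrow> ('a \<Rightarrow> complex) set \<Rightarrow> bool"
  where "is_basis J g S \<longleftrightarrow> finite J \<and> indep_fam J g \<and> S = fun_space.span (g ` J)"

lemma indep_famD:
  assumes "indep_fam J g" "(\<Sum>j\<in>J. fscale (c j) (g j)) = 0" "j \<in> J"
  shows "c j = 0"
proof -
  have "(\<Sum>j\<in>J. c j * g j x) = 0" for x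
    using fun_cong[OF assms(2), of x] by (simp add: sum_fun_apply fscale_apply)
  then show ?thesis using assms unfolding indep_fam_def by blast
qed

lemma indep_fam_inj: assumes "finite J" "indep_fam J g" shows "inj_on g J"
proof (rule inj_onI, rule ccontr)
  fix i j assume ij: "i \<in> J" "j \<in> J" "g i = g j" "i \<noteq> j"
  define c :: "'a \<Rightarrow> complex" where "c = (\<lambda>k. if k = i then 1 else if k = j then -1 else 0)"
  have "(\<Sum>k\<in>J. c k * g k x) = 0" for x
  proof -
    have "(\<Sum>k\<in>J. c k * g k x)
      = (\<Sum>k\<in>J. (if k = i then g k x else 0) - (if k = j then g k x else 0))"
      by (rule sum.cong) (use ij in \<open>auto simp: c_def\<close>)
    also have "\<dots> = 0" using ij assms by (simp add: sum_subtractf sum.delta')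
    finally show ?thesis .
  qed
  then have "c i = 0" using assms(2) ij(1) unfolding indep_fam_def by blast
  then show False by (simp add: c_def)
qed

lemma indep_fam_independent:
  assumes "finite J" "indep_fam J g" shows "fun_space.independent (g ` J)"
proof -
  have inj: "inj_on g J" by (rule indep_fam_inj[OF assms])
  show ?thesis
  proof (subst fun_space.independent_explicit_finite_subsets, intro allI impI ballI)
    fix A u b assume A: "A \<subseteq> g ` J" "finite A" "(\<Sum>a\<in>A. fscale (u a) a) = 0" "b \<in> A"
    let ?c = "\<lambda>j. if g j \<in> A then u (g j) else 0"
    obtain j where j: "j \<in> J" "b = g j" using A by auto
    have "(\<Sum>j\<in>J. fscale (?c j) (g j)) = (\<Sum>a\<in>g ` J. fscale (if a \<in> A then u a else 0) a)"
      by (subst sum.reindex[OF inj]) simp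
    also have "\<dots> = (\<Sum>a\<in>A. fscale (if a \<in> A then u a else 0) a)"
      by (rule sum.mono_neutral_right) (use assms A in \<open>auto simp: fun_eq_iff\<close>)
    also have "\<dots> = 0" using A(3) by simp
    finally have "?c j = 0" using indep_famD[OF assms(2), of ?c j] j by blast
    then show "u b = 0" using j A by simp
  qed
qed

lemma is_basis_dim: "is_basis J g S \<Longrightarrow> fun_space.dim S = card J"
  unfolding is_basis_def
  by (metis card_image fun_space.dim_span_eq_card_independent indep_fam_independent indep_fam_inj)

lemma span_fam:
  assumes "finite J" "x \<in> fun_space.span (g ` J)"
  obtains c where "x = (\<Sum>j\<in>J. fscale (c j) (g j))"
proof -
  have "\<exists>c. x = (\<Sum>j\<in>J. fscale (c j) (g j))" using assms(2)
  proof (induction rule: fun_space.span_induct_alt)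
    case base
    show ?case by (rule exI[of _ "\<lambda>_. 0"]) (simp add: fun_eq_iff sum_fun_apply fscale_apply)
  next
    case (step c v y)
    then obtain j d where j: "j \<in> J" "v = g j" "y = (\<Sum>j\<in>J. fscale (d j) (g j))"
      by (metis imageE)
    show ?case
    proof (rule exI[of _ "\<lambda>i. d i + (if i = j then c else 0)"])
      have "(\<Sum>i\<in>J. fscale (d i + (if i = j then c else 0)) (g i))
        = (\<Sum>i\<in>J. fscale (d i) (g i)) + (\<Sum>i\<in>J. if i = j then fscale c (g i) else 0)"
        by (simp add: sum.distrib[symmetric], rule sum.cong) (auto simp: fun_eq_iff algebra_simps)
      also have "\<dots> = fscale c v + y" using j assms by (simp add: sum.delta' add.commute)
      finally show "fscale c v + y = (\<Sum>i\<in>J. fscale (d i + (if i = j then c else 0)) (g i))" ..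
    qed
  qed
  then show thesis using that by blast
qed

lemma fam_in_span: "(\<Sum>j\<in>J. fscale (c j) (g j)) \<in> fun_space.span (g ` J)"
  by (intro fun_space.span_sum fun_space.span_scale fun_space.span_base) simp

lemma is_basis_mem: "is_basis J g S \<Longrightarrow> j \<in> J \<Longrightarrow> g j \<in> S"
  by (auto simp: is_basis_def intro: fun_space.span_base)

lemma indep_fam_id: "finite B \<Longrightarrow> fun_space.independent B \<Longrightarrow> indep_fam B (\<lambda>b. b)"
  unfolding indep_fam_def
proof (intro allI impI)
  fix c assume B: "finite B" "fun_space.independent B" and 0: "\<forall>x. (\<Sum>b\<in>B. c b * b x) = 0"
  have "(\<Sum>b\<in>B. fscale (c b) b) = 0"
    using 0 by (simp add: fun_eq_iff sum_fun_apply fscale_apply)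
  then show "\<forall>b\<in>B. c b = 0"
    using B unfolding fun_space.independent_explicit_finite_subsets by blast
qed

lemma subspace_basis:
  assumes "fun_space.subspace S" "S \<subseteq> fun_space.span B" "finite B"
  obtains C where "is_basis C (\<lambda>b. b) S" "C \<subseteq> S"
proof -
  obtain C where C: "C \<subseteq> S" "fun_space.independent C" "S \<subseteq> fun_space.span C"
    by (rule fun_space.maximal_independent_subset)
  have f: "finite C" using fun_space.independent_span_bound[OF assms(3) C(2)] C assms by auto
  have "S = fun_space.span C" using C assms(1) fun_space.span_minimal by blast
  then have "is_basis C (\<lambda>b. b) S"
    unfolding is_basis_def using f indep_fam_id[OF f C(2)] by simp
  with C show thesis using that by blast
qed

lemma linear_fam:
  assumes "Vector_Spaces.linear fscale fscale L"
  shows "L (\<Sum>j\<in>J. fscale (c j) (g j)) = (\<Sum>j\<in>J. fscale (c j) (L (g j)))"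
  by (simp only: fun_pair.linear_sum[OF assms] fun_pair.linear_scale[OF assms])

lemma is_basis_image:
  assumes "is_basis J g S" "Vector_Spaces.linear fscale fscale L" "\<And>x. x \<in> S \<Longrightarrow> L x = 0 \<Longrightarrow> x = 0"
  shows "is_basis J (\<lambda>j. L (g j)) (L ` S)"
proof -
  have "indep_fam J (\<lambda>j. L (g j))"
    unfolding indep_fam_def
  proof (intro allI impI)
    fix c assume "\<forall>x. (\<Sum>j\<in>J. c j * L (g j) x) = 0"
    then have "L (\<Sum>j\<in>J. fscale (c j) (g j)) = 0"
      by (subst linear_fam[OF assms(2)]) (simp add: fun_eq_iff sum_fun_apply fscale_apply)
    then have "(\<Sum>j\<in>J. fscale (c j) (g j)) = 0"
      using assms(1) fam_in_span[of c g J] by (intro assms(3)) (simp_all only: is_basis_def)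
    then show "\<forall>j\<in>J. c j = 0" using indep_famD[of J g c] assms(1) by (simp add: is_basis_def)
  qed
  moreover have "L ` S = fun_space.span ((\<lambda>j. L (g j)) ` J)"
    using assms(1) fun_pair.linear_span_image[OF assms(2), of "g ` J"]
    by (simp add: is_basis_def image_image)
  ultimately show ?thesis using assms(1) by (simp add: is_basis_def)
qed

lemma dim_linear_image:
  assumes "fun_space.subspace S" "S \<subseteq> fun_space.span B" "finite B"
    "Vector_Spaces.linear fscale fscale L" "\<And>x. x \<in> S \<Longrightarrow> L x = 0 \<Longrightarrow> x = 0"
  shows "fun_space.dim (L ` S) = fun_space.dim S"
proof -
  obtain C where "is_basis C (\<lambda>b. b) S" using subspace_basis[OF assms(1-3)] by blast
  then show ?thesis
    using is_basis_image[OF _ assms(4,5)] is_basis_dim by (metis (mono_tags, lifting))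
qed

text \<open>Substituting one expansion into the other writes \<open>g i\<close> in terms of the
  family \<open>g\<close> itself, and independence leaves only the identity coefficients.\<close>

lemma basis_change_inverse:
  assumes that: "i \<in> J" "k \<in> J" "finite J" "finite J'" "indep_fam J g"
    "\<And>i. i \<in> J \<Longrightarrow> g i = (\<Sum>j\<in>J'. fscale (P i j) (g' j))"
    "\<And>i. i \<in> J' \<Longrightarrow> g' i = (\<Sum>j\<in>J. fscale (Q i j) (g j))"
  shows "(\<Sum>j\<in>J'. P i j * Q j k) = (if i = k then 1 else 0)"
proof -
  have "(\<Sum>k\<in>J. fscale ((\<Sum>j\<in>J'. P i j * Q j k) - (if i = k then 1 else 0)) (g k)) x = 0" for x
  proof -
    have "(\<Sum>k\<in>J. fscale ((\<Sum>j\<in>J'. P i j * Q j k) - (if i = k then 1 else 0)) (g k)) x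
      = (\<Sum>k\<in>J. (\<Sum>j\<in>J'. P i j * (Q j k * g k x)) - (if i = k then g k x else 0))"
      by (simp add: sum_fun_apply fscale_apply, rule sum.cong) (auto simp: algebra_simps sum_distrib_left)
    also have "\<dots> = (\<Sum>j\<in>J'. P i j * (\<Sum>k\<in>J. Q j k * g k x)) - g i x"
      using that by (simp add: sum_subtractf sum_distrib_left sum.swap[of _ J J'])
    also have "(\<Sum>j\<in>J'. P i j * (\<Sum>k\<in>J. Q j k * g k x)) = (\<Sum>j\<in>J'. P i j * g' j x)"
      using that(7) by (intro sum.cong refl) (simp add: sum_fun_apply fscale_apply)
    also have "\<dots> = g i x" using that(6)[OF that(1)] by (simp add: sum_fun_apply fscale_apply)
    finally show ?thesis by (simp only: diff_self)
  qed
  then have "(\<Sum>k\<in>J. fscale ((\<Sum>j\<in>J'. P i j * Q j k) - (if i = k then 1 else 0)) (g k)) = 0"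
    by (intro ext, unfold zero_fun_apply)
  from indep_famD[OF that(5) this that(2)] show ?thesis by simp
qed

text \<open>A trace argument: the transition matrices \<open>P\<close> and \<open>Q\<close> are
  mutually inverse and a nonzero entry \<open>P i j\<close> forces equal labels, so the sum of
  \<open>P i j * Q j i\<close> over the pairs with label \<open>\<mu>\<close> counts that label in
  either basis. The characters have to separate labels across the two bases, which in the
  application follows from equal total degrees.\<close>

lemma weight_count:
  fixes L :: "'t \<Rightarrow> ('a \<Rightarrow> complex) \<Rightarrow> 'a \<Rightarrow> complex" and ch :: "'w \<Rightarrow> 't \<Rightarrow> complex"
  assumes b: "is_basis J g S" and b': "is_basis J' g' S"
    and lin: "\<And>t. t \<in> T \<Longrightarrow> Vector_Spaces.linear fscale fscale (L t)"
    and w: "\<And>t j. t \<in> T \<Longrightarrow> j \<in> J \<Longrightarrow> L t (g j) = fscale (ch (lab j) t) (g j)"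
    and w': "\<And>t j. t \<in> T \<Longrightarrow> j \<in> J' \<Longrightarrow> L t (g' j) = fscale (ch (lab' j) t) (g' j)"
    and sep: "\<And>i j. i \<in> J \<Longrightarrow> j \<in> J' \<Longrightarrow> (\<And>t. t \<in> T \<Longrightarrow> ch (lab i) t = ch (lab' j) t) \<Longrightarrow> lab i = lab' j"
  shows "card {j \<in> J. lab j = \<mu>} = card {j \<in> J'. lab' j = \<mu>}"
proof -
  have fin: "finite J" "finite J'" using b b' by (auto simp: is_basis_def)
  have "\<forall>i\<in>J. \<exists>c. g i = (\<Sum>j\<in>J'. fscale (c j) (g' j))"
    using is_basis_mem[OF b] b' span_fam[OF fin(2)] unfolding is_basis_def by metis
  then obtain P where P: "\<And>i. i \<in> J \<Longrightarrow> g i = (\<Sum>j\<in>J'. fscale (P i j) (g' j))" by metis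
  have "\<forall>i\<in>J'. \<exists>c. g' i = (\<Sum>j\<in>J. fscale (c j) (g j))"
    using is_basis_mem[OF b'] b span_fam[OF fin(1)] unfolding is_basis_def by metis
  then obtain Q where Q: "\<And>i. i \<in> J' \<Longrightarrow> g' i = (\<Sum>j\<in>J. fscale (Q i j) (g j))" by metis
  have PQ: "(\<Sum>j\<in>J'. P i j * Q j i) = 1" if "i \<in> J" for i
    using basis_change_inverse[of i J i J' g P g' Q] that fin b P Q by (simp add: is_basis_def)
  have QP: "(\<Sum>i\<in>J. Q j i * P i j) = 1" if "j \<in> J'" for j
    using basis_change_inverse[of j J' j J g' Q g P] that fin b' P Q by (simp add: is_basis_def)
  \<comment> \<open>Applying \<open>L t\<close> to the expansion of \<open>g i\<close> and
    subtracting its eigenvalue times the expansion leaves a relation among the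
    \<open>g' j\<close>.\<close>
  have eq: "lab i = lab' j" if ij: "i \<in> J" "j \<in> J'" "P i j \<noteq> 0" for i j
  proof (rule sep[OF ij(1,2)])
    fix t assume t: "t \<in> T"
    have "fscale (ch (lab i) t) (g i) = (\<Sum>j\<in>J'. fscale (P i j) (fscale (ch (lab' j) t) (g' j)))"
      using w[OF t ij(1)] linear_fam[OF lin[OF t], of "P i" g' J'] P[OF ij(1)] w'[OF t] by simp
    then have "(\<Sum>j\<in>J'. fscale (P i j * (ch (lab i) t - ch (lab' j) t)) (g' j)) = 0"
      using P[OF ij(1)]
      by (simp add: fun_eq_iff sum_fun_apply fscale_apply algebra_simps sum_subtractf sum_distrib_left)
    then show "ch (lab i) t = ch (lab' j) t"
      using indep_famD[of J' g' "\<lambda>j. P i j * (ch (lab i) t - ch (lab' j) t)" j] b' ij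
      by (auto simp: is_basis_def)
  qed
  let ?d = "\<lambda>x. if x = \<mu> then 1 else 0 :: complex"
  have "(\<Sum>i\<in>J. ?d (lab i)) = (\<Sum>i\<in>J. \<Sum>j\<in>J'. ?d (lab i) * (P i j * Q j i))"
    using PQ by (intro sum.cong refl) (simp add: sum_distrib_left[symmetric])
  also have "\<dots> = (\<Sum>i\<in>J. \<Sum>j\<in>J'. ?d (lab' j) * (Q j i * P i j))"
  proof (intro sum.cong refl)
    fix i j assume "i \<in> J" "j \<in> J'"
    then show "?d (lab i) * (P i j * Q j i) = ?d (lab' j) * (Q j i * P i j)"
      using eq[of i j] by (cases "P i j = 0") auto
  qed
  also have "\<dots> = (\<Sum>j\<in>J'. ?d (lab' j) * (\<Sum>i\<in>J. Q j i * P i j))"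
    by (subst sum.swap) (simp add: sum_distrib_left)
  also have "\<dots> = (\<Sum>j\<in>J'. ?d (lab' j))" using QP by (intro sum.cong refl) simp
  finally have "of_nat (card {j \<in> J. lab j = \<mu>}) = (of_nat (card {j \<in> J'. lab' j = \<mu>}) :: complex)"
    using fin by (simp add: sum.If_cases Int_def)
  then show ?thesis using of_nat_eq_iff by blast
qed

text \<open>The relation asks for a linear map of the ambient spaces, so the inverse bijection has
  to be extended; a linear left inverse of the map on \<open>S\<close> does this.\<close>

lemma lin_isomorphic_sym:
  assumes "S \<cong>\<^sub>l T" "fun_space.subspace S" shows "T \<cong>\<^sub>l S"
proof -
  obtain f where f: "Vector_Spaces.linear fscale fscale f" "bij_betw f S T"
    using assms(1) by (auto simp: lin_isomorphic_def)
  obtain g where g: "range g \<subseteq> S" "Vector_Spaces.linear fscale fscale g" "\<forall>v\<in>S. g (f v) = v"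
    using fun_pair.linear_exists_left_inverse_on[OF f(1) assms(2)] f(2) by (auto simp: bij_betw_def)
  have "bij_betw g T S" using f(2) g
    by (intro bij_betw_byWitness[where f'=f]) (auto simp: bij_betw_def)
  then show ?thesis using g(2) by (auto simp: lin_isomorphic_def)
qed

section \<open>Hermitian inner products and orthogonal projection\<close>

definition cinner :: "'i set \<Rightarrow> ('i \<Rightarrow> complex) \<Rightarrow> ('i \<Rightarrow> complex) \<Rightarrow> complex"
  where "cinner I x y = (\<Sum>i\<in>I. cnj (x i) * y i)"

lemma cinner_simps:
  "cinner I (x + y) z = cinner I x z + cinner I y z"
  "cinner I z (x + y) = cinner I z x + cinner I z y"
  "cinner I (x - y) z = cinner I x z - cinner I y z"
  "cinner I z (x - y) = cinner I z x - cinner I z y"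
  "cinner I (fscale c x) z = cnj c * cinner I x z"
  "cinner I z (fscale c x) = c * cinner I z x"
  "cinner I 0 z = 0" "cinner I z 0 = 0"
  by (simp_all add: cinner_def fscale_apply algebra_simps sum.distrib sum_subtractf sum_distrib_left)

lemma cinner_commute: "cinner I y x = cnj (cinner I x y)"
  by (simp add: cinner_def mult.commute)

lemma cinner_self_eq_0:
  assumes "finite I" "cinner I x x = 0" "i \<in> I" shows "x i = 0"
proof -
  have "cinner I x x = complex_of_real (\<Sum>i\<in>I. (cmod (x i))\<^sup>2)"
    by (simp add: cinner_def complex_norm_square[symmetric] mult.commute del: of_real_power)
  then have "(\<Sum>i\<in>I. (cmod (x i))\<^sup>2) = 0" using assms(2) by (metis of_real_eq_0_iff)
  then show ?thesis using assms by (simp add: sum_nonneg_eq_0_iff)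
qed

text \<open>Gram-Schmidt: the new vector \<open>b\<close> is replaced by its component
  \<open>c\<close> orthogonal to the old span, and the projection of \<open>x\<close> to the line of
  \<open>c\<close> is added.\<close>

lemma orth_proj_finite:
  assumes "finite I" "finite B"
  shows "\<exists>y\<in>fun_space.span B. \<forall>z\<in>fun_space.span B. cinner I z (x - y) = 0"
  using assms(2)
proof (induction B arbitrary: x rule: finite_induct)
  case empty
  show ?case by (rule bexI[of _ 0]) (simp_all only: fun_space.span_empty cinner_simps ball_simps diff_self insert_iff simp_thms)
next
  case (insert b B)
  obtain y0 where y0: "y0 \<in> fun_space.span B" "\<forall>z\<in>fun_space.span B. cinner I z (b - y0) = 0"
    using insert.IH by blast
  obtain y1 where y1: "y1 \<in> fun_space.span B" "\<forall>z\<in>fun_space.span B. cinner I z (x - y1) = 0"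
    using insert.IH by blast
  define c where "c = b - y0"
  define k where "k = cinner I c x / cinner I c c"
  have sub: "fun_space.span B \<subseteq> fun_space.span (insert b B)" by (rule fun_space.span_mono) auto
  have cc: "c \<in> fun_space.span (insert b B)"
    unfolding c_def using y0 sub by (intro fun_space.span_diff) (auto intro: fun_space.span_base)
  have 1: "cinner I c y = 0" if "y \<in> fun_space.span B" for y
    using y0(2) that cinner_commute[of I c y] by (simp add: c_def)
  have 2: "cinner I c (x - (y1 + fscale k c)) = 0"
  proof (cases "cinner I c c = 0")
    case True
    \<comment> \<open>The form ignores values outside \<open>I\<close>, so \<open>c\<close> can be
      null without being zero; it then vanishes on \<open>I\<close> and pairs to zero with
      everything.\<close>
    then have "cinner I c w = 0" for w
      using cinner_self_eq_0[OF assms(1) True] by (simp add: cinner_def)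
    then show ?thesis by blast
  next
    case False
    then show ?thesis using 1[OF y1(1)] by (simp add: cinner_simps k_def)
  qed
  show ?case
  proof (intro bexI[of _ "y1 + fscale k c"] ballI)
    show "y1 + fscale k c \<in> fun_space.span (insert b B)"
      using cc y1(1) sub by (intro fun_space.span_add fun_space.span_scale) auto
    fix z assume "z \<in> fun_space.span (insert b B)"
    then obtain m where m: "z - fscale m b \<in> fun_space.span B"
      by (auto simp: fun_space.span_insert)
    define z' where "z' = z - fscale m b + fscale m y0"
    have z': "z' \<in> fun_space.span B"
      unfolding z'_def using m y0 by (intro fun_space.span_add fun_space.span_scale)
    have z: "z = z' + fscale m c" by (simp add: z'_def c_def fun_eq_iff algebra_simps)
    have "cinner I z' (x - (y1 + fscale k c)) = cinner I z' (x - y1) - k * cinner I z' c"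
      by (simp add: cinner_simps)
    also have "\<dots> = 0" using y1(2) y0(2) z' by (simp add: c_def)
    finally show "cinner I z (x - (y1 + fscale k c)) = 0"
      using 2 by (simp add: z cinner_simps(1,5))
  qed
qed

definition supported :: "'i set \<Rightarrow> ('i \<Rightarrow> complex) set"
  where "supported I = {x. \<forall>i. i \<notin> I \<longrightarrow> x i = 0}"

definition unit_fun :: "'i \<Rightarrow> 'i \<Rightarrow> complex"
  where "unit_fun i = (\<lambda>j. if j = i then 1 else 0)"

lemma supported_expand:
  assumes "finite I" "x \<in> supported I" shows "x = (\<Sum>i\<in>I. fscale (x i) (unit_fun i))"
  using assms by (auto simp: supported_def unit_fun_def fun_eq_iff sum_fun_apply fscale_apply if_distrib sum.delta
      cong: if_cong)

lemma supported_span: "finite I \<Longrightarrow> supported I \<subseteq> fun_space.span (unit_fun ` I)"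
  using supported_expand fam_in_span by (metis subsetI)

lemma subspace_supported: "fun_space.subspace (supported I)"
  by (auto simp: fun_space.subspace_def supported_def fscale_apply)

lemma supported_subspace_basis:
  assumes "finite I" "fun_space.subspace S" "S \<subseteq> supported I"
  obtains C where "is_basis C (\<lambda>b. b) S" "C \<subseteq> S"
  using subspace_basis[OF assms(2), of "unit_fun ` I"] assms supported_span by blast

lemma orth_proj:
  assumes "finite I" "fun_space.subspace S" "S \<subseteq> supported I"
  obtains y where "y \<in> S" "\<And>z. z \<in> S \<Longrightarrow> cinner I z (x - y) = 0"
proof -
  obtain C where "is_basis C (\<lambda>b. b) S" using supported_subspace_basis[OF assms] by blast
  then show thesis using orth_proj_finite[OF assms(1), of C x] that by (auto simp: is_basis_def)
qed

text \<open>The vectors \<open>x j\<close> may be dependent and infinite in number. A maximal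
  independent subset \<open>B\<close> of them is sent to the prescribed values through chosen
  indices \<open>\<iota> b\<close>; any other \<open>x j\<close> is tied to \<open>B\<close> by a
  relation, which the hypothesis transfers to the \<open>y j\<close>.\<close>

lemma linear_of_relations:
  assumes "\<And>F c. finite F \<Longrightarrow> F \<subseteq> A \<Longrightarrow> (\<Sum>j\<in>F. fscale (c j) (x j)) = 0 \<Longrightarrow>
    (\<Sum>j\<in>F. fscale (c j) (y j)) = 0"
  obtains L where "Vector_Spaces.linear fscale fscale L" "\<And>j. j \<in> A \<Longrightarrow> L (x j) = y j"
proof -
  obtain B where B: "B \<subseteq> x ` A" "fun_space.independent B" "x ` A \<subseteq> fun_space.span B"
    by (rule fun_space.maximal_independent_subset)
  define \<iota> where "\<iota> = inv_into A x"
  obtain L where L: "Vector_Spaces.linear fscale fscale L" "\<forall>b\<in>B. L b = y (\<iota> b)"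
    using fun_pair.linear_independent_extend[OF B(2), of "\<lambda>b. y (\<iota> b)"] by blast
  have \<iota>: "\<iota> b \<in> A" "x (\<iota> b) = b" if "b \<in> B" for b
    using that B(1) unfolding \<iota>_def by (auto simp: inv_into_into f_inv_into_f)
  have "L (x j) = y j" if j: "j \<in> A" for j
  proof -
    obtain t r where t: "finite t" "t \<subseteq> B" "x j = (\<Sum>a\<in>t. fscale (r a) a)"
      using B(3) j unfolding fun_space.span_explicit by blast
    have inj: "inj_on \<iota> t" using \<iota>(2) t(2) by (metis inj_onI subsetD)
    show ?thesis
    proof (cases "j \<in> \<iota> ` t")
      case True
      then show ?thesis using L(2) \<iota> t(2) by auto
    next
      case False
      \<comment> \<open>The expansion of \<open>x j\<close> in \<open>B\<close>, rewritten as a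
        relation indexed by \<open>j\<close> and the chosen indices, so that the hypothesis applies
        to it.\<close>
      let ?c = "\<lambda>i. if i = j then 1 else - r (x i)"
      have s: "(\<Sum>i\<in>insert j (\<iota> ` t). fscale (?c i) (h i)) = h j - (\<Sum>b\<in>t. fscale (r b) (h (\<iota> b)))"
        for h :: "_ \<Rightarrow> 'e \<Rightarrow> complex"
      proof -
        have "(\<Sum>i\<in>\<iota> ` t. fscale (?c i) (h i)) = (\<Sum>b\<in>t. fscale (- r b) (h (\<iota> b)))"
          by (subst sum.reindex[OF inj], rule sum.cong) (use False \<iota>(2) t(2) in auto)
        then show ?thesis using False t(1)
          by (simp add: fun_space.scale_minus_left sum_negf)
      qed
      have "(\<Sum>b\<in>t. fscale (r b) (x (\<iota> b))) = x j"
        unfolding t(3) by (rule sum.cong) (use \<iota>(2) t(2) in auto)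
      then have "(\<Sum>i\<in>insert j (\<iota> ` t). fscale (?c i) (x i)) = 0" by (simp only: s) simp
      then have "(\<Sum>i\<in>insert j (\<iota> ` t). fscale (?c i) (y i)) = 0"
        by (intro assms) (use t j \<iota>(1) in auto)
      then have "y j = (\<Sum>b\<in>t. fscale (r b) (y (\<iota> b)))" by (simp only: s right_minus_eq)
      also have "\<dots> = L (x j)"
        unfolding t(3) by (subst linear_fam[OF L(1)], rule sum.cong) (use L(2) t(2) in auto)
      finally show ?thesis ..
    qed
  qed
  then show thesis using that L(1) by blast
qed

section \<open>The group and its highest weight vectors\<close>

definition mat3 :: "'a::zero \<Rightarrow> 'a \<Rightarrow> 'a \<Rightarrow> 'a \<Rightarrow> 'a \<Rightarrow> 'a \<Rightarrow> 'a \<Rightarrow> 'a \<Rightarrow> 'a \<Rightarrow> 'a^3^3"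
  where "mat3 a b c d e f g h i = vector [vector [a, b, c], vector [d, e, f], vector [g, h, i]]"

lemma mat3_nth [simp]:
  "mat3 a b c d e f g h i $ 1 $ 1 = a" "mat3 a b c d e f g h i $ 1 $ 2 = b"
  "mat3 a b c d e f g h i $ 1 $ 3 = c" "mat3 a b c d e f g h i $ 2 $ 1 = d"
  "mat3 a b c d e f g h i $ 2 $ 2 = e" "mat3 a b c d e f g h i $ 2 $ 3 = f"
  "mat3 a b c d e f g h i $ 3 $ 1 = g" "mat3 a b c d e f g h i $ 3 $ 2 = h"
  "mat3 a b c d e f g h i $ 3 $ 3 = i"
  by (simp_all add: mat3_def)

lemma mat3_eq_iff: "(A = B) \<longleftrightarrow> (A $ 1 $ 1 = B $ 1 $ 1 \<and> A $ 1 $ 2 = B $ 1 $ 2 \<and> A $ 1 $ 3 = B $ 1 $ 3 \<and>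
   A $ 2 $ 1 = B $ 2 $ 1 \<and> A $ 2 $ 2 = B $ 2 $ 2 \<and> A $ 2 $ 3 = B $ 2 $ 3 \<and>
   A $ 3 $ 1 = B $ 3 $ 1 \<and> A $ 3 $ 2 = B $ 3 $ 2 \<and> A $ 3 $ 3 = B $ 3 $ 3)" for A B :: "'a^3^3"
  by (auto simp: vec_eq_iff forall_3)

text \<open>The adjugate, which on \<open>SL3\<close> is the inverse. In contrast to
  \<open>matrix_inv\<close>, its entries are explicit polynomials.\<close>

definition adj3 :: "complex^3^3 \<Rightarrow> complex^3^3"
  where "adj3 G = mat3
    (G$2$2 * G$3$3 - G$2$3 * G$3$2) (G$1$3 * G$3$2 - G$1$2 * G$3$3) (G$1$2 * G$2$3 - G$1$3 * G$2$2)
    (G$2$3 * G$3$1 - G$2$1 * G$3$3) (G$1$1 * G$3$3 - G$1$3 * G$3$1) (G$1$3 * G$2$1 - G$1$1 * G$2$3)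
    (G$2$1 * G$3$2 - G$2$2 * G$3$1) (G$1$2 * G$3$1 - G$1$1 * G$3$2) (G$1$1 * G$2$2 - G$1$2 * G$2$1)"

lemma matrix_mult_3: "(A ** B) $ i $ j = A$i$1 * B$1$j + A$i$2 * B$2$j + A$i$3 * B$3$j"
  for A B :: "complex^3^3"
  by (simp add: matrix_matrix_mult_def sum_3)

lemma mat_1_nth: "(mat 1 :: complex^3^3) $ i $ j = (if i = j then 1 else 0)"
  by (simp add: mat_def)

lemma adj3_mult: "G \<in> SL3 \<Longrightarrow> G ** adj3 G = mat 1" "G \<in> SL3 \<Longrightarrow> adj3 G ** G = mat 1"
   apply (simp_all add: SL3_def det_3 mat3_eq_iff matrix_mult_3 adj3_def mat_1_nth)
   apply (intro conjI; (simp add: algebra_simps; fail | algebra))+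
  done

lemma matrix_inv_SL3: assumes "G \<in> SL3" shows "matrix_inv G = adj3 G"
proof -
  have "\<exists>B. G ** B = mat 1 \<and> B ** G = mat 1" using adj3_mult[OF assms] by blast
  then have "G ** matrix_inv G = mat 1 \<and> matrix_inv G ** G = mat 1"
    unfolding matrix_inv_def by (rule someI_ex)
  then show ?thesis using adj3_mult[OF assms] by (metis matrix_mul_assoc matrix_mul_lid matrix_mul_rid)
qed

lemma SL3_mult [intro]: "G \<in> SL3 \<Longrightarrow> H \<in> SL3 \<Longrightarrow> G ** H \<in> SL3"
  by (simp add: SL3_def det_mul)

lemma SL3_one [intro, simp]: "mat 1 \<in> SL3"
  by (simp add: SL3_def)

lemma SL3_adj3 [intro]: assumes "G \<in> SL3" shows "adj3 G \<in> SL3"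
  using arg_cong[OF adj3_mult(1)[OF assms], of det] assms by (simp add: SL3_def det_mul)

lemma adj3_unique: "G \<in> SL3 \<Longrightarrow> G ** H = mat 1 \<Longrightarrow> H = adj3 G"
  using adj3_mult by (metis matrix_mul_assoc matrix_mul_lid matrix_mul_rid)

lemma adj3_adj3: "G \<in> SL3 \<Longrightarrow> adj3 (adj3 G) = G"
  using adj3_unique[OF SL3_adj3 adj3_mult(2)] by metis

lemma adj3_mat_mult: "G \<in> SL3 \<Longrightarrow> H \<in> SL3 \<Longrightarrow> adj3 (G ** H) = adj3 H ** adj3 G"
  using adj3_unique[OF SL3_mult[of G H], of "adj3 H ** adj3 G"] adj3_mult(1)
  by (metis matrix_mul_assoc matrix_mul_rid)

lemma mat_tendsto:
  fixes G :: "complex^3^3"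
  assumes "\<And>i j. ((\<lambda>x. \<gamma> x $ i $ j) \<longlongrightarrow> G $ i $ j) F" shows "(\<gamma> \<longlongrightarrow> G) F"
  by (intro vec_tendstoI assms)

lemma mat3_tendsto:
  fixes G :: "complex^3^3"
  assumes "((\<lambda>x. \<gamma> x $ 1 $ 1) \<longlongrightarrow> G $ 1 $ 1) F" "((\<lambda>x. \<gamma> x $ 1 $ 2) \<longlongrightarrow> G $ 1 $ 2) F"
    "((\<lambda>x. \<gamma> x $ 1 $ 3) \<longlongrightarrow> G $ 1 $ 3) F" "((\<lambda>x. \<gamma> x $ 2 $ 1) \<longlongrightarrow> G $ 2 $ 1) F"
    "((\<lambda>x. \<gamma> x $ 2 $ 2) \<longlongrightarrow> G $ 2 $ 2) F" "((\<lambda>x. \<gamma> x $ 2 $ 3) \<longlongrightarrow> G $ 2 $ 3) F"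
    "((\<lambda>x. \<gamma> x $ 3 $ 1) \<longlongrightarrow> G $ 3 $ 1) F" "((\<lambda>x. \<gamma> x $ 3 $ 2) \<longlongrightarrow> G $ 3 $ 2) F"
    "((\<lambda>x. \<gamma> x $ 3 $ 3) \<longlongrightarrow> G $ 3 $ 3) F"
  shows "(\<gamma> \<longlongrightarrow> G) F"
proof (rule mat_tendsto)
  fix i j :: 3
  show "((\<lambda>x. \<gamma> x $ i $ j) \<longlongrightarrow> G $ i $ j) F"
    using exhaust_3[of i] exhaust_3[of j] assms by auto
qed

text \<open>A common framework for the given irreducibles and for the tensor powers used later:
  limits of group elements can be taken inside the matrix entries.\<close>

definition cont_rep :: "'i sl3_rep \<Rightarrow> bool"
  where "cont_rep R \<longleftrightarrow>
    finite (idx R) \<and>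
    (\<forall>v\<in>rep_space R. rep_act R (mat 1) v = v) \<and>
    (\<forall>G\<in>SL3. \<forall>H\<in>SL3. \<forall>v\<in>rep_space R. rep_act R (G ** H) v = rep_act R G (rep_act R H v)) \<and>
    (\<forall>i\<in>idx R. \<forall>j\<in>idx R. continuous_on SL3 (\<lambda>G. entry R G i j))"

lemma continuous_on_eval_poly:
  "continuous_on S (\<lambda>G :: complex^3^3. eval_poly (\<lambda>(a, b). G $ a $ b) p)"
  unfolding eval_poly_def by (auto intro!: continuous_intros simp: split_beta)

lemma is_rep_cont_rep: assumes "is_rep R" shows "cont_rep R"
  unfolding cont_rep_def
proof (intro conjI ballI)
  fix i j assume "i \<in> idx R" "j \<in> idx R"
  then obtain p where "\<forall>G\<in>SL3. entry R G i j = eval_poly (\<lambda>(a, b). G $ a $ b) p"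
    using assms unfolding is_rep_def by blast
  then show "continuous_on SL3 (\<lambda>G. entry R G i j)"
    using continuous_on_cong[OF refl, of SL3 "\<lambda>G. entry R G i j" "\<lambda>G. eval_poly (\<lambda>(a, b). G $ a $ b) p"]
      continuous_on_eval_poly by metis
qed (use assms in \<open>auto simp: is_rep_def\<close>)

lemma rep_space_supported: "rep_space R = supported (idx R)"
  by (simp add: rep_space_def supported_def)

lemma rep_act_closed: "rep_act R G v \<in> rep_space R"
  by (simp add: rep_act_def rep_space_def)

lemma fscale_linearI:
  assumes "\<And>x y. f (x + y) = f x + f y" "\<And>c x. f (fscale c x) = fscale c (f x)"
  shows "Vector_Spaces.linear fscale fscale f"
  using assms fun_pair.vector_space_pair_axioms
  unfolding Vector_Spaces.linear_iff vector_space_pair_def by blast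

lemma linear_rep_act: "Vector_Spaces.linear fscale fscale (rep_act R G)"
  by (rule fscale_linearI)
     (auto simp: rep_act_def fun_eq_iff fscale_def algebra_simps sum.distrib sum_distrib_left)

lemma cont_repD:
  assumes "cont_rep R"
  shows "finite (idx R)" "v \<in> rep_space R \<Longrightarrow> rep_act R (mat 1) v = v"
    "G \<in> SL3 \<Longrightarrow> H \<in> SL3 \<Longrightarrow> v \<in> rep_space R \<Longrightarrow> rep_act R (G ** H) v = rep_act R G (rep_act R H v)"
  using assms by (auto simp: cont_rep_def)

lemma rep_act_tendsto:
  assumes "cont_rep R" "(\<gamma> \<longlongrightarrow> G) F" "eventually (\<lambda>x. \<gamma> x \<in> SL3) F" "G \<in> SL3"
  shows "((\<lambda>x. rep_act R (\<gamma> x) v i) \<longlongrightarrow> rep_act R G v i) F"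
proof (cases "i \<in> idx R")
  case True
  have "((\<lambda>x. entry R (\<gamma> x) i j) \<longlongrightarrow> entry R G i j) F" if "j \<in> idx R" for j
    using continuous_on_tendsto_compose[OF _ assms(2,4,3), of "\<lambda>G. entry R G i j"] assms(1) True that
    by (auto simp: cont_rep_def)
  then show ?thesis using True by (auto simp: rep_act_def intro!: tendsto_intros)
qed (simp add: rep_act_def)

section \<open>The big cell and limits along one-parameter subgroups\<close>

definition lower :: "complex \<Rightarrow> complex \<Rightarrow> complex \<Rightarrow> complex^3^3"
  where "lower x y z = mat3 1 0 0 x 1 0 y z 1"

definition upper :: "complex \<Rightarrow> complex \<Rightarrow> complex \<Rightarrow> complex^3^3"
  where "upper x y z = mat3 1 x y 0 1 z 0 0 1"

definition diagm :: "complex \<Rightarrow> complex \<Rightarrow> complex \<Rightarrow> complex^3^3"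
  where "diagm x y z = mat3 x 0 0 0 y 0 0 0 z"

lemma diagm_diag3: "diagm x y z = diag3 (vector [x, y, z])"
  by (simp add: diagm_def diag3_def mat3_eq_iff)

lemma upper_SL3 [simp]: "upper x y z \<in> SL3"
  and lower_SL3 [simp]: "lower x y z \<in> SL3"
  and diagm_SL3 [simp]: "diagm x y z \<in> SL3 \<longleftrightarrow> x * y * z = 1"
  by (simp_all add: SL3_def det_3 upper_def lower_def diagm_def)

lemma upper_unipotent_upper [simp]: "upper x y z \<in> upper_unipotent"
  by (simp add: upper_unipotent_def upper_def forall_3)

text \<open>Gaussian elimination with pivots \<open>p\<close>, \<open>q / p\<close>,
  \<open>1 / q\<close>, the ratios of successive leading principal minors;
  \<open>adj3 G $ 3 $ 3\<close> is the minor of size two.\<close>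

lemma LDU:
  assumes "G \<in> SL3" "G$1$1 \<noteq> 0" "adj3 G $3$3 \<noteq> 0"
  obtains x y z a b c x' y' z' where "G = lower x y z ** (diagm a b c ** upper x' y' z')"
    "a * b * c = 1" "a = G$1$1" "a * b = adj3 G $3$3"
proof -
  let ?p = "G$1$1" and ?q = "adj3 G $3$3"
  have q: "?q = G$1$1 * G$2$2 - G$1$2 * G$2$1" by (simp add: adj3_def)
  have d: "G$1$1 * G$2$2 * G$3$3 + G$1$2 * G$2$3 * G$3$1 + G$1$3 * G$2$1 * G$3$2
    - G$1$1 * G$2$3 * G$3$2 - G$1$2 * G$2$1 * G$3$3 - G$1$3 * G$2$2 * G$3$1 = 1"
    using assms(1) by (simp add: SL3_def det_3)
  let ?L = "lower (G$2$1 / ?p) (G$3$1 / ?p) ((G$1$1 * G$3$2 - G$1$2 * G$3$1) / ?q)"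
  let ?U = "upper (G$1$2 / ?p) (G$1$3 / ?p) ((G$1$1 * G$2$3 - G$1$3 * G$2$1) / ?q)"
  \<comment> \<open>The product is expanded with the pivots left free; they are specialised to the
    minors of \<open>G\<close> afterwards.\<close>
  have m: "?L ** (diagm p (q / p) (1 / q) ** ?U) = mat3 p (p * (G$1$2 / ?p)) (p * (G$1$3 / ?p))
     (G$2$1 / ?p * p) (G$2$1 / ?p * p * (G$1$2 / ?p) + q / p)
     (G$2$1 / ?p * p * (G$1$3 / ?p) + q / p * ((G$1$1 * G$2$3 - G$1$3 * G$2$1) / ?q))
     (G$3$1 / ?p * p) (G$3$1 / ?p * p * (G$1$2 / ?p) + (G$1$1 * G$3$2 - G$1$2 * G$3$1) / ?q * (q / p))
     (G$3$1 / ?p * p * (G$1$3 / ?p) + (G$1$1 * G$3$2 - G$1$2 * G$3$1) / ?q * (q / p) *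
        ((G$1$1 * G$2$3 - G$1$3 * G$2$1) / ?q) + 1 / q)" for p q
    by (simp add: mat3_eq_iff matrix_mult_3 lower_def upper_def diagm_def algebra_simps)
  have "G = ?L ** (diagm ?p (?q / ?p) (1 / ?q) ** ?U)"
  proof -
    \<comment> \<open>The determinant condition enters in this entry; the other entries are
      identities in the entries of \<open>G\<close> once the minors are nonzero.\<close>
    have 1: "G$3$1 / ?p * ?p * (G$1$3 / ?p) + (G$1$1 * G$3$2 - G$1$2 * G$3$1) / ?q * (?q / ?p) *
        ((G$1$1 * G$2$3 - G$1$3 * G$2$1) / ?q) + 1 / ?q = G$3$3"
    proof -
      have "G$3$3 * (?p * ?q) = G$3$1 * G$1$3 * ?q +
        (G$1$1 * G$3$2 - G$1$2 * G$3$1) * (G$1$1 * G$2$3 - G$1$3 * G$2$1) + ?p"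
        unfolding q using d by algebra
      moreover have "(G$3$1 * G$1$3 * ?q + (G$1$1 * G$3$2 - G$1$2 * G$3$1) *
          (G$1$1 * G$2$3 - G$1$3 * G$2$1) + ?p) / (?p * ?q) = G$3$1 / ?p * ?p * (G$1$3 / ?p) +
          (G$1$1 * G$3$2 - G$1$2 * G$3$1) / ?q * (?q / ?p) *
          ((G$1$1 * G$2$3 - G$1$3 * G$2$1) / ?q) + 1 / ?q"
        using assms(2,3) by (simp add: add_divide_distrib)
      ultimately show ?thesis using assms(2,3) by (metis nonzero_mult_div_cancel_right mult_eq_0_iff)
    qed
    have 2: "G$2$1 / ?p * ?p * (G$1$2 / ?p) + ?q / ?p = G$2$2"
      using assms(2) by (simp add: q field_simps)
    have 3: "G$2$1 / ?p * ?p * (G$1$3 / ?p) + ?q / ?p * ((G$1$1 * G$2$3 - G$1$3 * G$2$1) / ?q) = G$2$3"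
      using assms(2,3) by (simp add: field_simps)
    have 4: "G$3$1 / ?p * ?p * (G$1$2 / ?p) + (G$1$1 * G$3$2 - G$1$2 * G$3$1) / ?q * (?q / ?p) = G$3$2"
      using assms(2,3) by (simp add: field_simps)
    show ?thesis unfolding m 1 2 3 4 using assms(2) by (simp add: mat3_eq_iff)
  qed
  then show thesis using that assms(2,3) by simp
qed

text \<open>The matrix coefficient of the highest weight vector of weight \<open>a \<omega>\<^sub>1 + b \<omega>\<^sub>2\<close>.\<close>

definition hw_coeff :: "nat \<Rightarrow> nat \<Rightarrow> complex^3^3 \<Rightarrow> complex"
  where "hw_coeff a b G = (G $ 1 $ 1) ^ a * (adj3 G $ 3 $ 3) ^ b"

lemma highest_weight_vectorD:
  assumes "highest_weight_vector R a b v"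
  shows "v \<in> rep_space R" "v \<noteq> 0" "rep_act R (upper x y z) v = v"
    "x * y * z = 1 \<Longrightarrow> rep_act R (diagm x y z) v = fscale (x ^ a * (x * y) ^ b) v"
  using assms by (simp_all add: highest_weight_vector_def diagm_diag3)

text \<open>In the decomposition \<open>LDU\<close> the upper unipotent factor fixes
  \<open>v\<close> and the diagonal factor scales it by its weight.\<close>

lemma hw_big_cell:
  assumes R: "cont_rep R" and v: "highest_weight_vector R a b v"
    and G: "G \<in> SL3" "G$1$1 \<noteq> 0" "adj3 G $3$3 \<noteq> 0"
  obtains x y z where "rep_act R G v = fscale (hw_coeff a b G) (rep_act R (lower x y z) v)"
proof -
  note vR = highest_weight_vectorD[OF v]
  obtain x y z p q r x' y' z' where LDU: "G = lower x y z ** (diagm p q r ** upper x' y' z')"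
    "p * q * r = 1" "p = G$1$1" "p * q = adj3 G $3$3"
    using LDU[OF G] by metis
  have "rep_act R G v = rep_act R (lower x y z) (rep_act R (diagm p q r ** upper x' y' z') v)"
    unfolding LDU(1) using LDU(2) by (intro cont_repD(3)[OF R] vR) auto
  also have "rep_act R (diagm p q r ** upper x' y' z') v = fscale (hw_coeff a b G) v"
    using LDU by (subst cont_repD(3)[OF R]) (auto simp: vR hw_coeff_def)
  finally show thesis using that by (simp only: fun_pair.linear_scale[OF linear_rep_act])
qed

text \<open>Up to the scalar \<open>hw_coeff a b G\<close>, the vector is a lower unipotent
  translate of \<open>v\<close>. The torus element diag(s, 1, 1/s) contracts the lower unipotent
  group to the identity as s grows and scales \<open>v\<close> by \<open>s ^ (a + b)\<close>; after
  division by that power the limit is a multiple of \<open>v\<close>.\<close>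

lemma hw_limit:
  assumes R: "cont_rep R" and v: "highest_weight_vector R a b v"
    and G: "G \<in> SL3" "G$1$1 \<noteq> 0" "adj3 G $3$3 \<noteq> 0"
  shows "((\<lambda>s::real. inverse (of_real s) ^ (a + b) * rep_act R (diagm (of_real s) 1 (inverse (of_real s)))
    (rep_act R G v) i) \<longlongrightarrow> hw_coeff a b G * v i) at_top"
proof -
  note vR = highest_weight_vectorD(1)[OF v] and T = highest_weight_vectorD(4)[OF v]
  obtain x y z where Gv: "rep_act R G v = fscale (hw_coeff a b G) (rep_act R (lower x y z) v)"
    using hw_big_cell[OF R v G] by blast
  let ?d = "\<lambda>s::real. diagm (of_real s) 1 (inverse (of_real s))"
  \<comment> \<open>Conjugation by diag(s, 1, 1/s) multiplies the three entries by the values of the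
    negative roots, which are 1/s, 1/s^2 and 1/s.\<close>
  let ?u = "\<lambda>s::real. lower (x / of_real s) (y / (of_real s)\<^sup>2) (z / of_real s)"
  have eq: "inverse (of_real s) ^ (a + b) * rep_act R (?d s) (rep_act R G v) i
      = hw_coeff a b G * rep_act R (?u s) v i" if "s > 0" for s
  proof -
    have d: "?d s \<in> SL3" using that by simp
    have c: "?d s ** lower x y z = ?u s ** ?d s"
      using that by (simp add: mat3_eq_iff matrix_mult_3 lower_def diagm_def field_simps power2_eq_square)
    have "rep_act R (?d s) (rep_act R (lower x y z) v) = rep_act R (?d s ** lower x y z) v"
      using cont_repD(3)[OF R d lower_SL3 vR] by simp
    also have "\<dots> = rep_act R (?u s) (rep_act R (?d s) v)"
      unfolding c by (rule cont_repD(3)[OF R lower_SL3 d vR])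
    also have "rep_act R (?d s) v = fscale (of_real s ^ (a + b)) v"
      using that by (subst T) (simp_all add: power_add)
    finally have "rep_act R (?d s) (rep_act R (lower x y z) v)
        = fscale (of_real s ^ (a + b)) (rep_act R (?u s) v)"
      by (simp only: fun_pair.linear_scale[OF linear_rep_act])
    then show ?thesis
      using that unfolding Gv
      by (simp only: fun_pair.linear_scale[OF linear_rep_act])
         (simp add: fscale_apply field_simps)
  qed
  have "((\<lambda>s::real. complex_of_real (inverse s)) \<longlongrightarrow> of_real 0) at_top"
    by (intro tendsto_of_real tendsto_inverse_0_at_top filterlim_ident)
  then have inv: "((\<lambda>s::real. inverse (complex_of_real s)) \<longlongrightarrow> 0) at_top"
    by (simp only: of_real_inverse of_real_0)
  have lim: "((\<lambda>s. ?u s) \<longlongrightarrow> mat 1) at_top"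
  proof (rule mat3_tendsto)
    have "((\<lambda>s::real. c * inverse (complex_of_real s)) \<longlongrightarrow> c * 0) at_top" for c
      by (intro tendsto_intros inv)
    then show "((\<lambda>s. ?u s $ 2 $ 1) \<longlongrightarrow> (mat 1 :: complex^3^3) $ 2 $ 1) at_top"
      "((\<lambda>s. ?u s $ 3 $ 2) \<longlongrightarrow> (mat 1 :: complex^3^3) $ 3 $ 2) at_top"
      by (simp_all add: lower_def mat_1_nth divide_inverse)
    have "((\<lambda>s::real. y * (inverse (complex_of_real s))\<^sup>2) \<longlongrightarrow> y * 0\<^sup>2) at_top"
      by (intro tendsto_intros inv)
    then show "((\<lambda>s. ?u s $ 3 $ 1) \<longlongrightarrow> (mat 1 :: complex^3^3) $ 3 $ 1) at_top"
      by (simp add: lower_def mat_1_nth divide_inverse power_inverse)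
  qed (simp_all add: lower_def mat_1_nth)
  have "((\<lambda>s. hw_coeff a b G * rep_act R (?u s) v i) \<longlongrightarrow> hw_coeff a b G * rep_act R (mat 1) v i) at_top"
    by (intro tendsto_intros rep_act_tendsto[OF R lim]) auto
  then have "((\<lambda>s. hw_coeff a b G * rep_act R (?u s) v i) \<longlongrightarrow> hw_coeff a b G * v i) at_top"
    using cont_repD(2)[OF R vR] by simp
  then show ?thesis
    by (rule Lim_transform_eventually)
       (rule eventually_mono[OF eventually_gt_at_top[of 0]], rule eq[symmetric])
qed

lemma eventually_poly_nonzero:
  assumes "p \<noteq> (0 :: complex poly)" shows "eventually (\<lambda>e. poly p e \<noteq> 0) (at 0)"
proof -
  have "finite {x. poly p x = 0}" by (rule poly_roots_finite[OF assms])
  then have "\<not> 0 islimpt {x. poly p x = 0}" by (rule islimpt_finite)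
  then show ?thesis by (simp add: islimpt_conv_frequently_at frequently_def)
qed

text \<open>A curve through the identity that moves every group element into the big cell.\<close>

definition unip_curve :: "complex \<Rightarrow> complex^3^3"
  where "unip_curve e = upper e (e\<^sup>2 / 2) e"

text \<open>The curve is the exponential of \<open>e\<close> times the regular nilpotent matrix,
  which explains the entry \<open>e\<^sup>2 / 2\<close>. It mixes the whole first column of
  \<open>G\<close> into the first minor and the whole third row of the inverse into the
  second.\<close>

lemma unip_curve_simps:
  "unip_curve e \<in> SL3" "(unip_curve e ** G) $ 1 $ 1 = poly [:G$1$1, G$2$1, G$3$1 / 2:] e"
  "G \<in> SL3 \<Longrightarrow> adj3 (unip_curve e ** G) $ 3 $ 3 = poly [:adj3 G$3$3, - adj3 G$3$2, adj3 G$3$1 / 2:] e"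
proof -
  show 1: "unip_curve e \<in> SL3" by (simp add: unip_curve_def)
  show "(unip_curve e ** G) $ 1 $ 1 = poly [:G$1$1, G$2$1, G$3$1 / 2:] e"
    by (simp add: unip_curve_def upper_def matrix_mult_3 algebra_simps power2_eq_square)
  show "adj3 (unip_curve e ** G) $ 3 $ 3 = poly [:adj3 G$3$3, - adj3 G$3$2, adj3 G$3$1 / 2:] e"
    if "G \<in> SL3"
    unfolding adj3_mat_mult[OF 1 that] matrix_mult_3
    by (simp add: unip_curve_def upper_def adj3_def[of "mat3 _ _ _ _ _ _ _ _ _"] algebra_simps power2_eq_square)
qed

text \<open>A column or row of an invertible matrix is nonzero, so neither polynomial along the
  curve is identically zero and its roots are isolated.\<close>

lemma unip_curve_generic:
  assumes "G \<in> SL3"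
  shows "eventually (\<lambda>e. (unip_curve e ** G) $ 1 $ 1 \<noteq> 0) (at 0)"
    "eventually (\<lambda>e. adj3 (unip_curve e ** G) $ 3 $ 3 \<noteq> 0) (at 0)"
proof -
  have "\<not> (H$1$1 = 0 \<and> H$2$1 = 0 \<and> H$3$1 = 0)" "\<not> (H$3$1 = 0 \<and> H$3$2 = 0 \<and> H$3$3 = 0)"
    if "H \<in> SL3" for H :: "complex^3^3"
    using that by (auto simp: SL3_def det_3)
  from this(1)[OF assms] this(2)[OF SL3_adj3[OF assms]]
  have "[:G$1$1, G$2$1, G$3$1 / 2:] \<noteq> 0" "[:adj3 G$3$3, - adj3 G$3$2, adj3 G$3$1 / 2:] \<noteq> 0" by auto
  from this[THEN eventually_poly_nonzero]
  show "eventually (\<lambda>e. (unip_curve e ** G) $ 1 $ 1 \<noteq> 0) (at 0)"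
    "eventually (\<lambda>e. adj3 (unip_curve e ** G) $ 3 $ 3 \<noteq> 0) (at 0)"
    unfolding unip_curve_simps(2) unip_curve_simps(3)[OF assms] by blast+
qed

lemma unip_curve_0: "unip_curve 0 = mat 1"
  by (simp add: unip_curve_def upper_def mat3_eq_iff mat_1_nth)

lemma hw_coeff_curve:
  assumes "G \<in> SL3" shows "((\<lambda>e. hw_coeff a b (unip_curve e ** G)) \<longlongrightarrow> hw_coeff a b G) (at 0)"
proof -
  have "isCont (\<lambda>e. hw_coeff a b (unip_curve e ** G)) 0"
    unfolding hw_coeff_def unip_curve_simps(2) unip_curve_simps(3)[OF assms]
    by (intro continuous_intros)
  then show ?thesis by (simp add: isCont_def unip_curve_0)
qed

text \<open>For elements of the big cell, the torus is applied to the relation and a coordinate is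
  read off where \<open>v\<close> does not vanish; \<open>hw_limit\<close> turns every translate
  into its coefficient. Other elements are moved into the big cell by \<open>unip_curve e\<close>
  with small nonzero \<open>e\<close>, and continuity returns to \<open>e = 0\<close>.\<close>

lemma hw_relation:
  assumes R: "cont_rep R" and v: "highest_weight_vector R a b v"
    and Q: "finite Q" "\<And>q. q \<in> Q \<Longrightarrow> G q \<in> SL3"
    and 0: "(\<Sum>q\<in>Q. fscale (c q) (rep_act R (G q) v)) = 0"
  shows "(\<Sum>q\<in>Q. c q * hw_coeff a b (G q)) = 0"
proof -
  have vR: "v \<in> rep_space R" and "v \<noteq> 0" using v by (simp_all add: highest_weight_vector_def)
  then obtain i where i: "v i \<noteq> 0" by (auto simp: fun_eq_iff)
  have gen: "(\<Sum>q\<in>Q. c q * hw_coeff a b (H q)) = 0"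
    if H: "\<And>q. q \<in> Q \<Longrightarrow> H q \<in> SL3" "\<And>q. q \<in> Q \<Longrightarrow> H q $ 1 $ 1 \<noteq> 0"
      "\<And>q. q \<in> Q \<Longrightarrow> adj3 (H q) $ 3 $ 3 \<noteq> 0"
      and 0: "(\<Sum>q\<in>Q. fscale (c q) (rep_act R (H q) v)) = 0" for H
  proof -
    let ?f = "\<lambda>s::real. \<lambda>q. inverse (of_real s) ^ (a + b) *
      rep_act R (diagm (of_real s) 1 (inverse (of_real s))) (rep_act R (H q) v) i"
    have "((\<lambda>s. \<Sum>q\<in>Q. c q * ?f s q) \<longlongrightarrow> (\<Sum>q\<in>Q. c q * (hw_coeff a b (H q) * v i))) at_top"
      by (intro tendsto_intros hw_limit[OF R v] H)
    moreover have "(\<Sum>q\<in>Q. c q * ?f s q) = 0" for s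
    proof -
      let ?D = "diagm (of_real s) 1 (inverse (of_real s))"
      have "rep_act R ?D (\<Sum>q\<in>Q. fscale (c q) (rep_act R (H q) v)) i = 0"
        unfolding 0 by (simp add: rep_act_def)
      then have "(\<Sum>q\<in>Q. c q * rep_act R ?D (rep_act R (H q) v) i) = 0"
        unfolding linear_fam[OF linear_rep_act] by (simp add: sum_fun_apply fscale_apply)
      then have "inverse (of_real s) ^ (a + b) * (\<Sum>q\<in>Q. c q * rep_act R ?D (rep_act R (H q) v) i) = 0"
        by simp
      then show ?thesis unfolding sum_distrib_left by (simp only: mult.left_commute)
    qed
    ultimately have "(\<Sum>q\<in>Q. c q * (hw_coeff a b (H q) * v i)) = 0"
      by (intro tendsto_unique[OF trivial_limit_at_top_linorder _ tendsto_const]) simp_all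
    then have "(\<Sum>q\<in>Q. c q * hw_coeff a b (H q)) * v i = 0" by (simp add: sum_distrib_right mult.assoc)
    then show ?thesis using i by simp
  qed
  let ?H = "\<lambda>e q. unip_curve e ** G q"
  have "((\<lambda>e. \<Sum>q\<in>Q. c q * hw_coeff a b (?H e q)) \<longlongrightarrow> (\<Sum>q\<in>Q. c q * hw_coeff a b (G q))) (at 0)"
    by (intro tendsto_intros hw_coeff_curve Q)
  moreover have "eventually (\<lambda>e. (\<Sum>q\<in>Q. c q * hw_coeff a b (?H e q)) = 0) (at 0)"
  proof -
    have "eventually (\<lambda>e. \<forall>q\<in>Q. ?H e q $ 1 $ 1 \<noteq> 0 \<and> adj3 (?H e q) $ 3 $ 3 \<noteq> 0) (at 0)"
      using Q unip_curve_generic by (intro eventually_ball_finite) (auto intro: eventually_conj)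
    then show ?thesis
    proof (rule eventually_mono)
      fix e assume e: "\<forall>q\<in>Q. ?H e q $ 1 $ 1 \<noteq> 0 \<and> adj3 (?H e q) $ 3 $ 3 \<noteq> 0"
      have "(\<Sum>q\<in>Q. fscale (c q) (rep_act R (?H e q) v))
        = rep_act R (unip_curve e) (\<Sum>q\<in>Q. fscale (c q) (rep_act R (G q) v))"
        unfolding linear_fam[OF linear_rep_act]
        by (intro sum.cong refl arg_cong[where f="fscale _"] cont_repD(3)[OF R] unip_curve_simps Q vR)
      also have "\<dots> = 0" unfolding 0 by (rule fun_pair.linear_0[OF linear_rep_act])
      finally show "(\<Sum>q\<in>Q. c q * hw_coeff a b (?H e q)) = 0"
        using e Q by (intro gen) (auto simp: unip_curve_simps(1))
    qed
  qed
  ultimately show ?thesis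
    by (intro tendsto_unique[OF at_neq_bot _ tendsto_eventually]) simp_all
qed

section \<open>Functions on the cone\<close>

definition flag_cone :: "((complex^3) \<times> (complex^3)) set"
  where "flag_cone = {z. (\<Sum>j\<in>UNIV. snd z $ j * fst z $ j) = 0}"

text \<open>A reproducing kernel for the functions of degree \<open>a\<close> in the covector and
  \<open>b\<close> in the vector: it is symmetric for \<open>w\<close> and \<open>z\<close> on the
  cone and expands into products of a monomial in \<open>w\<close> with the same monomial in
  \<open>z\<close>. Extension by zero makes equality of functions mean equality on the cone.\<close>

definition kernel_fun ::
    "nat \<Rightarrow> nat \<Rightarrow> (complex^3) \<times> (complex^3) \<Rightarrow> (complex^3) \<times> (complex^3) \<Rightarrow> complex"
  where "kernel_fun a b w z = (if z \<in> flag_cone then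
    (\<Sum>j\<in>UNIV. snd z $ j * snd w $ j) ^ a * (\<Sum>j\<in>UNIV. fst z $ j * fst w $ j) ^ b else 0)"

text \<open>The first column of \<open>g\<close> is placed in the covector slot and the third row of
  the inverse in the vector slot, since the kernel pairs like with like. Hence
  \<open>orbit_fun a b g\<close> is the translate by \<open>g\<close> of the highest weight
  function, the power \<open>a\<close> of the first covector coordinate times the power
  \<open>b\<close> of the third vector coordinate.\<close>

definition flag_of :: "complex^3^3 \<Rightarrow> (complex^3) \<times> (complex^3)"
  where "flag_of g = (\<chi> j. adj3 g $ 3 $ j, \<chi> j. g $ j $ 1)"

definition orbit_fun :: "nat \<Rightarrow> nat \<Rightarrow> complex^3^3 \<Rightarrow> (complex^3) \<times> (complex^3) \<Rightarrow> complex"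
  where "orbit_fun a b g = kernel_fun a b (flag_of g)"

definition mon_fun :: "(3 \<Rightarrow> nat) \<Rightarrow> (3 \<Rightarrow> nat) \<Rightarrow> (complex^3) \<times> (complex^3) \<Rightarrow> complex"
  where "mon_fun \<alpha> \<beta> z = (if z \<in> flag_cone then
    (\<Prod>j\<in>UNIV. snd z $ j ^ \<alpha> j) * (\<Prod>j\<in>UNIV. fst z $ j ^ \<beta> j) else 0)"

definition cone_funs :: "nat \<Rightarrow> nat \<Rightarrow> ((complex^3) \<times> (complex^3) \<Rightarrow> complex) set"
  where "cone_funs a b =
    fun_space.span {mon_fun \<alpha> \<beta> | \<alpha> \<beta>. sum \<alpha> UNIV = a \<and> sum \<beta> UNIV = b}"

definition pair_act :: "complex^3^3 \<Rightarrow> (complex^3) \<times> (complex^3) \<Rightarrow> (complex^3) \<times> (complex^3)"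
  where "pair_act g z = (g *v fst z, snd z v* adj3 g)"

definition pull :: "complex^3^3 \<Rightarrow> ((complex^3) \<times> (complex^3) \<Rightarrow> complex) \<Rightarrow>
    (complex^3) \<times> (complex^3) \<Rightarrow> complex"
  where "pull g f = (\<lambda>z. f (pair_act (adj3 g) z))"

lemma linear_pull: "Vector_Spaces.linear fscale fscale (pull g)"
  by (rule fscale_linearI) (simp_all add: pull_def fun_eq_iff fscale_apply)

lemma pair_act_simps:
  "fst (pair_act g z) $ i = g$i$1 * fst z $ 1 + g$i$2 * fst z $ 2 + g$i$3 * fst z $ 3"
  "snd (pair_act g z) $ j = snd z $ 1 * adj3 g$1$j + snd z $ 2 * adj3 g$2$j + snd z $ 3 * adj3 g$3$j"
  by (simp_all add: pair_act_def matrix_vector_mult_def vector_matrix_mult_def sum_3 mult.commute)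

lemma pair_act_mult: "g \<in> SL3 \<Longrightarrow> h \<in> SL3 \<Longrightarrow> pair_act g (pair_act h z) = pair_act (g ** h) z"
  by (simp add: pair_act_def matrix_vector_mul_assoc vector_matrix_mul_assoc adj3_mat_mult)

lemma pair_act_one: "pair_act (mat 1) z = z"
proof -
  have "adj3 (mat 1) = mat 1" using adj3_unique[of "mat 1" "mat 1"] by simp
  then show ?thesis by (simp add: pair_act_def)
qed

lemma pair_act_cone: assumes "g \<in> SL3" shows "pair_act g z \<in> flag_cone \<longleftrightarrow> z \<in> flag_cone"
proof -
  have "(\<Sum>j\<in>UNIV. snd (pair_act g z) $ j * fst (pair_act g z) $ j)
    = (\<Sum>j\<in>UNIV. snd z $ j * ((adj3 g ** g) *v fst z) $ j)"
    unfolding sum_3 pair_act_simps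
    by (simp add: matrix_vector_mult_def matrix_mult_3 sum_3 algebra_simps)
  then show ?thesis using adj3_mult(2)[OF assms] by (simp add: flag_cone_def)
qed

lemma flag_of_cone: assumes "g \<in> SL3" shows "flag_of g \<in> flag_cone"
proof -
  have "(adj3 g ** g) $ 3 $ 1 = 0" using adj3_mult(2)[OF assms] by (simp add: mat_1_nth)
  then show ?thesis by (simp add: flag_cone_def flag_of_def sum_3 matrix_mult_3 mult.commute)
qed

lemma pull_orbit_fun:
  assumes "g \<in> SL3" "h \<in> SL3"
  shows "pull g (orbit_fun a b h) = orbit_fun a b (g ** h)"
  using assms
  by (simp add: fun_eq_iff pull_def orbit_fun_def kernel_fun_def pair_act_cone SL3_adj3 flag_of_def
      adj3_mat_mult adj3_adj3 sum_3 pair_act_simps matrix_mult_3 algebra_simps)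

lemma flag_transitive:
  assumes "(q, p) \<in> flag_cone" "q \<noteq> 0" "p \<noteq> 0" shows "\<exists>g\<in>SL3. flag_of g = (q, p)"
proof -
  have ex: "\<exists>y :: complex^3. p $ 1 * y $ 1 + p $ 2 * y $ 2 + p $ 3 * y $ 3 = 1" if p: "p \<noteq> 0" for p :: "complex^3"
  proof -
    obtain i where i: "p $ i \<noteq> 0" using p by (auto simp: vec_eq_iff)
    have "(\<Sum>j\<in>UNIV. p $ j * axis i (inverse (p $ i)) $ j) = 1"
      using i by (simp add: axis_def if_distrib sum.delta cong: if_cong)
    then show ?thesis unfolding sum_3 by (rule exI)
  qed
  obtain y :: "complex^3" where y: "p $ 1 * y $ 1 + p $ 2 * y $ 2 + p $ 3 * y $ 3 = 1" by (rule exE[OF ex[OF assms(3)]])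
  obtain x :: "complex^3" where x: "q $ 1 * x $ 1 + q $ 2 * x $ 2 + q $ 3 * x $ 3 = 1" by (rule exE[OF ex[OF assms(2)]])
  have pq: "p $ 1 * q $ 1 + p $ 2 * q $ 2 + p $ 3 * q $ 3 = 0" using assms(1) by (simp add: flag_cone_def sum_3)
  \<comment> \<open>The columns are p, the cross product of q and y, and x. The third row of the
    adjugate is the cross product of the first two columns, which by the triple product rule is q (p
    . y) - y (p . q) = q; the determinant is q . x = 1.\<close>
  define g where "g = mat3
    (p$1) (q$2 * y$3 - q$3 * y$2) (x$1)
    (p$2) (q$3 * y$1 - q$1 * y$3) (x$2)
    (p$3) (q$1 * y$2 - q$2 * y$1) (x$3)"
  have a: "adj3 g $ 3 $ 1 = q $ 1" "adj3 g $ 3 $ 2 = q $ 2" "adj3 g $ 3 $ 3 = q $ 3"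
    using y pq by (simp_all add: g_def adj3_def[of "mat3 _ _ _ _ _ _ _ _ _"]) algebra+
  have "det g = adj3 g $ 3 $ 1 * x $ 1 + adj3 g $ 3 $ 2 * x $ 2 + adj3 g $ 3 $ 3 * x $ 3"
    by (simp add: det_3 g_def adj3_def[of "mat3 _ _ _ _ _ _ _ _ _"] algebra_simps)
  then have "g \<in> SL3" using x a by (simp add: SL3_def)
  moreover have "flag_of g = (q, p)"
    using a by (simp add: flag_of_def vec_eq_iff forall_3 g_def)
  ultimately show ?thesis by blast
qed

lemma orthogonal_nonzero: "\<exists>p :: complex^3. p \<noteq> 0 \<and> p $ 1 * q $ 1 + p $ 2 * q $ 2 + p $ 3 * q $ 3 = 0"
proof (cases "q $ 1 = 0 \<and> q $ 2 = 0")
  case True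
  then show ?thesis by (intro exI[of _ "vector [1, 0, 0]"]) (simp add: vec_eq_iff forall_3)
next
  case False
  then show ?thesis by (intro exI[of _ "vector [q $ 2, - q $ 1, 0]"]) (auto simp: vec_eq_iff forall_3)
qed

text \<open>The degenerate points of the cone, those with \<open>\<ell> = 0\<close> or \<open>A = 0\<close>, contribute nothing beyond the
  open orbit.\<close>

lemma kernel_fun_flag:
  assumes "w \<in> flag_cone"
  shows "kernel_fun a b w = 0 \<or> (\<exists>g\<in>SL3. kernel_fun a b w = orbit_fun a b g)"
proof (rule disjCI)
  assume "\<not> (\<exists>g\<in>SL3. kernel_fun a b w = orbit_fun a b g)"
  then have no: False if "(q, p) \<in> flag_cone" "q \<noteq> 0" "p \<noteq> 0" "kernel_fun a b w = kernel_fun a b (q, p)" for q p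
    using flag_transitive[OF that(1-3)] that(4) unfolding orbit_fun_def by metis
  show "kernel_fun a b w = 0"
  proof (rule ccontr)
    assume nz: "kernel_fun a b w \<noteq> 0"
    have b: "b = 0" if "fst w = 0"
    proof (rule ccontr)
      assume "b \<noteq> 0"
      then have "kernel_fun a b w = 0" by (intro ext) (simp add: kernel_fun_def that power_0_left)
      then show False using nz by contradiction
    qed
    have a: "a = 0" if "snd w = 0"
    proof (rule ccontr)
      assume "a \<noteq> 0"
      then have "kernel_fun a b w = 0" by (intro ext) (simp add: kernel_fun_def that power_0_left)
      then show False using nz by contradiction
    qed
    \<comment> \<open>A vanishing first component forces \<open>b = 0\<close>; the kernel then does
      not depend on that component, which may be replaced by any nonzero vector orthogonal to the
      second. The second component is treated in the same way below.\<close>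
    have "\<exists>q. q \<noteq> 0 \<and> (q, snd w) \<in> flag_cone \<and> kernel_fun a b w = kernel_fun a b (q, snd w)"
    proof (cases "fst w = 0")
      case True
      obtain q :: "complex^3" where "q \<noteq> 0" "q $ 1 * snd w $ 1 + q $ 2 * snd w $ 2 + q $ 3 * snd w $ 3 = 0"
        using orthogonal_nonzero by blast
      then show ?thesis using b[OF True]
        by (intro exI[of _ q]) (auto simp: flag_cone_def sum_3 kernel_fun_def fun_eq_iff mult.commute)
    qed (use assms in auto)
    then obtain q where q: "q \<noteq> 0" "(q, snd w) \<in> flag_cone" "kernel_fun a b w = kernel_fun a b (q, snd w)"
      by blast
    show False
    proof (cases "snd w = 0")
      case True
      obtain p :: "complex^3" where p: "p \<noteq> 0" "p $ 1 * q $ 1 + p $ 2 * q $ 2 + p $ 3 * q $ 3 = 0"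
        using orthogonal_nonzero by blast
      show False
        by (rule no[of q p]) (use p q a[OF True] in \<open>auto simp: flag_cone_def sum_3 kernel_fun_def fun_eq_iff\<close>)
    qed (use no q in auto)
  qed
qed

lemma kernel_fun_sym: "w \<in> flag_cone \<Longrightarrow> z \<in> flag_cone \<Longrightarrow> kernel_fun a b w z = kernel_fun a b z w"
  by (simp add: kernel_fun_def mult.commute)

text \<open>At orbit points the kernel becomes the highest weight matrix coefficient of a product.
  The transpose appears because the kernel pairs coordinates by the dot product.\<close>

lemma orbit_fun_hw_coeff:
  assumes "g \<in> SL3" "h \<in> SL3"
  shows "orbit_fun a b g (flag_of (transpose h)) = hw_coeff a b (h ** g)"
proof -
  have t: "transpose h \<in> SL3" using assms by (simp add: SL3_def det_transpose)
  have "adj3 (transpose h) = transpose (adj3 h)"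
    by (simp add: mat3_eq_iff adj3_def transpose_def)
  then show ?thesis
    using assms flag_of_cone[OF t]
    by (simp add: orbit_fun_def kernel_fun_def hw_coeff_def adj3_mat_mult matrix_mult_3)
       (simp add: flag_of_def sum_3 transpose_def mult.commute)
qed

text \<open>By symmetry of the kernel, the value at \<open>z\<close> of the orbit function of
  \<open>g\<close> is the kernel at \<open>z\<close> evaluated at \<open>flag_of g\<close>. That
  kernel is zero or belongs to an orbit point, and in the second case the value is
  \<open>hw_coeff a b (h ** g)\<close> for a fixed \<open>h\<close>; the given relation translated
  by \<open>h\<close> is then covered by \<open>hw_relation\<close>.\<close>

lemma orbit_fun_relation:
  assumes R: "cont_rep R" and v: "highest_weight_vector R a b v"
    and Q: "finite Q" "Q \<subseteq> SL3" and 0: "(\<Sum>g\<in>Q. fscale (c g) (rep_act R g v)) = 0"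
  shows "(\<Sum>g\<in>Q. fscale (c g) (orbit_fun a b g)) = 0"
proof
  fix z
  have vR: "v \<in> rep_space R" using v by (simp add: highest_weight_vector_def)
  show "(\<Sum>g\<in>Q. fscale (c g) (orbit_fun a b g)) z = 0 z"
  proof (cases "z \<in> flag_cone")
    case False
    then show ?thesis by (simp add: sum_fun_apply fscale_apply orbit_fun_def kernel_fun_def)
  next
    case True
    have sw: "orbit_fun a b g z = kernel_fun a b z (flag_of g)" if "g \<in> Q" for g
      using kernel_fun_sym[OF flag_of_cone True] that Q by (auto simp: orbit_fun_def)
    from kernel_fun_flag[OF True] show ?thesis
    proof
      assume "kernel_fun a b z = 0"
      then show ?thesis using sw by (simp add: sum_fun_apply fscale_apply)
    next
      assume "\<exists>k\<in>SL3. kernel_fun a b z = orbit_fun a b k"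
      then obtain k where k: "k \<in> SL3" "kernel_fun a b z = orbit_fun a b k" by blast
      define h where "h = transpose k"
      have h: "h \<in> SL3" "k = transpose h" using k by (simp_all add: h_def SL3_def det_transpose)
      have "orbit_fun a b g z = hw_coeff a b (h ** g)" if "g \<in> Q" for g
      proof -
        have "orbit_fun a b g z = kernel_fun a b (flag_of k) (flag_of g)"
          using sw[OF that] k(2) by (simp add: orbit_fun_def)
        also have "\<dots> = orbit_fun a b g (flag_of k)"
          using kernel_fun_sym[OF flag_of_cone flag_of_cone, of k g] k(1) that Q
          by (auto simp: orbit_fun_def)
        finally show ?thesis using orbit_fun_hw_coeff[of g h a b] h that Q by auto
      qed
      moreover have "(\<Sum>g\<in>Q. c g * hw_coeff a b (h ** g)) = 0"
      proof (rule hw_relation[OF R v Q(1)])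
        have "(\<Sum>g\<in>Q. fscale (c g) (rep_act R (h ** g) v))
          = rep_act R h (\<Sum>g\<in>Q. fscale (c g) (rep_act R g v))"
          unfolding linear_fam[OF linear_rep_act]
          by (intro sum.cong refl arg_cong[where f="fscale _"] cont_repD(3)[OF R] h vR) (use Q in auto)
        also have "\<dots> = 0" unfolding 0 by (rule fun_pair.linear_0[OF linear_rep_act])
        finally show "(\<Sum>g\<in>Q. fscale (c g) (rep_act R (h ** g) v)) = 0" .
      qed (use h Q in auto)
      ultimately show ?thesis by (simp add: sum_fun_apply fscale_apply)
    qed
  qed
qed

text \<open>Let \<open>y\<close> be the projection of the unit vector at \<open>k\<close> to the
  span of the vectors \<open>m i w\<close> with \<open>w\<close> in \<open>X\<close>. The difference
  is orthogonal to the vector of every conjugate point \<open>cj x\<close>, and since the form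
  conjugates its first argument this says that \<open>m k\<close> equals the combination of the
  \<open>m i\<close> with coefficients \<open>y i\<close> on all of \<open>X\<close>. As
  \<open>y\<close> lies in the span, that combination is one of kernels.\<close>

lemma kernel_span:
  assumes I: "finite I" and X: "\<And>x. x \<in> X \<Longrightarrow> cj x \<in> X"
    and cj: "\<And>i x. i \<in> I \<Longrightarrow> x \<in> X \<Longrightarrow> m i (cj x) = cnj (m i x)" and k: "k \<in> I"
  shows "(\<lambda>x. if x \<in> X then m k x else 0) \<in>
    fun_space.span ((\<lambda>w x. if x \<in> X then \<Sum>i\<in>I. m i w * m i x else 0) ` X)"
proof -
  let ?V = "(\<lambda>w i. if i \<in> I then m i w else 0) ` X"
  let ?L = "\<lambda>u x. if x \<in> X then \<Sum>i\<in>I. u i * m i x else 0"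
  have L: "Vector_Spaces.linear fscale fscale ?L"
    by (rule fscale_linearI)
       (auto simp: fun_eq_iff fscale_def algebra_simps sum.distrib sum_distrib_left)
  have V: "fun_space.span ?V \<subseteq> supported I"
    by (rule fun_space.span_minimal) (auto simp: subspace_supported, simp add: supported_def)
  obtain y where y: "y \<in> fun_space.span ?V" "\<And>z. z \<in> fun_space.span ?V \<Longrightarrow> cinner I z (unit_fun k - y) = 0"
    by (rule orth_proj[OF I fun_space.subspace_span V, of "unit_fun k"]) blast
  have "m k x = (\<Sum>i\<in>I. y i * m i x)" if x: "x \<in> X" for x
  proof -
    have "cinner I (\<lambda>i. if i \<in> I then m i (cj x) else 0) (unit_fun k - y) = 0"
      by (intro y(2) fun_space.span_base) (use X[OF x] in auto)
    then have "(\<Sum>i\<in>I. m i x * (unit_fun k i - y i)) = 0"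
      using cj x by (simp add: cinner_def)
    then have "(\<Sum>i\<in>I. if i = k then m i x else 0) = (\<Sum>i\<in>I. y i * m i x)"
    proof -
      have "m i x * (unit_fun k i - y i) = (if i = k then m i x else 0) - y i * m i x" for i
        by (simp add: unit_fun_def algebra_simps)
      then show ?thesis
        using \<open>(\<Sum>i\<in>I. m i x * (unit_fun k i - y i)) = 0\<close> by (simp only: sum_subtractf right_minus_eq)
    qed
    then show ?thesis using I k by simp
  qed
  then have "(\<lambda>x. if x \<in> X then m k x else 0) = ?L y" by auto
  also have "\<dots> \<in> ?L ` fun_space.span ?V" using y(1) by blast
  also have "?L ` fun_space.span ?V = fun_space.span (?L ` ?V)"
    using fun_pair.linear_span_image[OF L] by simp
  also have "?L ` ?V = (\<lambda>w x. if x \<in> X then \<Sum>i\<in>I. m i w * m i x else 0) ` X"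
    unfolding image_image by (intro image_cong refl ext if_cong sum.cong) auto
  finally show ?thesis .
qed

section \<open>Words in the coordinates against exponent vectors\<close>

lemma prod_3: "prod f (UNIV :: 3 set) = f 1 * f 2 * f 3"
  unfolding UNIV_3 by (simp add: ac_simps)

lemma power_sum_multi_index:
  "(\<Sum>j\<in>UNIV. x j) ^ a = (\<Sum>I\<in>{..<a} \<rightarrow>\<^sub>E (UNIV :: 3 set). \<Prod>i<a. x (I i))" for x :: "3 \<Rightarrow> complex"
  using prod_sum_PiE[of "{..<a}" "\<lambda>_. UNIV :: 3 set" "\<lambda>_. x"] by simp

lemma prod_multi_index:
  assumes "I \<in> {..<a} \<rightarrow>\<^sub>E (UNIV :: 3 set)"
  obtains \<alpha> where "sum \<alpha> UNIV = a" "\<And>x :: 3 \<Rightarrow> complex. (\<Prod>i<a. x (I i)) = (\<Prod>j\<in>UNIV. x j ^ \<alpha> j)"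
proof -
  define \<alpha> where "\<alpha> j = card {i \<in> {..<a}. I i = j}" for j
  have "(\<Sum>j\<in>UNIV. \<Sum>i\<in>{i \<in> {..<a}. I i = j}. 1) = (\<Sum>i<a. 1::nat)"
    by (rule sum.group) auto
  then have "sum \<alpha> UNIV = a" by (simp add: \<alpha>_def)
  moreover have "(\<Prod>i<a. x (I i)) = (\<Prod>j\<in>UNIV. x j ^ \<alpha> j)" for x :: "3 \<Rightarrow> complex"
  proof -
    have "(\<Prod>i<a. x (I i)) = (\<Prod>j\<in>UNIV. \<Prod>i\<in>{i \<in> {..<a}. I i = j}. x (I i))"
      by (rule prod.group[symmetric]) auto
    also have "\<dots> = (\<Prod>j\<in>UNIV. x j ^ \<alpha> j)"
      by (intro prod.cong refl) (simp add: \<alpha>_def)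
    finally show ?thesis .
  qed
  ultimately show thesis using that by blast
qed

lemma multi_index_of_exponents:
  assumes "sum \<alpha> (UNIV :: 3 set) = a"
  obtains I where "I \<in> {..<a} \<rightarrow>\<^sub>E (UNIV :: 3 set)"
    "\<And>x :: 3 \<Rightarrow> complex. (\<Prod>i<a. x (I i)) = (\<Prod>j\<in>UNIV. x j ^ \<alpha> j)"
proof -
  define I where "I = restrict (\<lambda>i. if i < \<alpha> 1 then 1 else if i < \<alpha> 1 + \<alpha> 2 then 2 else (3::3)) {..<a}"
  have a: "a = \<alpha> 1 + \<alpha> 2 + \<alpha> 3" using assms by (simp add: sum_3)
  have "(\<Prod>i<a. x (I i)) = (\<Prod>j\<in>UNIV. x j ^ \<alpha> j)" for x :: "3 \<Rightarrow> complex"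
  proof -
    have "(\<Prod>i<a. x (I i)) = (\<Prod>i\<in>{0..<\<alpha> 1}. x (I i)) * (\<Prod>i\<in>{\<alpha> 1..<\<alpha> 1 + \<alpha> 2}. x (I i)) *
        (\<Prod>i\<in>{\<alpha> 1 + \<alpha> 2..<a}. x (I i))"
      using prod.atLeastLessThan_concat[of 0 "\<alpha> 1" "\<alpha> 1 + \<alpha> 2" "\<lambda>i. x (I i)"]
        prod.atLeastLessThan_concat[of 0 "\<alpha> 1 + \<alpha> 2" a "\<lambda>i. x (I i)"]
      by (simp add: a atLeast0LessThan)
    also have "(\<Prod>i\<in>{0..<\<alpha> 1}. x (I i)) = (\<Prod>i\<in>{0..<\<alpha> 1}. x 1)"
      by (intro prod.cong refl) (auto simp: I_def a)
    also have "(\<Prod>i\<in>{\<alpha> 1..<\<alpha> 1 + \<alpha> 2}. x (I i)) = (\<Prod>i\<in>{\<alpha> 1..<\<alpha> 1 + \<alpha> 2}. x 2)"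
      by (intro prod.cong refl) (auto simp: I_def a)
    also have "(\<Prod>i\<in>{\<alpha> 1 + \<alpha> 2..<a}. x (I i)) = (\<Prod>i\<in>{\<alpha> 1 + \<alpha> 2..<a}. x 3)"
      by (intro prod.cong refl) (auto simp: I_def)
    finally show ?thesis by (simp add: prod_3 a)
  qed
  moreover have "I \<in> {..<a} \<rightarrow>\<^sub>E (UNIV :: 3 set)" by (simp add: I_def)
  ultimately show thesis using that by blast
qed

text \<open>Monomials as words in the coordinates: the power of a sum expands into words without
  multinomial coefficients.\<close>

definition index_fun :: "nat \<Rightarrow> nat \<Rightarrow> (nat \<Rightarrow> 3) \<times> (nat \<Rightarrow> 3) \<Rightarrow> (complex^3) \<times> (complex^3) \<Rightarrow> complex"
  where "index_fun a b IJ z = (\<Prod>i<a. snd z $ fst IJ i) * (\<Prod>i<b. fst z $ snd IJ i)"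

abbreviation indices :: "nat \<Rightarrow> nat \<Rightarrow> ((nat \<Rightarrow> 3) \<times> (nat \<Rightarrow> 3)) set"
  where "indices a b \<equiv> ({..<a} \<rightarrow>\<^sub>E UNIV) \<times> ({..<b} \<rightarrow>\<^sub>E UNIV)"

lemma finite_indices [simp]: "finite (indices a b)"
  by (intro finite_cartesian_product finite_PiE) auto

lemma kernel_fun_expand:
  assumes "z \<in> flag_cone"
  shows "kernel_fun a b w z = (\<Sum>i\<in>indices a b. index_fun a b i w * index_fun a b i z)"
proof -
  have "kernel_fun a b w z = (\<Sum>I\<in>{..<a} \<rightarrow>\<^sub>E UNIV. \<Prod>i<a. snd z $ I i * snd w $ I i) *
      (\<Sum>J\<in>{..<b} \<rightarrow>\<^sub>E UNIV. \<Prod>i<b. fst z $ J i * fst w $ J i)"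
    using assms by (simp add: kernel_fun_def power_sum_multi_index)
  also have "\<dots> = (\<Sum>(I, J)\<in>indices a b. (\<Prod>i<a. snd z $ I i * snd w $ I i) * (\<Prod>i<b. fst z $ J i * fst w $ J i))"
    by (simp add: sum_product sum.cartesian_product)
  also have "\<dots> = (\<Sum>i\<in>indices a b. index_fun a b i w * index_fun a b i z)"
    by (intro sum.cong refl) (auto simp: index_fun_def prod.distrib)
  finally show ?thesis .
qed

lemma cone_funs_indices:
  "cone_funs a b = fun_space.span ((\<lambda>i z. if z \<in> flag_cone then index_fun a b i z else 0) ` indices a b)"
proof -
  have "{mon_fun \<alpha> \<beta> | \<alpha> \<beta>. sum \<alpha> UNIV = a \<and> sum \<beta> UNIV = b}
    = (\<lambda>i z. if z \<in> flag_cone then index_fun a b i z else 0) ` indices a b" (is "?A = ?B")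
  proof (intro subset_antisym subsetI)
    fix f assume "f \<in> ?A"
    then obtain \<alpha> \<beta> where f: "f = mon_fun \<alpha> \<beta>" "sum \<alpha> UNIV = a" "sum \<beta> UNIV = b" by blast
    obtain I where I: "I \<in> {..<a} \<rightarrow>\<^sub>E UNIV" "\<And>x :: 3 \<Rightarrow> complex. (\<Prod>i<a. x (I i)) = (\<Prod>j\<in>UNIV. x j ^ \<alpha> j)"
      using multi_index_of_exponents[OF f(2)] by blast
    obtain J where J: "J \<in> {..<b} \<rightarrow>\<^sub>E UNIV" "\<And>x :: 3 \<Rightarrow> complex. (\<Prod>i<b. x (J i)) = (\<Prod>j\<in>UNIV. x j ^ \<beta> j)"
      using multi_index_of_exponents[OF f(3)] by blast
    show "f \<in> ?B"
      by (rule image_eqI[of _ _ "(I, J)"]) (use I J f in \<open>auto simp: mon_fun_def index_fun_def\<close>)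
  next
    fix f assume "f \<in> ?B"
    then obtain I J where f: "f = (\<lambda>z. if z \<in> flag_cone then index_fun a b (I, J) z else 0)"
      and IJ: "I \<in> {..<a} \<rightarrow>\<^sub>E UNIV" "J \<in> {..<b} \<rightarrow>\<^sub>E UNIV" by auto
    obtain \<alpha> where \<alpha>: "sum \<alpha> UNIV = a" "\<And>x :: 3 \<Rightarrow> complex. (\<Prod>i<a. x (I i)) = (\<Prod>j\<in>UNIV. x j ^ \<alpha> j)"
      using prod_multi_index[OF IJ(1)] by blast
    obtain \<beta> where \<beta>: "sum \<beta> UNIV = b" "\<And>x :: 3 \<Rightarrow> complex. (\<Prod>i<b. x (J i)) = (\<Prod>j\<in>UNIV. x j ^ \<beta> j)"
      using prod_multi_index[OF IJ(2)] by blast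
    have "f = mon_fun \<alpha> \<beta>" using \<alpha> \<beta> by (simp add: f fun_eq_iff mon_fun_def index_fun_def)
    then show "f \<in> ?A" using \<alpha>(1) \<beta>(1) by blast
  qed
  then show ?thesis by (simp add: cone_funs_def)
qed

text \<open>Expanding the kernel gives one inclusion. For the other, the cone is stable under
  complex conjugation, so \<open>kernel_span\<close> recovers every monomial from kernels at points
  of the cone, and \<open>kernel_fun_flag\<close> reduces these to orbit points.\<close>

lemma span_orbit_fun: "fun_space.span (orbit_fun a b ` SL3) = cone_funs a b"
proof (intro subset_antisym)
  let ?m = "\<lambda>i z. if z \<in> flag_cone then index_fun a b i z else 0"
  have "kernel_fun a b w = (\<Sum>i\<in>indices a b. fscale (index_fun a b i w) (?m i))" for w
  proof
    fix z
    show "kernel_fun a b w z = (\<Sum>i\<in>indices a b. fscale (index_fun a b i w) (?m i)) z"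
    proof (cases "z \<in> flag_cone")
      case True
      then show ?thesis by (simp add: sum_fun_apply fscale_apply kernel_fun_expand)
    qed (simp add: sum_fun_apply fscale_apply kernel_fun_def)
  qed
  then show "fun_space.span (orbit_fun a b ` SL3) \<subseteq> cone_funs a b"
    unfolding cone_funs_indices orbit_fun_def
    by (intro fun_space.span_minimal fun_space.subspace_span image_subsetI) (simp only: fam_in_span)
next
  let ?m = "\<lambda>i z. if z \<in> flag_cone then index_fun a b i z else 0"
  let ?cj = "\<lambda>z :: (complex^3) \<times> (complex^3). (\<chi> j. cnj (fst z $ j), \<chi> j. cnj (snd z $ j))"
  have k: "kernel_fun a b w \<in> fun_space.span (orbit_fun a b ` SL3)" if "w \<in> flag_cone" for w
    using kernel_fun_flag[OF that, of a b]
    by (metis fun_space.span_base fun_space.span_zero imageI)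
  have "?m i \<in> fun_space.span (orbit_fun a b ` SL3)" if i: "i \<in> indices a b" for i
  proof -
    have "?cj z \<in> flag_cone" if "z \<in> flag_cone" for z
      using arg_cong[OF that[unfolded flag_cone_def, simplified], of cnj] by (simp add: flag_cone_def)
    moreover have "index_fun a b i (?cj z) = cnj (index_fun a b i z)" for i z
      by (simp add: index_fun_def)
    ultimately have "?m i \<in> fun_space.span
        ((\<lambda>w z. if z \<in> flag_cone then \<Sum>i\<in>indices a b. index_fun a b i w * index_fun a b i z else 0) ` flag_cone)"
      using kernel_span[OF finite_indices, of flag_cone ?cj a b "index_fun a b", OF _ _ i] by blast
    also have "(\<lambda>w z. if z \<in> flag_cone then \<Sum>i\<in>indices a b. index_fun a b i w * index_fun a b i z else 0) ` flag_cone
      = kernel_fun a b ` flag_cone"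
      by (intro image_cong refl ext) (auto simp: kernel_fun_expand, simp add: kernel_fun_def)
    also have "fun_space.span (kernel_fun a b ` flag_cone) \<subseteq> fun_space.span (orbit_fun a b ` SL3)"
      by (rule fun_space.span_minimal) (use k in auto)
    finally show ?thesis .
  qed
  then show "cone_funs a b \<subseteq> fun_space.span (orbit_fun a b ` SL3)"
    unfolding cone_funs_indices by (intro fun_space.span_minimal fun_space.subspace_span image_subsetI)
qed

text \<open>\<open>orbit_fun_relation\<close> makes the assignment of \<open>orbit_fun a b g\<close>
  to the translate of \<open>v\<close> by \<open>g\<close> well defined, and it is onto by
  \<open>span_orbit_fun\<close>. Injectivity is left to the two applications: it comes from
  irreducibility in \<open>irrep_iso\<close> and from the inner product in
  \<open>star_hw_iso\<close>.\<close>

lemma hw_iso: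
  assumes R: "cont_rep R" and v: "highest_weight_vector R a b v"
    and S: "S = fun_space.span ((\<lambda>g. rep_act R g v) ` SL3)"
  obtains L where "Vector_Spaces.linear fscale fscale L" "L ` S = cone_funs a b"
    "\<And>g x. g \<in> SL3 \<Longrightarrow> x \<in> S \<Longrightarrow> L (rep_act R g x) = pull g (L x)"
    "\<And>g. g \<in> SL3 \<Longrightarrow> L (rep_act R g v) = orbit_fun a b g"
proof -
  have vR: "v \<in> rep_space R" using v by (simp add: highest_weight_vector_def)
  obtain L where L: "Vector_Spaces.linear fscale fscale L"
    "\<And>g. g \<in> SL3 \<Longrightarrow> L (rep_act R g v) = orbit_fun a b g"
  proof (rule linear_of_relations[of SL3 "\<lambda>g. rep_act R g v" "orbit_fun a b"])
    show "(\<Sum>g\<in>F. fscale (c g) (orbit_fun a b g)) = 0"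
      if "finite F" "F \<subseteq> SL3" "(\<Sum>g\<in>F. fscale (c g) (rep_act R g v)) = 0" for F c
      by (rule orbit_fun_relation[OF R v that])
  qed (rule that)
  have "L ` S = fun_space.span (L ` ((\<lambda>g. rep_act R g v) ` SL3))"
    unfolding S by (rule fun_pair.linear_span_image[OF L(1), symmetric])
  also have "L ` ((\<lambda>g. rep_act R g v) ` SL3) = orbit_fun a b ` SL3"
    unfolding image_image using L(2) by (rule image_cong[OF refl])
  finally have im: "L ` S = cone_funs a b" by (simp only: span_orbit_fun)
  have "L (rep_act R g x) = pull g (L x)" if g: "g \<in> SL3" and x: "x \<in> S" for g x
    using x unfolding S
  proof (induction rule: fun_space.span_induct_alt)
    case base
    then show ?case by (simp only: fun_pair.linear_0[OF linear_rep_act] fun_pair.linear_0[OF L(1)]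
        fun_pair.linear_0[OF linear_pull])
  next
    case (step c x y)
    then obtain h where h: "h \<in> SL3" "x = rep_act R h v" by blast
    have "L (rep_act R g x) = pull g (L x)"
      using L(2)[OF SL3_mult[OF g h(1)]] L(2)[OF h(1)] pull_orbit_fun[OF g h(1)] cont_repD(3)[OF R g h(1) vR]
      by (simp add: h(2))
    then show ?case using step
      by (simp only: fun_pair.linear_add[OF linear_rep_act] fun_pair.linear_scale[OF linear_rep_act]
        fun_pair.linear_add[OF L(1)] fun_pair.linear_scale[OF L(1)]
        fun_pair.linear_add[OF linear_pull] fun_pair.linear_scale[OF linear_pull])
  qed
  then show thesis using that L im by blast
qed

lemma orbit_fun_nonzero: "orbit_fun a b (mat 1) \<noteq> 0"
proof
  assume "orbit_fun a b (mat 1) = 0"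
  then have "orbit_fun a b (mat 1) (flag_of (transpose (mat 1))) = 0" by simp
  then have "hw_coeff a b (mat 1) = 0" using orbit_fun_hw_coeff[of "mat 1" "mat 1"] by simp
  moreover have "adj3 (mat 1) = mat 1" using adj3_unique[of "mat 1" "mat 1"] by simp
  ultimately show False by (simp add: hw_coeff_def mat_1_nth)
qed

lemma orbit_span_invariant:
  assumes R: "cont_rep R" and v: "v \<in> rep_space R" and h: "h \<in> SL3"
    and x: "x \<in> fun_space.span ((\<lambda>g. rep_act R g v) ` SL3)"
  shows "rep_act R h x \<in> fun_space.span ((\<lambda>g. rep_act R g v) ` SL3)"
proof -
  have "rep_act R h x \<in> rep_act R h ` fun_space.span ((\<lambda>g. rep_act R g v) ` SL3)" using x by blast
  also have "\<dots> = fun_space.span (rep_act R h ` ((\<lambda>g. rep_act R g v) ` SL3))"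
    by (rule fun_pair.linear_span_image[OF linear_rep_act, symmetric])
  also have "\<dots> \<subseteq> fun_space.span ((\<lambda>g. rep_act R g v) ` SL3)"
  proof (rule fun_space.span_mono, clarify)
    fix g assume g: "g \<in> SL3"
    show "rep_act R h (rep_act R g v) \<in> (\<lambda>g. rep_act R g v) ` SL3"
      by (rule image_eqI[of _ _ "h ** g"]) (use cont_repD(3)[OF R h g v] SL3_mult[OF h g] in auto)
  qed
  finally show ?thesis .
qed

lemma rep_act_span_subset: "fun_space.span ((\<lambda>g. rep_act R g v) ` SL3) \<subseteq> rep_space R"
  by (rule fun_space.span_minimal)
     (auto simp: rep_act_closed rep_space_supported subspace_supported, simp add: rep_act_closed flip: rep_space_supported)

text \<open>The span of the orbit of \<open>v\<close> and the kernel of the map of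
  \<open>hw_iso\<close> are both invariant; irreducibility makes the first everything and the second
  zero.\<close>

lemma irrep_iso:
  assumes "irrep_with_highest_weight R a b"
  obtains L where "Vector_Spaces.linear fscale fscale L" "L ` rep_space R = cone_funs a b"
    "\<And>x. x \<in> rep_space R \<Longrightarrow> L x = 0 \<Longrightarrow> x = 0"
    "\<And>g x. g \<in> SL3 \<Longrightarrow> x \<in> rep_space R \<Longrightarrow> L (rep_act R g x) = pull g (L x)"
proof -
  obtain v where v: "highest_weight_vector R a b v" and irr: "irreducible_rep R"
    using assms by (auto simp: irrep_with_highest_weight_def)
  have R: "cont_rep R" using irr is_rep_cont_rep by (auto simp: irreducible_rep_def)
  have vR: "v \<in> rep_space R" "v \<noteq> 0" using v by (simp_all add: highest_weight_vector_def)
  have sub: "S = {0} \<or> S = rep_space R"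
    if "S \<subseteq> rep_space R" "fun_space.subspace S" "\<And>g x. g \<in> SL3 \<Longrightarrow> x \<in> S \<Longrightarrow> rep_act R g x \<in> S" for S
    using irr that unfolding irreducible_rep_def by (metis image_subsetI)
  define S where "S = fun_space.span ((\<lambda>g. rep_act R g v) ` SL3)"
  have vS: "v \<in> S"
    unfolding S_def by (rule fun_space.span_base, rule image_eqI[of _ _ "mat 1"]) (use cont_repD(2)[OF R] vR in auto)
  have "S = {0} \<or> S = rep_space R"
    unfolding S_def
    by (intro sub rep_act_span_subset fun_space.subspace_span orbit_span_invariant[OF R vR(1)])
  then have S: "S = rep_space R" using vS vR by blast
  obtain L where L: "Vector_Spaces.linear fscale fscale L" "L ` S = cone_funs a b"
    "\<And>g x. g \<in> SL3 \<Longrightarrow> x \<in> S \<Longrightarrow> L (rep_act R g x) = pull g (L x)"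
    "\<And>g. g \<in> SL3 \<Longrightarrow> L (rep_act R g v) = orbit_fun a b g"
    using hw_iso[OF R v S_def] by blast
  let ?N = "{x \<in> rep_space R. L x = 0}"
  have "?N = {0} \<or> ?N = rep_space R"
  proof (rule sub)
    show "fun_space.subspace ?N"
      using subspace_supported[of "idx R"] unfolding fun_space.subspace_def rep_space_supported
      by (simp add: fun_pair.linear_0[OF L(1)] fun_pair.linear_add[OF L(1)] fun_pair.linear_scale[OF L(1)])
    show "rep_act R g x \<in> ?N" if "g \<in> SL3" "x \<in> ?N" for g x
      using that L(3)[of g x] fun_pair.linear_0[OF linear_pull, of g] by (simp add: S rep_act_closed)
  qed auto
  moreover have "L v \<noteq> 0"
    using L(4)[OF SL3_one] cont_repD(2)[OF R vR(1)] orbit_fun_nonzero by simp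
  ultimately have "?N = {0}" using vR by blast
  then show thesis using that[of L] L S by blast
qed

section \<open>The standard monomial basis\<close>

text \<open>Artin's argument for a set closed under \<open>m\<close>: subtracting
  \<open>ch j y\<close> times the relation at \<open>x\<close> from the relation at
  \<open>m x y\<close> eliminates \<open>j\<close>, and \<open>y\<close> is chosen so that a given
  other coefficient survives.\<close>

lemma characters_independent:
  fixes ch :: "'j \<Rightarrow> 'x \<Rightarrow> complex"
  assumes "finite J" and X: "\<And>x y. x \<in> X \<Longrightarrow> y \<in> X \<Longrightarrow> m x y \<in> X" "e \<in> X"
    and mult: "\<And>j x y. j \<in> J \<Longrightarrow> x \<in> X \<Longrightarrow> y \<in> X \<Longrightarrow> ch j (m x y) = ch j x * ch j y"
    and one: "\<And>j. j \<in> J \<Longrightarrow> ch j e \<noteq> 0"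
    and dist: "\<And>i j. i \<in> J \<Longrightarrow> j \<in> J \<Longrightarrow> i \<noteq> j \<Longrightarrow> \<exists>x\<in>X. ch i x \<noteq> ch j x"
    and 0: "\<And>x. x \<in> X \<Longrightarrow> (\<Sum>j\<in>J. c j * ch j x) = 0" and j: "j \<in> J"
  shows "c j = 0"
proof -
  have "\<forall>j\<in>J. c j = 0" using assms(1) mult one dist 0
  proof (induction J arbitrary: c rule: finite_induct)
    case (insert j J)
    have c0: "c i = 0" if i: "i \<in> J" for i
    proof -
      obtain y where y: "y \<in> X" "ch i y \<noteq> ch j y" using insert.prems(3)[of i j] insert.hyps i by auto
      have "\<forall>i\<in>J. c i * (ch i y - ch j y) = 0"
      proof (rule insert.IH)
        fix x assume x: "x \<in> X"
        have e: "c j * ch j x + (\<Sum>i\<in>J. c i * ch i x) = 0"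
          using insert.prems(4)[OF x] insert.hyps by simp
        have "c j * ch j (m x y) + (\<Sum>i\<in>J. c i * ch i (m x y)) = 0"
          using insert.prems(4)[OF X(1)[OF x y(1)]] insert.hyps by simp
        then have "c j * (ch j x * ch j y) + (\<Sum>i\<in>J. c i * (ch i x * ch i y)) = 0"
          using insert.prems(1) x y(1) by simp
        moreover have "c j * (ch j x * ch j y) + (\<Sum>i\<in>J. c i * ch i x * ch j y) = 0"
          using arg_cong[OF e, of "\<lambda>u. u * ch j y"] by (simp add: algebra_simps sum_distrib_left)
        ultimately have "(\<Sum>i\<in>J. c i * (ch i x * ch i y)) - (\<Sum>i\<in>J. c i * ch i x * ch j y) = 0"
          by (metis add_left_cancel right_minus_eq)
        then show "(\<Sum>i\<in>J. c i * (ch i y - ch j y) * ch i x) = 0"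
          by (simp add: sum_subtractf[symmetric] algebra_simps)
      qed (use insert.prems in auto)
      then show ?thesis using i y(2) by auto
    qed
    then have "c j * ch j e = 0" using insert.prems(4)[OF X(2)] insert.hyps by simp
    then show ?case using c0 insert.prems(2) by auto
  qed simp
  then show ?thesis using j by blast
qed

lemma two_power_eq_iff [simp]: "(2::complex) ^ i = 2 ^ j \<longleftrightarrow> i = j"
proof -
  have "(2::complex) ^ i = of_nat (2 ^ i)" for i by simp
  then show ?thesis by (metis of_nat_eq_iff one_less_numeral_iff power_inject_exp semiring_norm(76))
qed

text \<open>Gelfand--Tsetlin patterns with top row \<open>(l1, l2, l3)\<close>, middle row \<open>(p, q)\<close> and bottom row \<open>s\<close>.\<close>

definition gt :: "nat \<Rightarrow> nat \<Rightarrow> nat \<Rightarrow> (nat \<times> nat \<times> nat) set"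
  where "gt l1 l2 l3 = {(s, p, q). l3 \<le> q \<and> q \<le> l2 \<and> l2 \<le> p \<and> p \<le> l1 \<and> q \<le> s \<and> s \<le> p}"

lemma finite_gt [simp]: "finite (gt l1 l2 l3)"
  by (rule finite_subset[of _ "{..l1} \<times> {..l1} \<times> {..l2}"]) (auto simp: gt_def)

text \<open>Differences of consecutive row sums, grouped so that no subtraction is truncated on
  \<open>gt l1 l2 l3\<close>.\<close>

definition gt_weight :: "nat \<Rightarrow> nat \<Rightarrow> nat \<Rightarrow> nat \<times> nat \<times> nat \<Rightarrow> nat \<times> nat \<times> nat"
  where "gt_weight l1 l2 l3 = (\<lambda>(s, p, q). (s, p - s + q, (l1 - p) + (l2 - q) + l3))"

definition wt_char :: "nat \<times> nat \<times> nat \<Rightarrow> complex \<times> complex \<times> complex \<Rightarrow> complex"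
  where "wt_char = (\<lambda>(a, b, c) (x, y, z). x ^ a * y ^ b * z ^ c)"

definition exps :: "nat \<Rightarrow> nat \<Rightarrow> nat \<Rightarrow> 3 \<Rightarrow> nat"
  where "exps x y z j = (if j = 1 then x else if j = 2 then y else z)"

lemma exps_simps [simp]: "exps x y z 1 = x" "exps x y z 2 = y" "exps x y z 3 = z"
  by (simp_all add: exps_def)

lemma exps_eta: "\<alpha> = exps (\<alpha> 1) (\<alpha> 2) (\<alpha> 3)"
  using exhaust_3 by (auto simp: fun_eq_iff exps_def)

text \<open>Of the two truncated differences \<open>s - b\<close> and \<open>b - s\<close> one vanishes: the standard monomials are
  those not divisible by \<open>\<ell>\<^sub>1 A\<^sub>1\<close>.\<close>

definition std_fun :: "nat \<Rightarrow> nat \<Rightarrow> nat \<times> nat \<times> nat \<Rightarrow> (complex^3) \<times> (complex^3) \<Rightarrow> complex"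
  where "std_fun a b = (\<lambda>(s, p, q).
    mon_fun (exps (s - b) (p - max s b) (a + b - p)) (exps (b - s) (min s b - q) q))"

text \<open>The straightening rule: the equation of the cone, solved for
  \<open>\<ell>\<^sub>1 A\<^sub>1\<close>, times a monomial.\<close>

lemma mon_fun_relation:
  "mon_fun (exps (Suc m) a2 a3) (exps (Suc n) b2 b3) =
    fscale (-1) (mon_fun (exps m (Suc a2) a3) (exps n (Suc b2) b3)) +
    fscale (-1) (mon_fun (exps m a2 (Suc a3)) (exps n b2 (Suc b3)))"
proof
  fix z :: "(complex^3) \<times> (complex^3)"
  show "mon_fun (exps (Suc m) a2 a3) (exps (Suc n) b2 b3) z =
    (fscale (-1) (mon_fun (exps m (Suc a2) a3) (exps n (Suc b2) b3)) +
    fscale (-1) (mon_fun (exps m a2 (Suc a3)) (exps n b2 (Suc b3)))) z"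
  proof (cases "z \<in> flag_cone")
    case True
    then have "snd z $ 1 * fst z $ 1 = - (snd z $ 2 * fst z $ 2) - snd z $ 3 * fst z $ 3"
      by (simp add: flag_cone_def sum_3 algebra_simps eq_neg_iff_add_eq_0)
    moreover define M where "M = snd z $ 1 ^ m * snd z $ 2 ^ a2 * snd z $ 3 ^ a3 *
      (fst z $ 1 ^ n * fst z $ 2 ^ b2 * fst z $ 3 ^ b3)"
    ultimately have "M * (snd z $ 1 * fst z $ 1) =
        M * (- (snd z $ 2 * fst z $ 2) - snd z $ 3 * fst z $ 3)"
      by (simp only:)
    then have "M * (snd z $ 1 * fst z $ 1) =
        - (M * (snd z $ 2 * fst z $ 2)) + - (M * (snd z $ 3 * fst z $ 3))"
      by (simp add: right_diff_distrib)
    moreover have "snd z $ 1 ^ Suc m * snd z $ 2 ^ a2 * snd z $ 3 ^ a3 *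
        (fst z $ 1 ^ Suc n * fst z $ 2 ^ b2 * fst z $ 3 ^ b3) = M * (snd z $ 1 * fst z $ 1)"
      "snd z $ 1 ^ m * snd z $ 2 ^ Suc a2 * snd z $ 3 ^ a3 *
        (fst z $ 1 ^ n * fst z $ 2 ^ Suc b2 * fst z $ 3 ^ b3) = M * (snd z $ 2 * fst z $ 2)"
      "snd z $ 1 ^ m * snd z $ 2 ^ a2 * snd z $ 3 ^ Suc a3 *
        (fst z $ 1 ^ n * fst z $ 2 ^ b2 * fst z $ 3 ^ Suc b3) = M * (snd z $ 3 * fst z $ 3)"
      unfolding M_def by (simp_all add: mult_ac)
    ultimately show ?thesis using True
      by (simp only: mon_fun_def prod_3 fscale_apply exps_simps plus_fun_apply if_True) simp
  qed (simp add: mon_fun_def fscale_apply)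
qed

text \<open>While \<open>\<ell>\<^sub>1\<close> and \<open>A\<^sub>1\<close> both occur,
  straightening lowers both exponents. Once one is absent, the monomial is standard with
  \<open>q = b3\<close>: without \<open>\<ell>\<^sub>1\<close> the pattern has
  \<open>s = b2 + b3\<close> and \<open>p = b + a2\<close>, without \<open>A\<^sub>1\<close> it has
  \<open>s = b + a1\<close> and \<open>p = s + a2\<close>.\<close>

lemma mon_fun_std_span:
  "a1 + a2 + a3 = a \<Longrightarrow> b1 + b2 + b3 = b \<Longrightarrow>
    mon_fun (exps a1 a2 a3) (exps b1 b2 b3) \<in> fun_space.span (std_fun a b ` gt (a + b) b 0)"
proof (induction a1 arbitrary: a2 a3 b1 b2 b3)
  case 0
  have "mon_fun (exps 0 a2 a3) (exps b1 b2 b3) = std_fun a b (b2 + b3, b + a2, b3)"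
    using 0 by (auto simp: std_fun_def intro!: arg_cong2[of _ _ _ _ mon_fun] arg_cong[of _ _ "exps _ _"])
  moreover have "(b2 + b3, b + a2, b3) \<in> gt (a + b) b 0" using 0 by (auto simp: gt_def)
  ultimately show ?case by (metis fun_space.span_base imageI)
next
  case (Suc m)
  show ?case
  proof (cases b1)
    case 0
    have "mon_fun (exps (Suc m) a2 a3) (exps b1 b2 b3) = std_fun a b (b + Suc m, b + Suc m + a2, b3)"
      using Suc.prems 0 by (auto simp: std_fun_def intro!: arg_cong2[of _ _ _ _ mon_fun] arg_cong[of _ _ "exps _ _"])
    moreover have "(b + Suc m, b + Suc m + a2, b3) \<in> gt (a + b) b 0"
      using Suc.prems 0 by (auto simp: gt_def)
    ultimately show ?thesis by (metis fun_space.span_base imageI)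
  next
    case (Suc n)
    show ?thesis unfolding Suc mon_fun_relation
      by (intro fun_space.span_add fun_space.span_scale Suc.IH) (use Suc.prems Suc in auto)
  qed
qed

lemma std_fun_mem: assumes "\<tau> \<in> gt (a + b) b 0" shows "std_fun a b \<tau> \<in> cone_funs a b"
  unfolding cone_funs_def
proof (rule fun_space.span_base)
  obtain s p q where \<tau>: "\<tau> = (s, p, q)" by (cases \<tau>) auto
  let ?\<alpha> = "exps (s - b) (p - max s b) (a + b - p)" and ?\<beta> = "exps (b - s) (min s b - q) q"
  have "std_fun a b \<tau> = mon_fun ?\<alpha> ?\<beta>" "sum ?\<alpha> UNIV = a" "sum ?\<beta> UNIV = b"
    using assms by (auto simp: std_fun_def \<tau> sum_3 gt_def)
  then show "std_fun a b \<tau> \<in> {mon_fun \<alpha> \<beta> | \<alpha> \<beta>. sum \<alpha> UNIV = a \<and> sum \<beta> UNIV = b}" by blast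
qed

lemma std_span: "cone_funs a b = fun_space.span (std_fun a b ` gt (a + b) b 0)"
proof (rule subset_antisym)
  have "mon_fun \<alpha> \<beta> \<in> fun_space.span (std_fun a b ` gt (a + b) b 0)"
    if "sum \<alpha> UNIV = a" "sum \<beta> UNIV = b" for \<alpha> \<beta>
    using that exps_eta[of \<alpha>] exps_eta[of \<beta>]
      mon_fun_std_span[of "\<alpha> 1" "\<alpha> 2" "\<alpha> 3" a "\<beta> 1" "\<beta> 2" "\<beta> 3" b] by (simp add: sum_3)
  then show "cone_funs a b \<subseteq> fun_space.span (std_fun a b ` gt (a + b) b 0)"
    unfolding cone_funs_def by (intro fun_space.span_minimal fun_space.subspace_span) blast
  show "fun_space.span (std_fun a b ` gt (a + b) b 0) \<subseteq> cone_funs a b"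
    by (intro fun_space.span_minimal image_subsetI std_fun_mem)
       (simp_all only: cone_funs_def fun_space.subspace_span)
qed

text \<open>On the slice \<open>\<ell> = (x, y, 1)\<close>, \<open>A = (-(y + w)/x, 1, w)\<close> of the cone, comparing powers of \<open>x\<close>
  fixes \<open>s\<close>; after cancelling \<open>(y + w)\<^bsup>b - s\<^esup>\<close> what is left are distinct monomials in \<open>y\<close> and \<open>w\<close>.\<close>

lemma std_indep: "indep_fam (gt (a + b) b 0) (std_fun a b)"
  unfolding indep_fam_def
proof (intro allI impI ballI)
  fix c \<tau>0 assume 0: "\<forall>z. (\<Sum>\<tau>\<in>gt (a + b) b 0. c \<tau> * std_fun a b \<tau> z) = 0" and \<tau>0: "\<tau>0 \<in> gt (a + b) b 0"
  let ?G = "gt (a + b) b 0"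
  define h :: "real \<Rightarrow> real \<Rightarrow> nat \<times> nat \<times> nat \<Rightarrow> complex" where "h = (\<lambda>y w (s, p, q).
    of_real y ^ (p - max s b) * (- (of_real y + of_real w)) ^ (b - s) * of_real w ^ q)"
  \<comment> \<open>The factor \<open>x ^ b\<close> clears the denominator coming from the first
    vector coordinate; the exponent of \<open>x\<close> then is exactly \<open>s\<close>, whether or
    not \<open>s\<close> exceeds \<open>b\<close>.\<close>
  have eval: "of_real x ^ b * std_fun a b \<tau> (vector [- (of_real y + of_real w) / of_real x, 1, of_real w],
      vector [of_real x, of_real y, 1]) = of_real x ^ fst \<tau> * h y w \<tau>"
    if \<tau>: "\<tau> \<in> ?G" and x: "x > 0" for x y w :: real and \<tau>
  proof -
    obtain s p q where t: "\<tau> = (s, p, q)" by (cases \<tau>) auto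
    have "(vector [- (of_real y + of_real w) / of_real x, 1, of_real w],
      vector [of_real x, of_real y, 1]) \<in> flag_cone" using x by (simp add: flag_cone_def sum_3)
    moreover have "(of_real x :: complex) ^ b * (of_real x ^ (s - b) / of_real x ^ (b - s)) = of_real x ^ s"
      using x by (cases "s \<le> b") (simp_all add: power_diff)
    then have "(of_real x :: complex) ^ b * (of_real x ^ (s - b) * Y * (M ^ (b - s) / of_real x ^ (b - s) * W))
      = of_real x ^ s * (Y * M ^ (b - s) * W)" for Y M W
    proof -
      have "(of_real x :: complex) ^ b * (of_real x ^ (s - b) * Y * (M ^ (b - s) / of_real x ^ (b - s) * W))
        = of_real x ^ b * (of_real x ^ (s - b) / of_real x ^ (b - s)) * (Y * M ^ (b - s) * W)"
        by (simp add: divide_inverse mult_ac)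
      then show ?thesis
        using \<open>of_real x ^ b * (of_real x ^ (s - b) / of_real x ^ (b - s)) = (of_real x :: complex) ^ s\<close>
        by (simp only:)
    qed
    ultimately show ?thesis
      unfolding t std_fun_def h_def mon_fun_def prod_3
      by (simp add: power_divide)
  qed
  have hs: "(\<Sum>\<tau>\<in>{\<tau> \<in> ?G. fst \<tau> = s}. c \<tau> * h y w \<tau>) = 0" if yw: "s \<in> fst ` ?G" for s y w
  proof (rule characters_independent[where J = "fst ` ?G" and X = "{x::real. x > 0}" and m = "(*)" and e = 1
        and ch = "\<lambda>s x. of_real x ^ s" and c = "\<lambda>s. \<Sum>\<tau>\<in>{\<tau> \<in> ?G. fst \<tau> = s}. c \<tau> * h y w \<tau>"])
    fix x :: real assume "x \<in> {x. x > 0}"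
    then have x: "x > 0" by simp
    have "(\<Sum>s\<in>fst ` ?G. (\<Sum>\<tau>\<in>{\<tau> \<in> ?G. fst \<tau> = s}. c \<tau> * h y w \<tau>) * of_real x ^ s)
      = (\<Sum>s\<in>fst ` ?G. \<Sum>\<tau>\<in>{\<tau> \<in> ?G. fst \<tau> = s}. c \<tau> * (of_real x ^ fst \<tau> * h y w \<tau>))"
      by (intro sum.cong refl) (simp add: sum_distrib_left mult_ac)
    also have "\<dots> = (\<Sum>\<tau>\<in>?G. c \<tau> * (of_real x ^ fst \<tau> * h y w \<tau>))"
      by (rule sum.group) auto
    also have "\<dots> = of_real x ^ b * (\<Sum>\<tau>\<in>?G. c \<tau> * std_fun a b \<tau>
       (vector [- (of_real y + of_real w) / of_real x, 1, of_real w], vector [of_real x, of_real y, 1]))"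
      by (simp add: sum_distrib_left eval[OF _ x, symmetric] mult.left_commute)
    also have "\<dots> = 0" using 0 by simp
    finally show "(\<Sum>s\<in>fst ` ?G. (\<Sum>\<tau>\<in>{\<tau> \<in> ?G. fst \<tau> = s}. c \<tau> * h y w \<tau>) * of_real x ^ s) = 0" .
  next
    show "\<exists>x\<in>{x. x > 0}. complex_of_real x ^ i \<noteq> complex_of_real x ^ j" if "i \<noteq> j" for i j
      by (rule bexI[of _ 2]) (use that in simp_all)
  qed (use yw in \<open>auto simp: power_mult_distrib\<close>)
  show "c \<tau>0 = 0"
  proof (rule characters_independent[where J = "{\<tau> \<in> ?G. fst \<tau> = fst \<tau>0}"
        and X = "{(y, w). (0::real) < y \<and> (0::real) < w}" and m = "\<lambda>(y, w) (y', w'). (y * y', w * w')"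
        and e = "(1, 1)" and c = c
        and ch = "\<lambda>(s, p, q) (y, w). of_real y ^ (p - max s b) * of_real w ^ q"])
    fix yw :: "real \<times> real" assume "yw \<in> {(y, w). 0 < y \<and> 0 < w}"
    then obtain y w where yw: "yw = (y, w)" "y > 0" "w > 0" by auto
    let ?k = "(- (of_real y + of_real w)) ^ (b - fst \<tau>0) :: complex"
    have "?k \<noteq> 0" using yw by (simp flip: of_real_add)
    moreover have "?k * (\<Sum>\<tau>\<in>{\<tau> \<in> ?G. fst \<tau> = fst \<tau>0}. c \<tau> *
        (case \<tau> of (s, p, q) \<Rightarrow> \<lambda>(y, w). of_real y ^ (p - max s b) * of_real w ^ q) yw) = 0"
    proof -
      have "?k * (\<Sum>\<tau>\<in>{\<tau> \<in> ?G. fst \<tau> = fst \<tau>0}. c \<tau> *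
        (case \<tau> of (s, p, q) \<Rightarrow> \<lambda>(y, w). of_real y ^ (p - max s b) * of_real w ^ q) yw)
        = (\<Sum>\<tau>\<in>{\<tau> \<in> ?G. fst \<tau> = fst \<tau>0}. c \<tau> * h y w \<tau>)"
        unfolding sum_distrib_left by (rule sum.cong) (auto simp: h_def yw(1))
      then show ?thesis using hs[of "fst \<tau>0" y w] \<tau>0 by simp
    qed
    ultimately show "(\<Sum>\<tau>\<in>{\<tau> \<in> ?G. fst \<tau> = fst \<tau>0}. c \<tau> *
        (case \<tau> of (s, p, q) \<Rightarrow> \<lambda>(y, w). of_real y ^ (p - max s b) * of_real w ^ q) yw) = 0"
      by (simp only: mult_eq_0_iff simp_thms)
  next
    fix i j assume ij: "i \<in> {\<tau> \<in> ?G. fst \<tau> = fst \<tau>0}" "j \<in> {\<tau> \<in> ?G. fst \<tau> = fst \<tau>0}" "i \<noteq> j"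
    obtain s p q p' q' where i: "i = (s, p, q)" "j = (s, p', q')" using ij by (cases i; cases j) auto
    \<comment> \<open>In a pattern \<open>p\<close> is at least \<open>max s b\<close>, so this
      subtraction is exact and loses nothing.\<close>
    have "p - max s b \<noteq> p' - max s b \<or> q \<noteq> q'" using ij by (auto simp: i gt_def)
    then show "\<exists>x\<in>{(y, w). 0 < y \<and> 0 < w}.
       (case i of (s, p, q) \<Rightarrow> \<lambda>(y, w). of_real y ^ (p - max s b) * of_real w ^ q) x \<noteq>
       (case j of (s, p, q) \<Rightarrow> \<lambda>(y, w). of_real y ^ (p - max s b) * of_real w ^ q :: complex) x"
    proof
      assume "p - max s b \<noteq> p' - max s b"
      then show ?thesis unfolding i by (intro bexI[of _ "(2, 1)"]) simp_all
    next
      assume "q \<noteq> q'"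
      then show ?thesis unfolding i by (intro bexI[of _ "(1, 2)"]) simp_all
    qed
  qed (use \<tau>0 in \<open>auto simp: power_mult_distrib\<close>)
qed

lemma std_basis: "is_basis (gt (a + b) b 0) (std_fun a b) (cone_funs a b)"
  unfolding is_basis_def using std_indep std_span by auto

lemma adj3_diagm: "x * y * z = 1 \<Longrightarrow> adj3 (diagm x y z) = diagm (y * z) (x * z) (x * y)"
  by (simp add: adj3_def diagm_def mat3_eq_iff)

lemma pair_act_diagm_adj3:
  assumes "x * y * z = 1"
  shows "pair_act (adj3 (diagm x y z)) w = (vector [y * z * fst w $ 1, x * z * fst w $ 2, x * y * fst w $ 3],
    vector [x * snd w $ 1, y * snd w $ 2, z * snd w $ 3])"
  using assms
  by (simp add: prod_eq_iff vec_eq_iff forall_3 pair_act_simps adj3_adj3)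
     (simp only: adj3_diagm[OF assms], simp add: diagm_def)

text \<open>The torus scales \<open>A\<^sub>1\<close> by \<open>y * z\<close>, the inverse of
  \<open>x\<close>. All exponents thus stay natural numbers, and the weight has total degree equal
  to the covector degree plus twice the vector degree.\<close>

lemma mon_fun_weight:
  assumes t: "x * y * z = 1"
  shows "pull (diagm x y z) (mon_fun (exps u1 u2 u3) (exps v1 v2 v3)) =
    fscale (wt_char (u1 + v2 + v3, u2 + v1 + v3, u3 + v1 + v2) (x, y, z))
      (mon_fun (exps u1 u2 u3) (exps v1 v2 v3))"
proof
  fix w
  have "pair_act (adj3 (diagm x y z)) w \<in> flag_cone \<longleftrightarrow> w \<in> flag_cone"
    by (rule pair_act_cone) (use t in \<open>auto intro: SL3_adj3\<close>)
  then show "pull (diagm x y z) (mon_fun (exps u1 u2 u3) (exps v1 v2 v3)) w =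
    fscale (wt_char (u1 + v2 + v3, u2 + v1 + v3, u3 + v1 + v2) (x, y, z))
      (mon_fun (exps u1 u2 u3) (exps v1 v2 v3)) w"
    unfolding pull_def mon_fun_def fscale_apply
    by (simp add: wt_char_def pair_act_diagm_adj3[OF t] prod_3 power_mult_distrib power_add mult_ac)
qed

lemma std_fun_weight:
  assumes t: "x * y * z = 1" and \<tau>: "\<tau> \<in> gt (a + b) b 0"
  shows "pull (diagm x y z) (std_fun a b \<tau>) =
    fscale (wt_char (gt_weight (a + b) b 0 \<tau>) (x, y, z)) (std_fun a b \<tau>)"
proof -
  obtain s p q where st: "\<tau> = (s, p, q)" by (cases \<tau>) auto
  have e: "gt_weight (a + b) b 0 \<tau> = (s - b + (min s b - q) + q, p - max s b + (b - s) + q,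
      a + b - p + (b - s) + (min s b - q))"
    using \<tau> by (auto simp: gt_weight_def st gt_def)
  show ?thesis unfolding e using mon_fun_weight[OF t] by (simp add: std_fun_def st)
qed

section \<open>Multihomogeneous functions on the variety\<close>

lemma M_variety_cone: "z \<in> M_variety n \<longleftrightarrow> (\<forall>i<n. z i \<in> flag_cone) \<and> (\<forall>i\<ge>n. z i = 0)"
  by (simp add: M_variety_def flag_cone_def)

definition prod_fun :: "nat \<Rightarrow> (nat \<Rightarrow> (complex^3) \<times> (complex^3) \<Rightarrow> complex) \<Rightarrow> config \<Rightarrow> complex"
  where "prod_fun n f z = (if z \<in> M_variety n then \<Prod>i<n. f i (z i) else 0)"

lemma prod_fun_in_span:
  assumes J: "\<And>i. i < n \<Longrightarrow> finite (J i)" and f: "\<And>i. i < n \<Longrightarrow> f i \<in> fun_space.span (g i ` J i)"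
  obtains c where "prod_fun n f =
    (\<Sum>\<tau>\<in>Pi\<^sub>E {..<n} J. fscale (\<Prod>i<n. c i (\<tau> i)) (prod_fun n (\<lambda>i. g i (\<tau> i))))"
    "\<And>i. i < n \<Longrightarrow> f i = (\<Sum>j\<in>J i. fscale (c i j) (g i j))"
proof -
  have "\<forall>i. \<exists>c. i < n \<longrightarrow> f i = (\<Sum>j\<in>J i. fscale (c j) (g i j))"
    using span_fam[OF J f] by blast
  from choice[OF this] obtain c where c: "\<And>i. i < n \<Longrightarrow> f i = (\<Sum>j\<in>J i. fscale (c i j) (g i j))" by blast
  have "prod_fun n f = (\<Sum>\<tau>\<in>Pi\<^sub>E {..<n} J. fscale (\<Prod>i<n. c i (\<tau> i)) (prod_fun n (\<lambda>i. g i (\<tau> i))))"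
  proof
    fix z
    have "(\<Prod>i<n. f i (z i)) = (\<Prod>i<n. \<Sum>j\<in>J i. c i j * g i j (z i))"
      by (intro prod.cong refl) (simp add: c sum_fun_apply fscale_apply)
    also have "\<dots> = (\<Sum>\<tau>\<in>Pi\<^sub>E {..<n} J. \<Prod>i<n. c i (\<tau> i) * g i (\<tau> i) (z i))"
      by (rule prod_sum_PiE) (use J in auto)
    finally show "prod_fun n f z =
        (\<Sum>\<tau>\<in>Pi\<^sub>E {..<n} J. fscale (\<Prod>i<n. c i (\<tau> i)) (prod_fun n (\<lambda>i. g i (\<tau> i)))) z"
      by (simp add: prod_fun_def sum_fun_apply fscale_apply prod.distrib)
  qed
  then show thesis using that c by blast
qed

abbreviation prod_family ::
    "nat \<Rightarrow> (nat \<Rightarrow> 'j \<Rightarrow> (complex^3) \<times> (complex^3) \<Rightarrow> complex) \<Rightarrow> (nat \<Rightarrow> 'j) \<Rightarrow> config \<Rightarrow> complex"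
  where "prod_family n g \<tau> \<equiv> prod_fun n (\<lambda>i. g i (\<tau> i))"

lemma prod_fun_span:
  assumes "\<And>i. i < n \<Longrightarrow> finite (J i)" "\<And>i. i < n \<Longrightarrow> f i \<in> fun_space.span (g i ` J i)"
  shows "prod_fun n f \<in> fun_space.span (prod_family n g ` Pi\<^sub>E {..<n} J)"
proof -
  obtain c where "prod_fun n f =
    (\<Sum>\<tau>\<in>Pi\<^sub>E {..<n} J. fscale (\<Prod>i<n. c i (\<tau> i)) (prod_fun n (\<lambda>i. g i (\<tau> i))))"
    using prod_fun_in_span[of n J f g] assms by metis
  then show ?thesis by (simp only: fam_in_span)
qed

text \<open>Induction on the set of factors: with the other variables held fixed, independence in
  the variable \<open>k\<close> leaves, for each index \<open>j\<close> of that factor, a relation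
  among the remaining factors.\<close>

lemma tensor_independent:
  assumes "finite I"
    and "\<And>i c. i \<in> I \<Longrightarrow> (\<And>x. x \<in> X \<Longrightarrow> (\<Sum>j\<in>J i. c j * g i j x) = 0) \<Longrightarrow> \<forall>j\<in>J i. c j = 0"
    and "\<And>z. (\<And>i. i \<in> I \<Longrightarrow> z i \<in> X) \<Longrightarrow> (\<Sum>\<tau>\<in>Pi\<^sub>E I J. c \<tau> * (\<Prod>i\<in>I. g i (\<tau> i) (z i))) = (0::complex)"
  shows "\<forall>\<tau>\<in>Pi\<^sub>E I J. c \<tau> = 0"
  using assms
proof (induction I arbitrary: c rule: finite_induct)
  case empty
  then show ?case by simp
next
  case (insert k I)
  let ?ext = "\<lambda>(j, \<tau>). \<tau>(k := j)"
  have split: "(\<Sum>\<tau>\<in>Pi\<^sub>E (insert k I) J. F \<tau>) = (\<Sum>j\<in>J k. \<Sum>\<tau>\<in>Pi\<^sub>E I J. F (\<tau>(k := j)))"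
    for F :: "_ \<Rightarrow> complex"
    unfolding PiE_insert_eq
    by (subst sum.reindex[OF inj_combinator[OF insert.hyps(2)]])
       (simp add: sum.cartesian_product split_beta)
  have "\<forall>j\<in>J k. \<forall>\<tau>\<in>Pi\<^sub>E I J. c (\<tau>(k := j)) = 0"
  proof
    fix j assume j: "j \<in> J k"
    show "\<forall>\<tau>\<in>Pi\<^sub>E I J. c (\<tau>(k := j)) = 0"
    proof (rule insert.IH)
      fix z assume z: "\<And>i. i \<in> I \<Longrightarrow> z i \<in> X"
      have "\<forall>j\<in>J k. (\<Sum>\<tau>\<in>Pi\<^sub>E I J. c (\<tau>(k := j)) * (\<Prod>i\<in>I. g i (\<tau> i) (z i))) = 0"
      proof (rule insert.prems(1))
        fix x assume x: "x \<in> X"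
        have "(\<Sum>\<tau>\<in>Pi\<^sub>E (insert k I) J. c \<tau> * (\<Prod>i\<in>insert k I. g i (\<tau> i) ((z(k := x)) i))) = 0"
          by (rule insert.prems(2)) (use x z insert.hyps in auto)
        then have "0 = (\<Sum>j\<in>J k. \<Sum>\<tau>\<in>Pi\<^sub>E I J. c (\<tau>(k := j)) *
            (\<Prod>i\<in>insert k I. g i ((\<tau>(k := j)) i) ((z(k := x)) i)))"
          unfolding split by simp
        also have "\<dots> = (\<Sum>j\<in>J k. (\<Sum>\<tau>\<in>Pi\<^sub>E I J. c (\<tau>(k := j)) * (\<Prod>i\<in>I. g i (\<tau> i) (z i))) * g k j x)"
        proof (intro sum.cong refl)
          fix j
          have "(\<Prod>i\<in>insert k I. g i ((\<tau>(k := j)) i) ((z(k := x)) i)) = g k j x * (\<Prod>i\<in>I. g i (\<tau> i) (z i))" for \<tau>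
          proof -
            have "(\<Prod>i\<in>I. g i ((\<tau>(k := j)) i) ((z(k := x)) i)) = (\<Prod>i\<in>I. g i (\<tau> i) (z i))"
              by (rule prod.cong) (use insert.hyps in auto)
            then show ?thesis using insert.hyps by simp
          qed
          then show "(\<Sum>\<tau>\<in>Pi\<^sub>E I J. c (\<tau>(k := j)) * (\<Prod>i\<in>insert k I. g i ((\<tau>(k := j)) i) ((z(k := x)) i)))
            = (\<Sum>\<tau>\<in>Pi\<^sub>E I J. c (\<tau>(k := j)) * (\<Prod>i\<in>I. g i (\<tau> i) (z i))) * g k j x"
            by (simp only: sum_distrib_right) (simp add: mult_ac)
        qed
        finally show "(\<Sum>j\<in>J k. (\<Sum>\<tau>\<in>Pi\<^sub>E I J. c (\<tau>(k := j)) * (\<Prod>i\<in>I. g i (\<tau> i) (z i))) * g k j x) = 0" ..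
      qed simp
      then show "(\<Sum>\<tau>\<in>Pi\<^sub>E I J. c (\<tau>(k := j)) * (\<Prod>i\<in>I. g i (\<tau> i) (z i))) = 0" using j by blast
    qed (use insert.prems(1) in auto)
  qed
  then show ?case unfolding PiE_insert_eq by auto
qed

lemma cone_funs_zero: "f \<in> cone_funs a b \<Longrightarrow> z \<notin> flag_cone \<Longrightarrow> f z = 0"
  unfolding cone_funs_def
  by (induction rule: fun_space.span_induct_alt) (auto simp: mon_fun_def fscale_apply)

text \<open>For \<open>a = r + 3\<close> and \<open>b = r\<close> the top row
  \<open>(a + b, b, 0)\<close> of the patterns becomes the shape \<open>(2 * r + 3, r, 0)\<close> of
  the Schur polynomial.\<close>

lemma top_row: "r + 3 + r = 2 * r + (3::nat)"
  by simp

lemmas std_basis_3 = std_basis[of "r + 3" r for r, unfolded top_row]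
lemmas std_span_3 = std_span[of "r + 3" r for r, unfolded top_row]
lemmas std_fun_mem_3 = std_fun_mem[of _ "r + 3" r for r, unfolded top_row]

text \<open>The tensor product of the spaces \<open>cone_funs (r i + 3) (r i)\<close>, realised by
  functions on the variety and given by its standard monomials.\<close>

definition multi_funs :: "nat \<Rightarrow> (nat \<Rightarrow> nat) \<Rightarrow> (config \<Rightarrow> complex) set"
  where "multi_funs n r = fun_space.span (prod_family n (\<lambda>i. std_fun (r i + 3) (r i)) `
    (\<Pi>\<^sub>E i\<in>{..<n}. gt (2 * r i + 3) (r i) 0))"

text \<open>Expansions multiply out, so products of one spanning family lie in the span of products
  of another. This serves both the bases transported from the irreducibles and the spanning family
  \<open>slot_fun\<close>.\<close>

lemma prod_family_span:
  assumes J: "\<And>i. i < n \<Longrightarrow> finite (J i)"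
    and sp: "\<And>i. i < n \<Longrightarrow> cone_funs (r i + 3) (r i) = fun_space.span (g i ` J i)"
  shows "fun_space.span (prod_family n g ` Pi\<^sub>E {..<n} J) = multi_funs n r"
  unfolding multi_funs_def
proof (intro subset_antisym fun_space.span_minimal image_subsetI fun_space.subspace_span)
  fix \<tau> assume "\<tau> \<in> Pi\<^sub>E {..<n} J"
  then have "g i (\<tau> i) \<in> fun_space.span (std_fun (r i + 3) (r i) ` gt (2 * r i + 3) (r i) 0)" if "i < n" for i
    unfolding std_span_3[symmetric] sp[OF that] using that by (intro fun_space.span_base) auto
  then show "prod_family n g \<tau> \<in> fun_space.span (prod_family n (\<lambda>i. std_fun (r i + 3) (r i)) `
    (\<Pi>\<^sub>E i\<in>{..<n}. gt (2 * r i + 3) (r i) 0))"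
    by (intro prod_fun_span) simp_all
next
  fix \<tau> assume \<tau>: "\<tau> \<in> (\<Pi>\<^sub>E i\<in>{..<n}. gt (2 * r i + 3) (r i) 0)"
  have "std_fun (r i + 3) (r i) (\<tau> i) \<in> fun_space.span (g i ` J i)" if "i < n" for i
    using \<tau> that unfolding sp[OF that, symmetric] by (intro std_fun_mem_3) auto
  then show "prod_family n (\<lambda>i. std_fun (r i + 3) (r i)) \<tau> \<in> fun_space.span (prod_family n g ` Pi\<^sub>E {..<n} J)"
    by (intro prod_fun_span J)
qed

lemma prod_family_basis:
  assumes "\<And>i. i < n \<Longrightarrow> is_basis (J i) (g i) (cone_funs (r i + 3) (r i))"
  shows "is_basis (Pi\<^sub>E {..<n} J) (prod_family n g) (multi_funs n r)"
proof -
  have J: "\<And>i. i < n \<Longrightarrow> finite (J i)" and sp: "\<And>i. i < n \<Longrightarrow> cone_funs (r i + 3) (r i) = fun_space.span (g i ` J i)"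
    using assms by (auto simp: is_basis_def)
  have "fun_space.span (prod_family n g ` Pi\<^sub>E {..<n} J) = multi_funs n r"
    by (rule prod_family_span[OF J sp])
  moreover have "indep_fam (Pi\<^sub>E {..<n} J) (prod_family n g)"
    unfolding indep_fam_def
  proof (intro allI impI)
    fix c assume 0: "\<forall>z. (\<Sum>\<tau>\<in>Pi\<^sub>E {..<n} J. c \<tau> * prod_family n g \<tau> z) = 0"
    show "\<forall>\<tau>\<in>Pi\<^sub>E {..<n} J. c \<tau> = 0"
    proof (rule tensor_independent[where X = flag_cone and g = g])
      fix i d assume i: "i \<in> {..<n}" and d: "\<And>x. x \<in> flag_cone \<Longrightarrow> (\<Sum>j\<in>J i. d j * g i j x) = 0"
      have "(\<Sum>j\<in>J i. d j * g i j x) = 0" for x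
      proof (cases "x \<in> flag_cone")
        case False
        then have "g i j x = 0" if "j \<in> J i" for j
          using cone_funs_zero[OF is_basis_mem[OF assms[of i] that]] i by blast
        then show ?thesis by simp
      qed (rule d)
      then show "\<forall>j\<in>J i. d j = 0" using assms i by (auto simp: is_basis_def indep_fam_def)
    next
      fix z :: config assume z: "\<And>i. i \<in> {..<n} \<Longrightarrow> z i \<in> flag_cone"
      \<comment> \<open>Points of the variety vanish from index \<open>n\<close> on, which the
        product over \<open>i < n\<close> does not notice.\<close>
      define z' :: config where "z' = (\<lambda>i. if i < n then z i else 0)"
      have "z' \<in> M_variety n" using z by (simp add: M_variety_cone z'_def)
      moreover have "(\<Prod>i<n. g i (\<tau> i) (z' i)) = (\<Prod>i<n. g i (\<tau> i) (z i))" for \<tau>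
        by (intro prod.cong refl) (simp add: z'_def)
      ultimately show "(\<Sum>\<tau>\<in>Pi\<^sub>E {..<n} J. c \<tau> * (\<Prod>i\<in>{..<n}. g i (\<tau> i) (z i))) = 0"
        using spec[OF 0, of z'] by (simp add: prod_fun_def)
    qed simp
  qed
  ultimately show ?thesis using J by (auto simp: is_basis_def intro!: finite_PiE)
qed

lemma std_multi_basis:
  "is_basis (\<Pi>\<^sub>E i\<in>{..<n}. gt (2 * r i + 3) (r i) 0) (prod_family n (\<lambda>i. std_fun (r i + 3) (r i))) (multi_funs n r)"
  by (rule prod_family_basis) (rule std_basis_3)

lemma multi_funs_subspace: "fun_space.subspace (multi_funs n r)"
  by (simp add: multi_funs_def)

lemma prod_fun_multi:
  assumes "\<And>i. i < n \<Longrightarrow> f i \<in> cone_funs (r i + 3) (r i)" shows "prod_fun n f \<in> multi_funs n r"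
  unfolding multi_funs_def by (rule prod_fun_span, rule finite_gt, unfold std_span_3[symmetric], rule assms)

lemma multi_funs_zero:
  assumes "f \<in> multi_funs n r" "z \<notin> M_variety n" shows "f z = 0"
  using assms(1) unfolding multi_funs_def
proof (induction rule: fun_space.span_induct_alt)
  case (step c x y)
  then have "x z = 0" using assms(2) by (clarsimp simp: prod_fun_def)
  then show ?case using step by (simp add: fscale_apply)
qed simp

text \<open>Only the vectors are scaled, so this is not a torus element; it preserves the variety
  because the equations are bihomogeneous. It reads off the vector degrees, whereas the torus sees
  differences of degrees.\<close>

definition scale_vec :: "(nat \<Rightarrow> complex) \<Rightarrow> config \<Rightarrow> config"
  where "scale_vec s z = (\<lambda>i. (s i *s vec_of z i, covec_of z i))"

lemma scale_vec_cone: "(c *s x, y) \<in> flag_cone \<longleftrightarrow> c = 0 \<or> (x, y) \<in> flag_cone"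
proof -
  have "(\<Sum>j\<in>UNIV. y $ j * (c * x $ j)) = c * (\<Sum>j\<in>UNIV. y $ j * x $ j)"
    by (simp add: sum_distrib_left mult_ac)
  then show ?thesis by (simp add: flag_cone_def)
qed

lemma scale_vec_M: assumes "z \<in> M_variety n" shows "scale_vec s z \<in> M_variety n"
  unfolding M_variety_cone
proof (intro conjI allI impI)
  fix i assume "i < n"
  then have "(vec_of z i, covec_of z i) \<in> flag_cone" using assms by (simp add: M_variety_cone)
  then show "scale_vec s z i \<in> flag_cone" unfolding scale_vec_def scale_vec_cone by blast
next
  fix i assume "n \<le> i"
  then have "z i = 0" using assms by (simp add: M_variety_cone)
  then show "scale_vec s z i = 0" by (simp add: scale_vec_def zero_prod_def)
qed

lemma torus_act_M: assumes "z \<in> M_variety n" "\<And>i. i < n \<Longrightarrow> t i \<noteq> 0" shows "torus_act t z \<in> M_variety n"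
proof -
  have "(\<Sum>j\<in>UNIV. inverse (t i) * y $ j * (t i * x $ j)) = (\<Sum>j\<in>UNIV. y $ j * x $ j)" if "i < n" for i and x y :: "complex^3"
    using assms(2)[OF that] by (intro sum.cong refl) simp
  then show ?thesis using assms(1) unfolding M_variety_def torus_act_def
    by (simp add: zero_prod_def)
qed

lemma SL3_act_pair_act: "G \<in> SL3 \<Longrightarrow> SL3_act G z = (\<lambda>i. pair_act G (z i))"
  by (simp add: SL3_act_def pair_act_def matrix_inv_SL3)

lemma pair_act_zero: "pair_act G 0 = 0"
  by (simp add: pair_act_def prod_eq_iff)

lemma SL3_act_M: "G \<in> SL3 \<Longrightarrow> z \<in> M_variety n \<Longrightarrow> SL3_act G z \<in> M_variety n"
  by (simp add: SL3_act_pair_act M_variety_cone pair_act_cone pair_act_zero)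

lemma SL3_act_M_iff: assumes "G \<in> SL3" shows "SL3_act G z \<in> M_variety n \<longleftrightarrow> z \<in> M_variety n"
proof
  assume "SL3_act G z \<in> M_variety n"
  then have "SL3_act (adj3 G) (SL3_act G z) \<in> M_variety n" by (rule SL3_act_M[OF SL3_adj3[OF assms]])
  moreover have "SL3_act (adj3 G) (SL3_act G z) = z"
    using assms by (simp add: SL3_act_pair_act SL3_adj3 pair_act_mult adj3_mult pair_act_one)
  ultimately show "z \<in> M_variety n" by (simp only:)
qed (rule SL3_act_M[OF assms])

lemma scale_vec_SL3_act: "SL3_act G (scale_vec s z) = scale_vec s (SL3_act G z)"
  by (auto simp: SL3_act_def scale_vec_def matrix_vector_mult_def vec_eq_iff sum_distrib_left mult_ac)

lemma mon_fun_scale: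
  assumes "z \<in> flag_cone" "(c *s fst z, d *s snd z) \<in> flag_cone"
  shows "mon_fun \<alpha> \<beta> (c *s fst z, d *s snd z) = d ^ sum \<alpha> UNIV * c ^ sum \<beta> UNIV * mon_fun \<alpha> \<beta> z"
  using assms by (simp add: mon_fun_def power_mult_distrib prod.distrib power_sum[symmetric] mult_ac)

lemma std_fun_scale:
  assumes "z \<in> flag_cone" "(c *s fst z, d *s snd z) \<in> flag_cone" "\<tau> \<in> gt (a + b) b 0"
  shows "std_fun a b \<tau> (c *s fst z, d *s snd z) = d ^ a * c ^ b * std_fun a b \<tau> z"
proof -
  obtain s p q where \<tau>: "\<tau> = (s, p, q)" by (cases \<tau>) auto
  have "sum (exps (s - b) (p - max s b) (a + b - p)) UNIV = a" "sum (exps (b - s) (min s b - q) q) UNIV = b"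
    using assms(3) by (auto simp: \<tau> sum_3 gt_def)
  then show ?thesis using mon_fun_scale[OF assms(1,2)] by (simp add: \<tau> std_fun_def)
qed

lemma multi_funs_scale:
  assumes f: "f \<in> multi_funs n r" and z: "z \<in> M_variety n"
    and z': "(\<lambda>i. (c i *s vec_of z i, d i *s covec_of z i)) \<in> M_variety n" (is "?z' \<in> _")
  shows "f (\<lambda>i. (c i *s vec_of z i, d i *s covec_of z i)) = (\<Prod>i<n. d i ^ (r i + 3) * c i ^ r i) * f z"
  using f unfolding multi_funs_def
proof (induction rule: fun_space.span_induct_alt)
  case (step k x y)
  then obtain \<tau> where \<tau>: "\<tau> \<in> (\<Pi>\<^sub>E i\<in>{..<n}. gt (2 * r i + 3) (r i) 0)"
    "x = prod_family n (\<lambda>i. std_fun (r i + 3) (r i)) \<tau>" by blast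
  have "(\<Prod>i<n. std_fun (r i + 3) (r i) (\<tau> i) (?z' i)) =
      (\<Prod>i<n. d i ^ (r i + 3) * c i ^ r i * std_fun (r i + 3) (r i) (\<tau> i) (z i))"
  proof (intro prod.cong refl)
    fix i assume "i \<in> {..<n}"
    then show "std_fun (r i + 3) (r i) (\<tau> i) (?z' i) =
       d i ^ (r i + 3) * c i ^ r i * std_fun (r i + 3) (r i) (\<tau> i) (z i)"
      using z z' \<tau>(1) by (intro std_fun_scale) (auto simp: M_variety_cone)
  qed
  then have "x ?z' = (\<Prod>i<n. d i ^ (r i + 3) * c i ^ r i) * x z"
    using z z' by (simp add: \<tau>(2) prod_fun_def prod.distrib)
  then show ?case using step by (simp add: fscale_apply algebra_simps)
qed simp

lemma multi_funs_scale_vec: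
  assumes "f \<in> multi_funs n r" "z \<in> M_variety n"
  shows "f (scale_vec s z) = (\<Prod>i<n. s i ^ r i) * f z"
  using multi_funs_scale[OF assms, of s "\<lambda>_. 1"] scale_vec_M[OF assms(2), of s]
  by (simp add: scale_vec_def)

text \<open>Covector degree \<open>r i + 3\<close> and vector degree \<open>r i\<close> combine to
  the exponent \<open>r i - (r i + 3) = -3\<close> of each \<open>t i\<close>.\<close>

lemma multi_funs_torus:
  assumes "f \<in> multi_funs n r" "z \<in> M_variety n" "\<And>i. i < n \<Longrightarrow> t i \<noteq> 0"
  shows "f (torus_act t z) = (\<Prod>i<n. t i) powi (-3) * f z"
proof -
  have "inverse (t i) ^ (r i + 3) * t i ^ r i = inverse (t i) ^ 3" if "i < n" for i
    using assms(3)[OF that] by (simp add: power_add power_inverse)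
  then have "(\<Prod>i<n. inverse (t i) ^ (r i + 3) * t i ^ r i) = (\<Prod>i<n. t i) powi (-3)"
    using prod_inversef[of "\<lambda>i. t i ^ 3" "{..<n}"]
    by (simp add: power_int_minus prod_power_distrib o_def power_inverse)
  then show ?thesis
    using multi_funs_scale[OF assms(1,2), of t "\<lambda>i. inverse (t i)"] torus_act_M[OF assms(2,3)]
    by (simp add: torus_act_def)
qed

text \<open>Rescaling the vectors independently separates the multidegrees.\<close>

lemma multi_funs_separate:
  fixes C :: "(nat \<Rightarrow> nat) set"
  assumes C: "finite C" "C \<subseteq> {..<n} \<rightarrow>\<^sub>E UNIV"
    and 0: "\<And>s. (\<And>i. s i \<noteq> 0) \<Longrightarrow> (\<Sum>r\<in>C. (\<Prod>i<n. s i ^ r i) * h r) = (0::complex)" and r: "r \<in> C"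
  shows "h r = 0"
proof (rule characters_independent[where J = C and X = "{s :: nat \<Rightarrow> complex. \<forall>i. s i \<noteq> 0}"
      and m = "\<lambda>s t i. s i * t i" and e = "\<lambda>_. 1" and ch = "\<lambda>r s. \<Prod>i<n. s i ^ r i" and c = h])
  fix r r' assume rr: "r \<in> C" "r' \<in> C" "r \<noteq> r'"
  have "r \<in> {..<n} \<rightarrow>\<^sub>E UNIV" "r' \<in> {..<n} \<rightarrow>\<^sub>E UNIV" using rr C(2) by auto
  then obtain i where i: "i < n" "r i \<noteq> r' i" using PiE_ext[of r "{..<n}" "\<lambda>_. UNIV" r'] rr(3) by auto
  have "(\<Prod>j<n. (if j = i then 2 else 1) ^ q j) = (2::complex) ^ q i" for q
    using i(1) by (simp add: if_distrib[of "\<lambda>x. x ^ _"] prod.delta cong: if_cong)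
  then show "\<exists>s\<in>{s. \<forall>i. s i \<noteq> 0}. (\<Prod>i<n. s i ^ r i) \<noteq> (\<Prod>i<n. (s i :: complex) ^ r' i)"
    using i(2) by (intro bexI[of _ "\<lambda>j. if j = i then 2 else 1"]) simp_all
next
  show "(\<Sum>r\<in>C. h r * (\<Prod>i<n. s i ^ r i)) = 0" if "s \<in> {s. \<forall>i. s i \<noteq> 0}" for s
    using 0[of s] that by (simp add: mult.commute)
qed (use C r in \<open>auto simp: power_mult_distrib prod.distrib\<close>)

section \<open>The graded pieces as sums of spaces of invariants\<close>

lemma eval_poly_superset:
  assumes "finite A" "Poly_Mapping.keys p \<subseteq> A"
  shows "eval_poly x p = (\<Sum>m\<in>A. Poly_Mapping.lookup p m *
    (\<Prod>v\<in>Poly_Mapping.keys m. x v ^ Poly_Mapping.lookup m v))"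
  unfolding eval_poly_def
  by (rule sum.mono_neutral_left[OF assms]) (auto simp: in_keys_iff)

lemma eval_poly_single:
  "eval_poly x (Poly_Mapping.single m c) = c * (\<Prod>v\<in>Poly_Mapping.keys m. x v ^ Poly_Mapping.lookup m v)"
  by (subst eval_poly_superset[of "{m}"]) (auto simp: lookup_single)

lemma eval_poly_add: "eval_poly x (p + q) = eval_poly x p + eval_poly x q"
proof -
  let ?A = "Poly_Mapping.keys p \<union> Poly_Mapping.keys q"
  show ?thesis
    using eval_poly_superset[of ?A p x] eval_poly_superset[of ?A q x]
      eval_poly_superset[of ?A "p + q" x] keys_add[of p q]
    by (simp add: lookup_add algebra_simps sum.distrib)
qed

lemma eval_poly_zero: "eval_poly x 0 = 0"
  by (simp add: eval_poly_def)

lemma eval_poly_sum: "eval_poly x (\<Sum>i\<in>I. p i) = (\<Sum>i\<in>I. eval_poly x (p i))"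
  by (induction I rule: infinite_finite_induct) (simp_all add: eval_poly_zero eval_poly_add)

lemma coords_eq: "coords n = (\<lambda>(i, j). Vec i j) ` ({..<n} \<times> UNIV) \<union> (\<lambda>(i, j). Covec i j) ` ({..<n} \<times> UNIV)"
  by (auto simp: coords_def)

lemma finite_coords: "finite (coords n)"
  by (simp add: coords_eq)

text \<open>Proved in the locale, so that it applies both to sums of exponents and to products of
  powers.\<close>

lemma (in comm_monoid_set) coords_split:
  "F g (coords n) = f (F (\<lambda>i. F (\<lambda>j. g (Vec i j)) UNIV) {..<n}) (F (\<lambda>i. F (\<lambda>j. g (Covec i j)) UNIV) {..<n})"
proof -
  have "F g (coords n) = f (F g ((\<lambda>(i, j). Vec i j) ` ({..<n} \<times> UNIV))) (F g ((\<lambda>(i, j). Covec i j) ` ({..<n} \<times> UNIV)))"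
    unfolding coords_eq by (rule union_disjoint) auto
  also have "F g ((\<lambda>(i, j). Vec i j) ` ({..<n} \<times> UNIV)) = F (\<lambda>i. F (\<lambda>j. g (Vec i j)) UNIV) {..<n}"
    by (subst reindex) (auto simp: inj_on_def cartesian_product split_beta o_def)
  also have "F g ((\<lambda>(i, j). Covec i j) ` ({..<n} \<times> UNIV)) = F (\<lambda>i. F (\<lambda>j. g (Covec i j)) UNIV) {..<n}"
    by (subst reindex) (auto simp: inj_on_def cartesian_product split_beta o_def)
  finally show ?thesis .
qed

definition mono_prod :: "nat \<Rightarrow> (coord \<Rightarrow>\<^sub>0 nat) \<Rightarrow> config \<Rightarrow> complex"
  where "mono_prod n m = prod_fun n (\<lambda>i. mon_fun (\<lambda>j. Poly_Mapping.lookup m (Covec i j))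
    (\<lambda>j. Poly_Mapping.lookup m (Vec i j)))"

lemma mono_prod_eval:
  assumes "Poly_Mapping.keys m \<subseteq> coords n" "z \<in> M_variety n"
  shows "(\<Prod>v\<in>Poly_Mapping.keys m. coord_value z v ^ Poly_Mapping.lookup m v) = mono_prod n m z"
proof -
  have "(\<Prod>v\<in>Poly_Mapping.keys m. coord_value z v ^ Poly_Mapping.lookup m v)
    = (\<Prod>v\<in>coords n. coord_value z v ^ Poly_Mapping.lookup m v)"
    by (rule prod.mono_neutral_left[OF finite_coords assms(1)]) (auto simp: in_keys_iff)
  also have "\<dots> = mono_prod n m z"
    using assms(2) by (simp add: prod.coords_split mono_prod_def prod_fun_def mon_fun_def M_variety_cone prod.distrib)
  finally show ?thesis .
qed

lemma restrict_to_M_expand: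
  assumes "p \<in> ambient_polys n"
  shows "restrict_to_M n p = (\<Sum>m\<in>Poly_Mapping.keys p. fscale (Poly_Mapping.lookup p m) (mono_prod n m))"
proof
  fix z
  have "Poly_Mapping.keys m \<subseteq> coords n" if "m \<in> Poly_Mapping.keys p" for m
    using assms that by (auto simp: ambient_polys_def poly_vars_def)
  then have e: "(\<Sum>m\<in>Poly_Mapping.keys p. Poly_Mapping.lookup p m *
      (\<Prod>v\<in>Poly_Mapping.keys m. coord_value z v ^ Poly_Mapping.lookup m v)) =
      (\<Sum>m\<in>Poly_Mapping.keys p. Poly_Mapping.lookup p m * mono_prod n m z)" if "z \<in> M_variety n"
    using mono_prod_eval[OF _ that] by (intro sum.cong refl) auto
  show "restrict_to_M n p z = (\<Sum>m\<in>Poly_Mapping.keys p. fscale (Poly_Mapping.lookup p m) (mono_prod n m)) z"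
  proof (cases "z \<in> M_variety n")
    case True
    then show ?thesis using e by (simp add: restrict_to_M_def sum_fun_apply fscale_apply eval_poly_def)
  next
    case False
    then show ?thesis
      by (simp add: restrict_to_M_def sum_fun_apply fscale_apply mono_prod_def prod_fun_def)
  qed
qed

definition homogeneous_funs :: "nat \<Rightarrow> nat \<Rightarrow> (config \<Rightarrow> complex) set"
  where "homogeneous_funs n k = restrict_to_M n ` {p \<in> ambient_polys n. C_homogeneous k p}"

lemma homogeneous_funs_subspace: "fun_space.subspace (homogeneous_funs n k)"
  unfolding fun_space.subspace_def
proof (intro conjI ballI allI)
  show "0 \<in> homogeneous_funs n k"
    unfolding homogeneous_funs_def
    by (rule image_eqI[of _ _ 0])
       (auto simp: restrict_to_M_def eval_poly_zero fun_eq_iff ambient_polys_def poly_vars_def C_homogeneous_def)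
next
  fix f g assume "f \<in> homogeneous_funs n k" "g \<in> homogeneous_funs n k"
  then obtain p q where pq: "p \<in> ambient_polys n" "C_homogeneous k p" "f = restrict_to_M n p"
    "q \<in> ambient_polys n" "C_homogeneous k q" "g = restrict_to_M n q" by (auto simp: homogeneous_funs_def)
  show "f + g \<in> homogeneous_funs n k"
    unfolding homogeneous_funs_def
  proof (rule image_eqI[of _ _ "p + q"])
    show "f + g = restrict_to_M n (p + q)"
      by (simp add: pq restrict_to_M_def eval_poly_add fun_eq_iff)
    show "p + q \<in> {p \<in> ambient_polys n. C_homogeneous k p}"
      using pq keys_add[of p q] unfolding ambient_polys_def poly_vars_def C_homogeneous_def by blast
  qed
next
  fix c f assume "f \<in> homogeneous_funs n k"
  then obtain p where p: "p \<in> ambient_polys n" "C_homogeneous k p" "f = restrict_to_M n p"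
    by (auto simp: homogeneous_funs_def)
  \<comment> \<open>The scalar multiple of \<open>p\<close>, assembled termwise so that its
    monomials are visibly among those of \<open>p\<close>.\<close>
  define q where "q = (\<Sum>m\<in>Poly_Mapping.keys p. Poly_Mapping.single m (c * Poly_Mapping.lookup p m))"
  have q: "Poly_Mapping.keys q \<subseteq> Poly_Mapping.keys p"
  proof
    fix m assume m: "m \<in> Poly_Mapping.keys q"
    show "m \<in> Poly_Mapping.keys p"
    proof (rule ccontr)
      assume "m \<notin> Poly_Mapping.keys p"
      then have "Poly_Mapping.lookup q m = 0"
        unfolding q_def lookup_sum by (intro sum.neutral) (auto simp: lookup_single when_def)
      then show False using m by (simp add: in_keys_iff)
    qed
  qed
  show "fscale c f \<in> homogeneous_funs n k"
    unfolding homogeneous_funs_def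
  proof (rule image_eqI[of _ _ q])
    have "eval_poly x q = c * eval_poly x p" for x
      by (simp add: q_def eval_poly_sum eval_poly_single eval_poly_def[of x p] sum_distrib_left mult.assoc)
    then show "fscale c f = restrict_to_M n q"
      by (simp add: p restrict_to_M_def fun_eq_iff fscale_apply)
    show "q \<in> {p \<in> ambient_polys n. C_homogeneous k p}"
      using p q unfolding ambient_polys_def poly_vars_def C_homogeneous_def by blast
  qed
qed

lemma vec_degree_coords:
  assumes "Poly_Mapping.keys m \<subseteq> coords n"
  shows "vec_degree m = (\<Sum>i<n. \<Sum>j\<in>UNIV. Poly_Mapping.lookup m (Vec i j))"
proof -
  have "vec_degree m = (\<Sum>v\<in>coords n. vec_weight v * Poly_Mapping.lookup m v)"
    unfolding vec_degree_def
    by (rule sum.mono_neutral_left[OF finite_coords assms]) (auto simp: in_keys_iff)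
  then show ?thesis by (simp add: sum.coords_split)
qed

lemma mono_prod_homogeneous:
  assumes "(\<Sum>i<n. sum (\<beta> i) UNIV) = k"
  shows "prod_fun n (\<lambda>i. mon_fun (\<alpha> i) (\<beta> i)) \<in> homogeneous_funs n k"
proof -
  \<comment> \<open>The exponents are cut off at \<open>n\<close>, which makes the support
    finite.\<close>
  define f where "f v = (case v of Vec i j \<Rightarrow> if i < n then \<beta> i j else 0 | Covec i j \<Rightarrow> if i < n then \<alpha> i j else 0)" for v
  define m where "m = Abs_poly_mapping f"
  have sub: "{v. f v \<noteq> 0} \<subseteq> coords n"
  proof
    fix v assume "v \<in> {v. f v \<noteq> 0}"
    then show "v \<in> coords n" by (cases v) (auto simp: f_def coords_def split: if_splits)
  qed
  have l: "Poly_Mapping.lookup m = f"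
    unfolding m_def by (rule lookup_Abs_poly_mapping) (rule finite_subset[OF sub finite_coords])
  have keys: "Poly_Mapping.keys m \<subseteq> coords n" using sub by (auto simp: in_keys_iff l)
  have deg: "vec_degree m = k"
    unfolding vec_degree_coords[OF keys] l using assms by (simp add: f_def)
  have e: "mono_prod n m = prod_fun n (\<lambda>i. mon_fun (\<alpha> i) (\<beta> i))"
    by (intro ext) (simp add: mono_prod_def prod_fun_def l f_def)
  have p: "Poly_Mapping.single m (1::complex) \<in> ambient_polys n"
    using keys by (simp add: ambient_polys_def poly_vars_def)
  have "restrict_to_M n (Poly_Mapping.single m 1) = mono_prod n m"
    unfolding restrict_to_M_expand[OF p] by (simp add: fscale_def)
  then show ?thesis
    unfolding homogeneous_funs_def e[symmetric]
    by (intro image_eqI[of _ _ "Poly_Mapping.single m 1"]) (use p deg in \<open>auto simp: C_homogeneous_def\<close>)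
qed

lemma finite_compositions: "finite (compositions n k)"
proof (rule finite_subset)
  show "compositions n k \<subseteq> {..<n} \<rightarrow>\<^sub>E {..k}"
  proof
    fix r assume r: "r \<in> compositions n k"
    have "r i \<le> k" if "i < n" for i
      using r member_le_sum[of i "{..<n}" r] that by (simp add: compositions_def)
    then show "r \<in> {..<n} \<rightarrow>\<^sub>E {..k}" using r by (auto simp: compositions_def)
  qed
qed (simp add: finite_PiE)

lemma multi_funs_homogeneous:
  assumes "r \<in> compositions n k" shows "multi_funs n r \<subseteq> homogeneous_funs n k"
  unfolding multi_funs_def
proof (intro fun_space.span_minimal homogeneous_funs_subspace image_subsetI)
  fix \<tau> assume \<tau>: "\<tau> \<in> (\<Pi>\<^sub>E i\<in>{..<n}. gt (2 * r i + 3) (r i) 0)"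
  let ?b = "\<lambda>i. case \<tau> i of (s, p, q) \<Rightarrow> exps (r i - s) (min s (r i) - q) q"
  let ?a = "\<lambda>i. case \<tau> i of (s, p, q) \<Rightarrow> exps (s - r i) (p - max s (r i)) (2 * r i + 3 - p)"
  have "sum (?b i) UNIV = r i" if "i < n" for i
    using PiE_mem[OF \<tau>, of i] that by (auto simp: sum_3 gt_def split: prod.splits)
  then have "(\<Sum>i<n. sum (?b i) UNIV) = k" using assms by (simp add: compositions_def)
  then have "prod_fun n (\<lambda>i. mon_fun (?a i) (?b i)) \<in> homogeneous_funs n k" by (rule mono_prod_homogeneous)
  moreover have "std_fun (r i + 3) (r i) (\<tau> i) = mon_fun (?a i) (?b i)" for i
    unfolding std_fun_def top_row by (cases "\<tau> i") simp
  ultimately show "prod_family n (\<lambda>i. std_fun (r i + 3) (r i)) \<tau> \<in> homogeneous_funs n k" by simp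
qed

definition inv_funs :: "nat \<Rightarrow> (nat \<Rightarrow> nat) \<Rightarrow> (config \<Rightarrow> complex) set"
  where "inv_funs n r = {f \<in> multi_funs n r. \<forall>G\<in>SL3. \<forall>z\<in>M_variety n. f (SL3_act G z) = f z}"

lemma inv_funs_subspace: "fun_space.subspace (inv_funs n r)"
  using multi_funs_subspace[of n r]
  by (auto simp: fun_space.subspace_def inv_funs_def fscale_apply)

text \<open>The sum of the spaces \<open>multi_funs n r\<close> is direct: under
  \<open>scale_vec s\<close> the summands at a point acquire distinct characters of
  \<open>s\<close>.\<close>

lemma multi_funs_sum_eq_0:
  assumes h: "\<And>r. r \<in> compositions n k \<Longrightarrow> h r \<in> multi_funs n r"
    and 0: "(\<Sum>r\<in>compositions n k. h r) = 0" and r: "r \<in> compositions n k"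
  shows "h r = 0"
proof
  fix z
  show "h r z = 0 z"
  proof (cases "z \<in> M_variety n")
    case True
    have "h r z = 0"
    proof (rule multi_funs_separate[OF finite_compositions _ _ r, where h = "\<lambda>r. h r z"])
      fix s :: "nat \<Rightarrow> complex"
      have "(\<Sum>r\<in>compositions n k. h r (scale_vec s z)) = 0"
        using fun_cong[OF 0, of "scale_vec s z"] by (simp add: sum_fun_apply)
      then show "(\<Sum>r\<in>compositions n k. (\<Prod>i<n. s i ^ r i) * h r z) = 0"
        using multi_funs_scale_vec[OF h True] by simp
    qed (auto simp: compositions_def)
    then show ?thesis by simp
  qed (use multi_funs_zero[OF h[OF r]] in simp)
qed

lemma mono_prod_torus:
  assumes z: "z \<in> M_variety n" and t: "\<And>i. t i \<noteq> 0"
  shows "mono_prod n m (torus_act t z) = (\<Prod>i<n. t i powi (int (\<Sum>j\<in>UNIV. Poly_Mapping.lookup m (Vec i j))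
    - int (\<Sum>j\<in>UNIV. Poly_Mapping.lookup m (Covec i j)))) * mono_prod n m z"
proof -
  have z': "torus_act t z \<in> M_variety n" by (rule torus_act_M[OF z]) (rule t)
  let ?f = "\<lambda>i. mon_fun (\<lambda>j. Poly_Mapping.lookup m (Covec i j)) (\<lambda>j. Poly_Mapping.lookup m (Vec i j))"
  have "?f i (torus_act t z i) = t i powi (int (\<Sum>j\<in>UNIV. Poly_Mapping.lookup m (Vec i j))
    - int (\<Sum>j\<in>UNIV. Poly_Mapping.lookup m (Covec i j))) * ?f i (z i)" if i: "i < n" for i
  proof -
    have c: "z i \<in> flag_cone" "(t i *s vec_of z i, inverse (t i) *s covec_of z i) \<in> flag_cone"
      using z z' i by (simp_all add: M_variety_cone torus_act_def)
    have "t i powi (int B - int A) = t i ^ B * inverse (t i) ^ A" for A B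
      using t[of i] by (simp add: power_int_diff divide_inverse power_inverse)
    then show ?thesis
      using mon_fun_scale[OF c] by (simp only: torus_act_def mult.commute)
  qed
  then have "(\<Prod>i<n. ?f i (torus_act t z i)) = (\<Prod>i<n. t i powi (int (\<Sum>j\<in>UNIV. Poly_Mapping.lookup m (Vec i j))
    - int (\<Sum>j\<in>UNIV. Poly_Mapping.lookup m (Covec i j))) * ?f i (z i))"
    by (intro prod.cong refl) simp
  then show ?thesis using z z' by (simp add: mono_prod_def prod_fun_def prod.distrib)
qed

text \<open>The analogue of \<open>multi_funs_separate\<close> for Laurent exponents. Setting one
  coordinate to 2 and taking absolute values distinguishes two exponents, and exponents from
  \<open>n\<close> on are zero.\<close>

lemma torus_separate:
  fixes J :: "(nat \<Rightarrow> int) set"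
  assumes J: "finite J" "\<And>e i. e \<in> J \<Longrightarrow> i \<ge> n \<Longrightarrow> e i = 0"
    and 0: "\<And>t. (\<And>i. t i \<noteq> 0) \<Longrightarrow> (\<Sum>e\<in>J. h e * (\<Prod>i<n. t i powi e i)) = (0::complex)" and e: "e \<in> J"
  shows "h e = 0"
proof (rule characters_independent[where J = J and X = "{s :: nat \<Rightarrow> complex. \<forall>i. s i \<noteq> 0}"
      and m = "\<lambda>s t i. s i * t i" and e = "\<lambda>_. 1" and ch = "\<lambda>r s. \<Prod>i<n. s i powi r i" and c = h])
  fix r r' assume rr: "r \<in> J" "r' \<in> J" "r \<noteq> r'"
  then obtain i where i: "r i \<noteq> r' i" by (auto simp: fun_eq_iff)
  then have n: "i < n" using J(2) rr by (metis not_less)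
  have "(\<Prod>j<n. (if j = i then 2 else 1) powi q j) = (2::complex) powi q i" for q
    using n by (simp add: if_distrib[of "\<lambda>x. x powi _"] prod.delta cong: if_cong)
  moreover have "(2::complex) powi r i \<noteq> 2 powi r' i"
  proof
    assume "(2::complex) powi r i = 2 powi r' i"
    then have "cmod (2 powi r i) = cmod (2 powi r' i)" by simp
    then have "(2::real) powi r i = 2 powi r' i" by (simp add: norm_power_int)
    then show False
      using i power_int_strict_increasing[of "r i" "r' i" "2::real"] power_int_strict_increasing[of "r' i" "r i" "2::real"]
      by linarith
  qed
  ultimately show "\<exists>s\<in>{s. \<forall>i. s i \<noteq> 0}. (\<Prod>i<n. s i powi r i) \<noteq> (\<Prod>i<n. (s i :: complex) powi r' i)"
    by (intro bexI[of _ "\<lambda>j. if j = i then 2 else 1"]) simp_all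
next
  show "(\<Sum>r\<in>J. h r * (\<Prod>i<n. s i powi r i)) = 0" if "s \<in> {s. \<forall>i. s i \<noteq> 0}" for s
    using 0[of s] that by simp
qed (use J e in \<open>auto simp: power_int_mult_distrib prod.distrib\<close>)

text \<open>The function \<open>H\<close> has torus weight -3, but a polynomial \<open>p\<close>
  representing it can contain other weights that cancel on the variety. At a fixed point the
  characters of the torus separate these weights, so \<open>H\<close> equals the contribution of the
  monomials in \<open>K\<close>. For them each covector degree exceeds the vector degree by 3, and
  grouping by vector degrees gives the components.\<close>

lemma W_graded_split:
  assumes H: "H \<in> W_graded n k"
  obtains h where "\<And>r. r \<in> compositions n k \<Longrightarrow> h r \<in> multi_funs n r" "H = (\<Sum>r\<in>compositions n k. h r)"
proof -
  obtain p where p: "p \<in> ambient_polys n" "C_homogeneous k p" "H = restrict_to_M n p"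
    using H by (auto simp: W_graded_def)
  let ?K = "Poly_Mapping.keys p"
  define b where "b m i = (\<Sum>j\<in>UNIV. Poly_Mapping.lookup m (Vec i j) :: nat)" for m i
  define a where "a m i = (\<Sum>j\<in>UNIV. Poly_Mapping.lookup m (Covec i j) :: nat)" for m i
  define e where "e m = (\<lambda>i. if i < n then int (b m i) - int (a m i) else 0)" for m
  define e0 where "e0 = (\<lambda>i. if i < n then -3 else 0 :: int)"
  define K where "K = {m \<in> ?K. e m = e0}"
  define h where "h r = (\<Sum>m\<in>{m \<in> K. restrict (b m) {..<n} = r}. fscale (Poly_Mapping.lookup p m) (mono_prod n m))" for r
  have H_eq: "H z = (\<Sum>m\<in>?K. Poly_Mapping.lookup p m * mono_prod n m z)" for z
    unfolding p(3) restrict_to_M_expand[OF p(1)] by (simp add: sum_fun_apply fscale_apply)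
  have H_K: "H z = (\<Sum>m\<in>K. Poly_Mapping.lookup p m * mono_prod n m z)" for z
  proof (cases "z \<in> M_variety n")
    case True
    \<comment> \<open>Coefficient of the character \<open>x\<close> in the equation expressing the
      weight of \<open>H\<close>, all moved to one side. The exponent \<open>e0\<close> is inserted
      into the index set because \<open>p\<close> may have no monomial of that weight.\<close>
    let ?c = "\<lambda>x. (\<Sum>m\<in>{m \<in> ?K. e m = x}. Poly_Mapping.lookup p m * mono_prod n m z) - (if x = e0 then H z else 0)"
    have "?c e0 = 0"
    proof (rule torus_separate[where J = "insert e0 (e ` ?K)" and n = n and h = ?c])
      fix t :: "nat \<Rightarrow> complex" assume t: "\<And>i. t i \<noteq> 0"
      let ?x = "\<lambda>x. \<Prod>i<n. t i powi x i"
      have tz: "mono_prod n m (torus_act t z) = ?x (e m) * mono_prod n m z" for m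
        unfolding mono_prod_torus[OF True t]
        by (intro arg_cong2[of _ _ _ _ "(*)"] prod.cong refl) (simp add: e_def a_def b_def)
      have x0: "?x e0 = (\<Prod>i<n. t i) powi (-3)"
        by (simp add: e0_def prod_power_distrib power_int_minus flip: prod_inversef cong: prod.cong_simp)
      have "(\<Sum>x\<in>insert e0 (e ` ?K). ?c x * ?x x) =
        (\<Sum>x\<in>insert e0 (e ` ?K). (\<Sum>m\<in>{m \<in> ?K. e m = x}. Poly_Mapping.lookup p m * (?x (e m) * mono_prod n m z)))
         - (\<Sum>x\<in>insert e0 (e ` ?K). if x = e0 then ?x x * H z else 0)"
        unfolding sum_subtractf[symmetric]
      proof (intro sum.cong refl)
        fix x
        have "(\<Sum>m\<in>{m \<in> ?K. e m = x}. Poly_Mapping.lookup p m * (?x (e m) * mono_prod n m z))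
          = (\<Sum>m\<in>{m \<in> ?K. e m = x}. Poly_Mapping.lookup p m * mono_prod n m z) * ?x x"
          unfolding sum_distrib_right by (rule sum.cong) (auto simp: mult_ac)
        then show "?c x * ?x x = (\<Sum>m\<in>{m \<in> ?K. e m = x}. Poly_Mapping.lookup p m *
            (?x (e m) * mono_prod n m z)) - (if x = e0 then ?x x * H z else 0)"
          by (simp add: right_diff_distrib mult.commute)
      qed
      also have "(\<Sum>x\<in>insert e0 (e ` ?K). if x = e0 then ?x x * H z else 0) = ?x e0 * H z"
        by (subst sum.delta) auto
      also have "(\<Sum>x\<in>insert e0 (e ` ?K). (\<Sum>m\<in>{m \<in> ?K. e m = x}. Poly_Mapping.lookup p m * (?x (e m) * mono_prod n m z)))
        = (\<Sum>m\<in>?K. Poly_Mapping.lookup p m * (?x (e m) * mono_prod n m z))"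
        by (rule sum.group) auto
      also have "\<dots> = H (torus_act t z)" by (simp add: H_eq tz)
      also have "\<dots> = ?x e0 * H z"
        using H t True unfolding x0 by (auto simp: W_graded_def W_space_def)
      finally show "(\<Sum>x\<in>insert e0 (e ` ?K). ?c x * ?x x) = 0" by simp
    qed (auto simp: e_def e0_def)
    then show ?thesis by (simp add: K_def)
  next
    case False
    then show ?thesis by (simp add: p(3) restrict_to_M_def mono_prod_def prod_fun_def)
  qed
  have K: "restrict (b m) {..<n} \<in> compositions n k" "\<And>i. i < n \<Longrightarrow> a m i = b m i + 3" if "m \<in> K" for m
  proof -
    have "Poly_Mapping.keys m \<subseteq> coords n" "vec_degree m = k"
      using p that by (auto simp: K_def ambient_polys_def poly_vars_def C_homogeneous_def)
    then show "restrict (b m) {..<n} \<in> compositions n k"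
      using vec_degree_coords[of m n] by (simp add: compositions_def b_def)
    show "a m i = b m i + 3" if "i < n" for i
    proof -
      have "e m i = e0 i" using \<open>m \<in> K\<close> by (simp add: K_def)
      then show ?thesis using that by (simp add: e_def e0_def)
    qed
  qed
  show thesis
  proof (rule that[of h])
    show "h r \<in> multi_funs n r" if "r \<in> compositions n k" for r
      unfolding h_def
    proof (intro fun_space.subspace_sum fun_space.subspace_scale multi_funs_subspace)
      fix m assume m: "m \<in> {m \<in> K. restrict (b m) {..<n} = r}"
      have "mon_fun (\<lambda>j. Poly_Mapping.lookup m (Covec i j)) (\<lambda>j. Poly_Mapping.lookup m (Vec i j))
          \<in> cone_funs (r i + 3) (r i)" if "i < n" for i
      proof -
        have "r i = b m i" using m that by auto
        then show ?thesis using K(2)[of m i] m that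
          unfolding cone_funs_def a_def b_def by (intro fun_space.span_base) force
      qed
      then show "mono_prod n m \<in> multi_funs n r" unfolding mono_prod_def by (rule prod_fun_multi)
    qed
    show "H = (\<Sum>r\<in>compositions n k. h r)"
    proof
      fix z
      have "(\<Sum>r\<in>compositions n k. h r z) = (\<Sum>r\<in>compositions n k.
          \<Sum>m\<in>{m \<in> K. restrict (b m) {..<n} = r}. Poly_Mapping.lookup p m * mono_prod n m z)"
        by (simp add: h_def sum_fun_apply fscale_apply)
      also have "\<dots> = H z"
        unfolding H_K using K(1) by (intro sum.group finite_compositions) (auto simp: K_def)
      finally show "H z = (\<Sum>r\<in>compositions n k. h r) z" by (simp add: sum_fun_apply)
    qed
  qed
qed

text \<open>Invariance descends to the components because \<open>scale_vec\<close> commutes with the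
  group: invariance of \<open>H\<close> at all rescaled points is an identity between characters of
  \<open>s\<close>, with the defects of invariance of the \<open>h r\<close> as
  coefficients.\<close>

lemma W_graded_eq:
  "W_graded n k = {\<Sum>r\<in>compositions n k. h r | h. \<forall>r\<in>compositions n k. h r \<in> inv_funs n r}"
proof (intro subset_antisym subsetI)
  fix H assume H: "H \<in> W_graded n k"
  obtain h where h: "\<And>r. r \<in> compositions n k \<Longrightarrow> h r \<in> multi_funs n r" "H = (\<Sum>r\<in>compositions n k. h r)"
    using W_graded_split[OF H] by blast
  have "h r \<in> inv_funs n r" if r: "r \<in> compositions n k" for r
    unfolding inv_funs_def
  proof (intro CollectI conjI h(1)[OF r] ballI)
    fix G z assume G: "G \<in> SL3" and z: "z \<in> M_variety n"
    have "h r (SL3_act G z) - h r z = 0"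
    proof (rule multi_funs_separate[OF finite_compositions _ _ r, where h = "\<lambda>r. h r (SL3_act G z) - h r z"])
      fix s :: "nat \<Rightarrow> complex"
      have "H (SL3_act G (scale_vec s z)) = H (scale_vec s z)"
        using H G scale_vec_M[OF z] by (auto simp: W_graded_def W_space_def)
      then have "(\<Sum>r\<in>compositions n k. h r (scale_vec s (SL3_act G z))) = (\<Sum>r\<in>compositions n k. h r (scale_vec s z))"
        by (simp add: h(2) scale_vec_SL3_act sum_fun_apply)
      then show "(\<Sum>r\<in>compositions n k. (\<Prod>i<n. s i ^ r i) * (h r (SL3_act G z) - h r z)) = 0"
        using multi_funs_scale_vec[OF h(1) z] multi_funs_scale_vec[OF h(1) SL3_act_M[OF G z]]
        by (simp add: right_diff_distrib sum_subtractf)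
    qed (auto simp: compositions_def)
    then show "h r (SL3_act G z) = h r z" by simp
  qed
  then show "H \<in> {\<Sum>r\<in>compositions n k. h r | h. \<forall>r\<in>compositions n k. h r \<in> inv_funs n r}"
    using h(2) by blast
next
  fix H assume "H \<in> {\<Sum>r\<in>compositions n k. h r | h. \<forall>r\<in>compositions n k. h r \<in> inv_funs n r}"
  then obtain h where h: "H = (\<Sum>r\<in>compositions n k. h r)" "\<And>r. r \<in> compositions n k \<Longrightarrow> h r \<in> inv_funs n r"
    by blast
  have m: "h r \<in> multi_funs n r" if "r \<in> compositions n k" for r
    using h(2)[OF that] by (simp add: inv_funs_def)
  have "H \<in> homogeneous_funs n k"
    unfolding h(1) using m multi_funs_homogeneous
    by (intro fun_space.subspace_sum homogeneous_funs_subspace) blast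
  moreover have "H (SL3_act G z) = H z" if "G \<in> SL3" "z \<in> M_variety n" for G z
    unfolding h(1) sum_fun_apply by (intro sum.cong refl) (use h(2) that in \<open>simp add: inv_funs_def\<close>)
  moreover have "H (torus_act t z) = (\<Prod>i<n. t i) powi (-3) * H z"
    if "\<And>i. i < n \<Longrightarrow> t i \<noteq> 0" "z \<in> M_variety n" for t z
    unfolding h(1) sum_fun_apply sum_distrib_left
    by (rule sum.cong[OF refl], rule multi_funs_torus[OF m that(2) that(1)])
  ultimately show "H \<in> W_graded n k"
    by (auto simp: W_graded_def W_space_def homogeneous_funs_def coordinate_ring_def)
qed

section \<open>Tensor products of representations as functions on the variety\<close>

lemma unit_fun_basis: "finite I \<Longrightarrow> is_basis I unit_fun (supported I)"
proof -
  assume I: "finite I"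
  have "indep_fam I unit_fun"
    using I by (auto simp: indep_fam_def unit_fun_def if_distrib sum.delta cong: if_cong)
  moreover have "fun_space.span (unit_fun ` I) \<subseteq> supported I"
    by (intro fun_space.span_minimal subspace_supported) (auto simp: supported_def unit_fun_def)
  ultimately show ?thesis using I supported_span[OF I] by (auto simp: is_basis_def)
qed

lemma rep_act_unit_fun:
  assumes "finite (idx R)" "j \<in> idx R"
  shows "rep_act R G (unit_fun j) = (\<Sum>k\<in>idx R. fscale (entry R G k j) (unit_fun k))"
proof
  fix i
  have "(\<Sum>l\<in>idx R. entry R G i l * (if l = j then 1 else 0)) = entry R G i j"
    using assms by (simp add: if_distrib sum.delta cong: if_cong)
  moreover have "(\<Sum>k\<in>idx R. entry R G k j * (if i = k then 1 else 0)) = (if i \<in> idx R then entry R G i j else 0)"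
    using assms by (simp add: if_distrib sum.delta cong: if_cong)
  ultimately show "rep_act R G (unit_fun j) i = (\<Sum>k\<in>idx R. fscale (entry R G k j) (unit_fun k)) i"
    by (simp add: rep_act_def unit_fun_def sum_fun_apply fscale_apply)
qed

text \<open>Equivariance of the multiplication map from a tensor product to functions. It is phrased
  for families that transform by the matrices of \<open>R i\<close>, so that it covers both bases
  and the dependent family \<open>slot_fun\<close>.\<close>

lemma prod_map_act:
  fixes R :: "nat \<Rightarrow> 'i sl3_rep"
  assumes fin: "\<And>i. i < n \<Longrightarrow> finite (idx (R i))"
    and pull_g: "\<And>i j. i < n \<Longrightarrow> j \<in> idx (R i) \<Longrightarrow>
      pull G (g i j) = (\<Sum>k\<in>idx (R i). fscale (entry (R i) G k j) (g i k))"
    and G: "G \<in> SL3" and z: "z \<in> M_variety n"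
  shows "(\<Sum>J\<in>idx (tensor_rep n R). fscale (rep_act (tensor_rep n R) G x J) (prod_family n g J)) z =
    (\<Sum>J\<in>idx (tensor_rep n R). fscale (x J) (prod_family n g J)) (SL3_act (adj3 G) z)"
proof -
  let ?T = "tensor_rep n R"
  let ?I = "\<Pi>\<^sub>E i\<in>{..<n}. idx (R i)"
  have idx: "idx ?T = ?I" by (simp add: tensor_rep_def)
  define X where "X x = (\<Sum>J\<in>?I. fscale (x J) (prod_family n g J))" for x
  have z': "SL3_act (adj3 G) z \<in> M_variety n" using G z by (intro SL3_act_M SL3_adj3)
  have "prod_family n g J (SL3_act (adj3 G) z) =
      (\<Sum>K\<in>?I. (\<Prod>i<n. entry (R i) G (K i) (J i)) * prod_family n g K z)" if J: "J \<in> ?I" for J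
  proof -
    have "prod_family n g J (SL3_act (adj3 G) z) = (\<Prod>i<n. pull G (g i (J i)) (z i))"
      using z' G by (simp add: prod_fun_def SL3_act_pair_act SL3_adj3 pull_def)
    also have "\<dots> = (\<Prod>i<n. \<Sum>k\<in>idx (R i). entry (R i) G k (J i) * g i k (z i))"
    proof (intro prod.cong refl)
      fix i assume "i \<in> {..<n}"
      then have "i < n" "J i \<in> idx (R i)" using J by auto
      then show "pull G (g i (J i)) (z i) = (\<Sum>k\<in>idx (R i). entry (R i) G k (J i) * g i k (z i))"
        by (simp only: pull_g sum_fun_apply fscale_apply)
    qed
    also have "\<dots> = (\<Sum>K\<in>?I. \<Prod>i<n. entry (R i) G (K i) (J i) * g i (K i) (z i))"
      by (rule prod_sum_PiE) (use fin in auto)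
    finally show ?thesis using z by (simp add: prod_fun_def prod.distrib)
  qed
  then have "X x (SL3_act (adj3 G) z) = (\<Sum>J\<in>?I. x J *
      (\<Sum>K\<in>?I. (\<Prod>i<n. entry (R i) G (K i) (J i)) * prod_family n g K z))"
    by (simp add: X_def sum_fun_apply fscale_apply)
  also have "\<dots> = (\<Sum>K\<in>?I. (\<Sum>J\<in>?I. (\<Prod>i<n. entry (R i) G (K i) (J i)) * x J) * prod_family n g K z)"
    unfolding sum_distrib_left sum_distrib_right by (subst sum.swap) (simp add: mult_ac)
  also have "\<dots> = X (rep_act ?T G x) z"
    by (simp add: X_def sum_fun_apply fscale_apply rep_act_def idx) (simp add: tensor_rep_def)
  finally show ?thesis by (simp only: X_def idx)
qed

text \<open>Each \<open>irrep_iso\<close> carries the coordinate basis of a factor to a basis of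
  functions on the cone. The products of these are a basis of \<open>multi_funs n r\<close> on which
  the group acts by the Kronecker product, so invariant tensors match invariant functions.\<close>

lemma tensor_invariants_iso:
  fixes R :: "nat \<Rightarrow> 'i sl3_rep"
  assumes irr: "\<And>i. i < n \<Longrightarrow> irrep_with_highest_weight (R i) (r i + 3) (r i)"
  obtains X where "Vector_Spaces.linear fscale fscale X"
    "X ` rep_invariants (tensor_rep n R) = inv_funs n r"
    "\<And>x. x \<in> rep_invariants (tensor_rep n R) \<Longrightarrow> X x = 0 \<Longrightarrow> x = 0"
proof -
  have fin: "finite (idx (R i))" if "i < n" for i
    using irr[OF that] by (auto simp: irrep_with_highest_weight_def irreducible_rep_def is_rep_def)
  define Q where "Q i L \<longleftrightarrow> Vector_Spaces.linear fscale fscale L \<and>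
    L ` rep_space (R i) = cone_funs (r i + 3) (r i) \<and>
    (\<forall>x\<in>rep_space (R i). L x = 0 \<longrightarrow> x = 0) \<and>
    (\<forall>G\<in>SL3. \<forall>x\<in>rep_space (R i). L (rep_act (R i) G x) = pull G (L x))" for i L
  have "\<exists>L. Q i L" if "i < n" for i
    by (rule irrep_iso[OF irr[OF that]]) (auto simp: Q_def)
  then have "\<forall>i. \<exists>L. i < n \<longrightarrow> Q i L" by simp
  from choice[OF this] obtain L where "\<forall>i<n. Q i (L i)" by (rule exE)
  then have L: "\<And>i. i < n \<Longrightarrow> Vector_Spaces.linear fscale fscale (L i)"
    "\<And>i. i < n \<Longrightarrow> L i ` rep_space (R i) = cone_funs (r i + 3) (r i)"
    "\<And>i x. i < n \<Longrightarrow> x \<in> rep_space (R i) \<Longrightarrow> L i x = 0 \<Longrightarrow> x = 0"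
    "\<And>i G x. i < n \<Longrightarrow> G \<in> SL3 \<Longrightarrow> x \<in> rep_space (R i) \<Longrightarrow> L i (rep_act (R i) G x) = pull G (L i x)"
    by (simp_all add: Q_def)
  define g where "g i j = L i (unit_fun j)" for i j
  have basis: "is_basis (idx (R i)) (g i) (cone_funs (r i + 3) (r i))" if i: "i < n" for i
    using is_basis_image[OF unit_fun_basis[OF fin[OF i]] L(1)[OF i]] L(2,3)[OF i]
    unfolding g_def rep_space_supported by metis
  have pull_g: "pull G (g i j) = (\<Sum>k\<in>idx (R i). fscale (entry (R i) G k j) (g i k))"
    if "i < n" "j \<in> idx (R i)" "G \<in> SL3" for G i j
  proof -
    have "unit_fun j \<in> rep_space (R i)"
      using that by (auto simp: rep_space_def unit_fun_def)
    then have "pull G (g i j) = L i (rep_act (R i) G (unit_fun j))"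
      unfolding g_def using L(4) that by simp
    then show ?thesis
      unfolding rep_act_unit_fun[OF fin[OF that(1)] that(2)] g_def by (simp only: linear_fam[OF L(1)[OF that(1)]])
  qed
  let ?T = "tensor_rep n R"
  let ?I = "\<Pi>\<^sub>E i\<in>{..<n}. idx (R i)"
  have I: "finite ?I" using fin by (intro finite_PiE) auto
  have idx: "idx ?T = ?I" by (simp add: tensor_rep_def)
  have pb: "is_basis ?I (prod_family n g) (multi_funs n r)"
    by (rule prod_family_basis) (rule basis)
  define X where "X x = (\<Sum>J\<in>?I. fscale (x J) (prod_family n g J))" for x
  have lin: "Vector_Spaces.linear fscale fscale X"
    by (rule fscale_linearI)
       (simp_all add: X_def fun_eq_iff sum_fun_apply fscale_apply algebra_simps sum.distrib sum_distrib_left)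
  have X_mem: "X x \<in> multi_funs n r" for x
  proof -
    have "multi_funs n r = fun_space.span (prod_family n g ` ?I)" using pb by (simp add: is_basis_def)
    then show ?thesis unfolding X_def by (simp only: fam_in_span)
  qed
  have X_0: "x = 0" if "x \<in> rep_space ?T" "X x = 0" for x
  proof
    fix J
    show "x J = 0 J"
    proof (cases "J \<in> ?I")
      case True
      then show ?thesis using indep_famD[of ?I "prod_family n g" x J] pb that(2)
        by (simp add: X_def is_basis_def)
    next
      case False
      then show ?thesis using that(1) by (simp add: rep_space_def idx)
    qed
  qed
  have X_act: "X (rep_act ?T G x) z = X x (SL3_act (adj3 G) z)" if G: "G \<in> SL3" and z: "z \<in> M_variety n" for G x z
    using prod_map_act[of n R G g z x, OF fin pull_g] G z unfolding X_def idx by blast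
  have inv: "x \<in> rep_invariants ?T \<longleftrightarrow> X x \<in> inv_funs n r" if x: "x \<in> rep_space ?T" for x
  proof
    assume "x \<in> rep_invariants ?T"
    then have "X x (SL3_act G z) = X x z" if "G \<in> SL3" "z \<in> M_variety n" for G z
      using X_act[OF SL3_adj3[OF that(1)] that(2), of x] that
      by (simp add: rep_invariants_def SL3_adj3 adj3_adj3)
    then show "X x \<in> inv_funs n r" by (simp add: inv_funs_def X_mem)
  next
    assume Xx: "X x \<in> inv_funs n r"
    have "rep_act ?T G x = x" if G: "G \<in> SL3" for G
    proof -
      have "X (rep_act ?T G x) = X x"
      proof
        fix z
        show "X (rep_act ?T G x) z = X x z"
        proof (cases "z \<in> M_variety n")
          case True
          then show ?thesis using X_act[OF G] Xx SL3_adj3[OF G] by (simp add: inv_funs_def)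
        next
          case False
          then show ?thesis using multi_funs_zero[OF X_mem] by simp
        qed
      qed
      then have "X (rep_act ?T G x - x) = 0" by (simp add: fun_pair.linear_diff[OF lin])
      moreover have "rep_act ?T G x - x \<in> rep_space ?T"
        using x rep_act_closed[of ?T G x] by (simp add: rep_space_def)
      ultimately have "rep_act ?T G x - x = 0" using X_0 by blast
      then show ?thesis by simp
    qed
    then show "x \<in> rep_invariants ?T" using x by (simp add: rep_invariants_def)
  qed
  show thesis
  proof (rule that[OF lin])
    show "X ` rep_invariants ?T = inv_funs n r"
    proof (intro subset_antisym subsetI)
      fix f assume "f \<in> X ` rep_invariants ?T"
      then show "f \<in> inv_funs n r" using inv by (auto simp: rep_invariants_def)
    next
      fix f assume f: "f \<in> inv_funs n r"
      then have "f \<in> fun_space.span (prod_family n g ` ?I)" using pb by (simp add: inv_funs_def is_basis_def)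
      then obtain c where c: "f = (\<Sum>J\<in>?I. fscale (c J) (prod_family n g J))" using span_fam[OF I] by blast
      define x where "x = (\<lambda>J. if J \<in> ?I then c J else 0)"
      have "x \<in> rep_space ?T" by (simp add: rep_space_def idx x_def)
      moreover have "X x = f" unfolding X_def c by (rule sum.cong) (auto simp: x_def)
      ultimately show "f \<in> X ` rep_invariants ?T" using inv f by blast
    qed
    show "x = 0" if "x \<in> rep_invariants ?T" "X x = 0" for x
      using X_0 that by (simp add: rep_invariants_def)
  qed
qed

lemma rep_invariants_subspace: "fun_space.subspace (rep_invariants R)"
  unfolding fun_space.subspace_def rep_invariants_def rep_space_supported
  using subspace_supported[of "idx R"]
  by (simp add: fun_space.subspace_def fun_pair.linear_0[OF linear_rep_act]
      fun_pair.linear_add[OF linear_rep_act] fun_pair.linear_scale[OF linear_rep_act])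

lemma direct_sum_subspace:
  assumes "\<And>i. i \<in> I \<Longrightarrow> fun_space.subspace (S i)" shows "fun_space.subspace (direct_sum I S)"
proof -
  have "(\<lambda>a. 0) \<in> S i" "f \<in> S i \<Longrightarrow> g \<in> S i \<Longrightarrow> (\<lambda>a. f a + g a) \<in> S i" "f \<in> S i \<Longrightarrow> (\<lambda>a. c * f a) \<in> S i"
    if "i \<in> I" for i f g c
    using fun_space.subspace_0[OF assms[OF that]] fun_space.subspace_add[OF assms[OF that], of f g]
      fun_space.subspace_scale[OF assms[OF that], of f c]
    by (simp_all add: zero_fun_def plus_fun_def fscale_def)
  then show ?thesis
    by (simp add: fun_space.subspace_def direct_sum_def fscale_apply)
qed

text \<open>The map is built from the direct sum, where adding up the component images is linear on
  the ambient space, and then reversed. Its injectivity is the directness in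
  \<open>multi_funs_sum_eq_0\<close>, its surjectivity is \<open>W_graded_eq\<close>.\<close>

lemma W_graded_iso_direct_sum:
  fixes S :: "(nat \<Rightarrow> nat) \<Rightarrow> ('a \<Rightarrow> complex) set"
  assumes S: "\<And>r. r \<in> compositions n k \<Longrightarrow> fun_space.subspace (S r)"
    and X: "\<And>r. r \<in> compositions n k \<Longrightarrow> Vector_Spaces.linear fscale fscale (X r)"
      "\<And>r. r \<in> compositions n k \<Longrightarrow> X r ` S r = inv_funs n r"
      "\<And>r x. r \<in> compositions n k \<Longrightarrow> x \<in> S r \<Longrightarrow> X r x = 0 \<Longrightarrow> x = 0"
  shows "W_graded n k \<cong>\<^sub>l direct_sum (compositions n k) S"
proof (rule lin_isomorphic_sym)
  let ?C = "compositions n k"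
  let ?D = "direct_sum ?C S"
  show sub: "fun_space.subspace ?D" by (rule direct_sum_subspace) (rule S)
  define P where "P x = (\<Sum>r\<in>?C. X r (\<lambda>a. x (r, a)))" for x
  have lin: "Vector_Spaces.linear fscale fscale P"
  proof (rule fscale_linearI)
    have "(\<lambda>a. (x + y) (r, a)) = (\<lambda>a. x (r, a)) + (\<lambda>a. y (r, a))" for x y :: "(nat \<Rightarrow> nat) \<times> 'a \<Rightarrow> complex" and r
      by (simp add: fun_eq_iff)
    then show "P (x + y) = P x + P y" for x y
      unfolding P_def by (simp only: sum.distrib[symmetric]) (intro sum.cong refl, simp only: fun_pair.linear_add[OF X(1)])
    have "(\<lambda>a. fscale c x (r, a)) = fscale c (\<lambda>a. x (r, a))" for c and x :: "(nat \<Rightarrow> nat) \<times> 'a \<Rightarrow> complex" and r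
      by (simp add: fun_eq_iff fscale_apply)
    then show "P (fscale c x) = fscale c (P x)" for c x
      unfolding P_def by (simp only: fun_space.scale_sum_right) (intro sum.cong refl, simp only: fun_pair.linear_scale[OF X(1)])
  qed
  have comp: "X r (\<lambda>a. x (r, a)) \<in> inv_funs n r" if "x \<in> ?D" "r \<in> ?C" for x r
    using that X(2)[OF that(2)] by (auto simp: direct_sum_def)
  have inj: "x = 0" if x: "x \<in> ?D" "P x = 0" for x
  proof
    fix ra :: "(nat \<Rightarrow> nat) \<times> 'a"
    obtain r a where ra: "ra = (r, a)" by (cases ra)
    show "x ra = 0 ra"
    proof (cases "r \<in> ?C")
      case True
      have "X r (\<lambda>a. x (r, a)) = 0"
        by (rule multi_funs_sum_eq_0[OF _ x(2)[unfolded P_def] True])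
           (use comp[OF x(1)] in \<open>simp add: inv_funs_def\<close>)
      then have "(\<lambda>a. x (r, a)) = 0" using X(3)[OF True] x(1) True by (simp add: direct_sum_def)
      then show ?thesis using fun_cong[of _ _ a] by (fastforce simp: ra)
    qed (use x(1) in \<open>simp add: direct_sum_def ra\<close>)
  qed
  have "inj_on P ?D"
    using inj by (simp add: fun_pair.linear_inj_on_iff_eq_0[OF lin sub])
  moreover have "P ` ?D = W_graded n k"
    unfolding W_graded_eq
  proof (intro subset_antisym subsetI)
    fix f assume "f \<in> P ` ?D"
    then obtain x where x: "x \<in> ?D" "f = P x" by blast
    then show "f \<in> {\<Sum>r\<in>?C. h r | h. \<forall>r\<in>?C. h r \<in> inv_funs n r}"
      using comp[OF x(1)] by (auto simp: P_def)
  next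
    fix f assume "f \<in> {\<Sum>r\<in>?C. h r | h. \<forall>r\<in>?C. h r \<in> inv_funs n r}"
    then obtain h where h: "f = (\<Sum>r\<in>?C. h r)" "\<forall>r\<in>?C. h r \<in> inv_funs n r" by blast
    have "\<forall>r\<in>?C. \<exists>y. y \<in> S r \<and> X r y = h r" using X(2) h(2) by (metis imageE)
    then obtain y where y: "\<forall>r\<in>?C. y r \<in> S r \<and> X r (y r) = h r" by metis
    define x where "x = (\<lambda>(r, a). if r \<in> ?C then y r a else 0)"
    have "x \<in> ?D" using y by (simp add: direct_sum_def x_def)
    moreover have "P x = f" unfolding P_def h(1) by (rule sum.cong) (use y in \<open>simp_all add: x_def\<close>)
    ultimately show "f \<in> P ` ?D" by blast
  qed
  ultimately show "?D \<cong>\<^sub>l W_graded n k" using lin by (auto simp: lin_isomorphic_def bij_betw_def)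
qed

lemma inv_funs_basis: obtains C where "is_basis C (\<lambda>b. b) (inv_funs n r)"
proof -
  let ?B = "prod_family n (\<lambda>i. std_fun (r i + 3) (r i)) ` (\<Pi>\<^sub>E i\<in>{..<n}. gt (2 * r i + 3) (r i) 0)"
  have "finite ?B" by (intro finite_imageI finite_PiE) auto
  moreover have "inv_funs n r \<subseteq> fun_space.span ?B" unfolding inv_funs_def multi_funs_def by simp
  ultimately show thesis using subspace_basis[OF inv_funs_subspace, of n r ?B] that by metis
qed

text \<open>Bases of the spaces of invariant functions are tagged by their composition and joined.
  The dimension count thus rests on \<open>inv_funs\<close> and involves no choice of
  irreducibles.\<close>

lemma W_graded_basis:
  assumes C: "\<And>r. is_basis (C r) (\<lambda>b. b) (inv_funs n r)"
  shows "is_basis (Sigma (compositions n k) C) snd (W_graded n k)"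
proof -
  let ?C = "compositions n k"
  have fin: "finite (C r)" for r using C by (simp add: is_basis_def)
  have "indep_fam (Sigma ?C C) snd"
    unfolding indep_fam_def
  proof (intro allI impI ballI)
    fix c rb assume 0: "\<forall>z. (\<Sum>j\<in>Sigma ?C C. c j * snd j z) = 0" and rb: "rb \<in> Sigma ?C C"
    obtain r b where rb': "rb = (r, b)" "r \<in> ?C" "b \<in> C r" using rb by auto
    let ?h = "\<lambda>r. \<Sum>b\<in>C r. fscale (c (r, b)) b"
    have "(\<Sum>r\<in>?C. ?h r) = 0"
    proof
      fix z
      show "(\<Sum>r\<in>?C. ?h r) z = 0 z"
        using 0 sum.Sigma[OF finite_compositions, of n k C "\<lambda>r b. c (r, b) * b z"] fin
        by (simp add: sum_fun_apply fscale_apply split_beta)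
    qed
    moreover have "?h r \<in> multi_funs n r" for r
    proof -
      have "?h r \<in> inv_funs n r" using C[of r] fam_in_span[of "\<lambda>b. c (r, b)" "\<lambda>b. b" "C r"] by (simp only: is_basis_def)
      then show ?thesis by (simp add: inv_funs_def)
    qed
    ultimately have "?h r = 0" using multi_funs_sum_eq_0[of n k ?h r] rb' by blast
    then show "c rb = 0" using indep_famD[of "C r" "\<lambda>b. b" "\<lambda>b. c (r, b)" b] C[of r] rb' by (simp add: is_basis_def)
  qed
  moreover have "W_graded n k = fun_space.span (snd ` Sigma ?C C)"
  proof (rule subset_antisym)
    have m: "inv_funs n r \<subseteq> fun_space.span (snd ` Sigma ?C C)" if "r \<in> ?C" for r
    proof -
      have "C r \<subseteq> snd ` Sigma ?C C" using that by force
      then show ?thesis using C[of r] fun_space.span_mono by (simp add: is_basis_def)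
    qed
    show "W_graded n k \<subseteq> fun_space.span (snd ` Sigma ?C C)"
      unfolding W_graded_eq by (auto intro!: fun_space.span_sum dest: m[THEN subsetD])
    have sub: "fun_space.subspace (W_graded n k)"
      unfolding fun_space.subspace_def
    proof (intro conjI ballI allI)
      show "0 \<in> W_graded n k" unfolding W_graded_eq
        using fun_space.subspace_0[OF inv_funs_subspace] by (intro CollectI exI[of _ "\<lambda>_. 0"]) simp
      show "f + g \<in> W_graded n k" if fg: "f \<in> W_graded n k" "g \<in> W_graded n k" for f g
      proof -
        obtain h h' where "f = (\<Sum>r\<in>?C. h r)" "\<forall>r\<in>?C. h r \<in> inv_funs n r"
          "g = (\<Sum>r\<in>?C. h' r)" "\<forall>r\<in>?C. h' r \<in> inv_funs n r" using fg unfolding W_graded_eq by blast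
        then show ?thesis unfolding W_graded_eq
          by (intro CollectI exI[of _ "\<lambda>r. h r + h' r"])
             (simp add: sum.distrib fun_space.subspace_add[OF inv_funs_subspace])
      qed
      show "fscale c f \<in> W_graded n k" if f: "f \<in> W_graded n k" for c f
      proof -
        obtain h where "f = (\<Sum>r\<in>?C. h r)" "\<forall>r\<in>?C. h r \<in> inv_funs n r" using f unfolding W_graded_eq by blast
        then show ?thesis unfolding W_graded_eq
          by (intro CollectI exI[of _ "\<lambda>r. fscale c (h r)"])
             (simp add: fun_space.scale_sum_right fun_space.subspace_scale[OF inv_funs_subspace])
      qed
    qed
    show "fun_space.span (snd ` Sigma ?C C) \<subseteq> W_graded n k"
    proof (rule fun_space.span_minimal[OF _ sub], clarsimp)
      fix r b assume r: "r \<in> ?C" and b: "b \<in> C r"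
      have "b \<in> inv_funs n r" using is_basis_mem[OF C b] .
      moreover have "(\<Sum>s\<in>?C. if s = r then b else 0) = b" using r finite_compositions by simp
      ultimately show "b \<in> W_graded n k" unfolding W_graded_eq
        using fun_space.subspace_0[OF inv_funs_subspace]
        by (intro CollectI exI[of _ "\<lambda>s. if s = r then b else 0"]) auto
    qed
  qed
  ultimately show ?thesis using fin finite_compositions by (auto simp: is_basis_def)
qed

lemma W_graded_dim:
  "finite_dimensional (W_graded n k)"
  "fun_space.dim (W_graded n k) = (\<Sum>r\<in>compositions n k. fun_space.dim (inv_funs n r))"
proof -
  have "\<forall>r. \<exists>C. is_basis C (\<lambda>b. b) (inv_funs n r)" using inv_funs_basis by metis
  then obtain C where C: "\<And>r. is_basis (C r) (\<lambda>b. b) (inv_funs n r)" by metis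
  note b = W_graded_basis[of C, OF C]
  show "finite_dimensional (W_graded n k)"
    using b[of k] unfolding finite_dimensional_def is_basis_def by blast
  have "finite (C r)" for r using C by (simp add: is_basis_def)
  then show "fun_space.dim (W_graded n k) = (\<Sum>r\<in>compositions n k. fun_space.dim (inv_funs n r))"
    using is_basis_dim[OF b] is_basis_dim[OF C] finite_compositions by (simp add: card_SigmaI)
qed

section \<open>Complete reducibility of unitarizable representations\<close>

lemma is_basis_direct:
  assumes b1: "is_basis J1 g1 S1" and b2: "is_basis J2 g2 S2"
    and disj: "\<And>x y. x \<in> S1 \<Longrightarrow> y \<in> S2 \<Longrightarrow> x + y = 0 \<Longrightarrow> x = 0"
    and S: "S = {x + y | x y. x \<in> S1 \<and> y \<in> S2}"
  shows "is_basis (J1 <+> J2) (case_sum g1 g2) S"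
proof -
  have fin: "finite J1" "finite J2" using b1 b2 by (auto simp: is_basis_def)
  have sum: "(\<Sum>j\<in>J1 <+> J2. fscale (c j) (case_sum g1 g2 j)) =
    (\<Sum>j\<in>J1. fscale (c (Inl j)) (g1 j)) + (\<Sum>j\<in>J2. fscale (c (Inr j)) (g2 j))" for c
    by (simp add: sum.Plus[OF fin])
  have mem: "(\<Sum>j\<in>J1. fscale (c j) (g1 j)) \<in> S1" "(\<Sum>j\<in>J2. fscale (d j) (g2 j)) \<in> S2" for c d
    using b1 b2 by (simp_all only: is_basis_def fam_in_span)
  have "indep_fam (J1 <+> J2) (case_sum g1 g2)"
    unfolding indep_fam_def
  proof (intro allI impI ballI)
    fix c j assume 0: "\<forall>x. (\<Sum>j\<in>J1 <+> J2. c j * case_sum g1 g2 j x) = 0" and j: "j \<in> J1 <+> J2"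
    have "(\<Sum>j\<in>J1 <+> J2. fscale (c j) (case_sum g1 g2 j)) = 0"
      using 0 by (simp add: fun_eq_iff sum_fun_apply fscale_apply)
    then have z: "(\<Sum>j\<in>J1. fscale (c (Inl j)) (g1 j)) + (\<Sum>j\<in>J2. fscale (c (Inr j)) (g2 j)) = 0"
      by (simp only: sum)
    have z1: "(\<Sum>j\<in>J1. fscale (c (Inl j)) (g1 j)) = 0" by (rule disj[OF mem z])
    then have z2: "(\<Sum>j\<in>J2. fscale (c (Inr j)) (g2 j)) = 0" using z by simp
    have "indep_fam J1 g1" "indep_fam J2 g2" using b1 b2 by (simp_all add: is_basis_def)
    then have "\<forall>i\<in>J1. c (Inl i) = 0" "\<forall>i\<in>J2. c (Inr i) = 0"
      using indep_famD[of J1 g1 "\<lambda>j. c (Inl j)", OF _ z1] indep_famD[of J2 g2 "\<lambda>j. c (Inr j)", OF _ z2]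
      by blast+
    then show "c j = 0" using j by (elim PlusE) simp_all
  qed
  moreover have "S = fun_space.span (case_sum g1 g2 ` (J1 <+> J2))"
  proof (intro subset_antisym subsetI)
    fix x assume "x \<in> S"
    then obtain y z where yz: "x = y + z" "y \<in> S1" "z \<in> S2" using S by blast
    obtain c where c: "y = (\<Sum>j\<in>J1. fscale (c j) (g1 j))"
      using span_fam[OF fin(1)] b1 yz(2) unfolding is_basis_def by metis
    obtain d where d: "z = (\<Sum>j\<in>J2. fscale (d j) (g2 j))"
      using span_fam[OF fin(2)] b2 yz(3) unfolding is_basis_def by metis
    have "x = (\<Sum>j\<in>J1 <+> J2. fscale (case_sum c d j) (case_sum g1 g2 j))"
      by (simp only: sum yz c d sum.case)
    then show "x \<in> fun_space.span (case_sum g1 g2 ` (J1 <+> J2))" by (simp only: fam_in_span)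
  next
    fix x assume "x \<in> fun_space.span (case_sum g1 g2 ` (J1 <+> J2))"
    then obtain c where "x = (\<Sum>j\<in>J1 <+> J2. fscale (c j) (case_sum g1 g2 j))"
      by (rule span_fam[OF finite_Plus[OF fin]])
    then show "x \<in> S" unfolding S sum using mem(1)[of "\<lambda>j. c (Inl j)"] mem(2)[of "\<lambda>j. c (Inr j)"] by blast
  qed
  ultimately show ?thesis using fin by (simp add: is_basis_def)
qed

lemma is_basis_reindex:
  assumes "is_basis J g S" "bij_betw f J' J" shows "is_basis J' (\<lambda>j. g (f j)) S"
proof -
  have inj: "inj_on f J'" and im: "f ` J' = J" using assms(2) by (auto simp: bij_betw_def)
  have fin: "finite J'" using assms bij_betw_finite by (auto simp: is_basis_def)
  have "indep_fam J' (\<lambda>j. g (f j))"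
    unfolding indep_fam_def
  proof (intro allI impI ballI)
    fix c j assume 0: "\<forall>x. (\<Sum>j\<in>J'. c j * g (f j) x) = 0" and j: "j \<in> J'"
    let ?c = "\<lambda>i. c (inv_into J' f i)"
    have "\<forall>x. (\<Sum>i\<in>J. ?c i * g i x) = 0"
      unfolding im[symmetric] sum.reindex[OF inj] using 0 inj by (simp add: inv_into_f_f cong: sum.cong)
    moreover have "indep_fam J g" using assms(1) by (simp add: is_basis_def)
    ultimately have "\<forall>i\<in>J. ?c i = 0" unfolding indep_fam_def by (elim allE[of _ ?c] impE)
    then have "?c (f j) = 0" using im j by blast
    then show "c j = 0" using inj j by (simp add: inv_into_f_f)
  qed
  moreover have "(\<lambda>j. g (f j)) ` J' = g ` J" using im by auto
  ultimately show ?thesis using assms(1) fin by (simp add: is_basis_def)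
qed

section \<open>Representations on which the conjugate transpose acts as the adjoint\<close>

definition hadj :: "complex^3^3 \<Rightarrow> complex^3^3"
  where "hadj G = (\<chi> i j. cnj (G $ j $ i))"

lemma hadj_nth [simp]: "hadj G $ i $ j = cnj (G $ j $ i)"
  by (simp add: hadj_def)

lemma hadj_SL3: assumes "G \<in> SL3" shows "hadj G \<in> SL3"
proof -
  have "det (hadj G) = cnj (det G)" by (simp add: det_3 mult_ac)
  then show ?thesis using assms by (simp add: SL3_def)
qed

lemma hadj_hadj [simp]: "hadj (hadj G) = G"
  by (simp add: vec_eq_iff)

lemma adj3_hadj: "adj3 (hadj G) = hadj (adj3 G)"
  by (simp add: mat3_eq_iff adj3_def mult_ac)

text \<open>The total degree picks one representative among the triples that differ by a multiple of
  (1, 1, 1) and hence agree on the torus of \<open>SL3\<close>.\<close>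

definition wt_deg :: "nat \<times> nat \<times> nat \<Rightarrow> nat"
  where "wt_deg = (\<lambda>(a, b, c). a + b + c)"

text \<open>Besides the adjoint condition, the coordinate basis consists of weight vectors, with
  weights lifted to triples of common degree \<open>D\<close>. Both conditions pass to tensor
  products.\<close>

definition star_rep :: "'i sl3_rep \<Rightarrow> nat \<Rightarrow> ('i \<Rightarrow> nat \<times> nat \<times> nat) \<Rightarrow> bool"
  where "star_rep R D wt \<longleftrightarrow>
    finite (idx R) \<and>
    (\<forall>G\<in>SL3. \<forall>H\<in>SL3. \<forall>i\<in>idx R. \<forall>j\<in>idx R.
      entry R (G ** H) i j = (\<Sum>k\<in>idx R. entry R G i k * entry R H k j)) \<and>
    (\<forall>i\<in>idx R. \<forall>j\<in>idx R. continuous_on SL3 (\<lambda>G. entry R G i j)) \<and>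
    (\<forall>G\<in>SL3. \<forall>i\<in>idx R. \<forall>j\<in>idx R. entry R (hadj G) i j = cnj (entry R G j i)) \<and>
    (\<forall>x y z. x * y * z = 1 \<longrightarrow> (\<forall>i\<in>idx R. \<forall>j\<in>idx R.
      entry R (diagm x y z) i j = (if i = j then wt_char (wt i) (x, y, z) else 0))) \<and>
    (\<forall>i\<in>idx R. wt_deg (wt i) = D)"

lemma diagm_one: "diagm 1 1 1 = mat 1"
  by (simp add: diagm_def mat3_eq_iff mat_1_nth)

lemma star_rep_diag:
  assumes R: "star_rep R D wt" and t: "x * y * z = 1" and i: "i \<in> idx R"
  shows "rep_act R (diagm x y z) v i = wt_char (wt i) (x, y, z) * v i"
proof -
  have "(\<Sum>j\<in>idx R. entry R (diagm x y z) i j * v j) = (\<Sum>j\<in>idx R. if j = i then wt_char (wt i) (x, y, z) * v i else 0)"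
    using R t i by (intro sum.cong refl) (auto simp: star_rep_def)
  then show ?thesis using R i by (simp add: rep_act_def star_rep_def)
qed

lemma star_rep_cont_rep:
  assumes R: "star_rep R D wt" shows "cont_rep R"
  unfolding cont_rep_def
proof (intro conjI ballI)
  show "finite (idx R)" using R by (simp add: star_rep_def)
next
  fix v assume v: "v \<in> rep_space R"
  show "rep_act R (mat 1) v = v"
  proof
    fix i
    show "rep_act R (mat 1) v i = v i"
    proof (cases "i \<in> idx R")
      case True
      then show ?thesis using star_rep_diag[OF R, of 1 1 1 i v]
        by (simp add: diagm_one wt_char_def split_beta)
    next
      case False
      then show ?thesis using v by (simp add: rep_act_def rep_space_def)
    qed
  qed
next
  fix G H v assume GH: "G \<in> SL3" "H \<in> SL3" "v \<in> rep_space R"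
  show "rep_act R (G ** H) v = rep_act R G (rep_act R H v)"
  proof
    fix i
    show "rep_act R (G ** H) v i = rep_act R G (rep_act R H v) i"
    proof (cases "i \<in> idx R")
      case True
      have "rep_act R (G ** H) v i = (\<Sum>j\<in>idx R. (\<Sum>k\<in>idx R. entry R G i k * entry R H k j) * v j)"
        using R GH True by (simp add: rep_act_def star_rep_def)
      also have "\<dots> = (\<Sum>k\<in>idx R. entry R G i k * (\<Sum>j\<in>idx R. entry R H k j * v j))"
        unfolding sum_distrib_left sum_distrib_right by (subst sum.swap) (simp add: mult_ac)
      finally show ?thesis using True by (simp add: rep_act_def)
    qed (simp add: rep_act_def)
  qed
qed (use R in \<open>auto simp: star_rep_def\<close>)

lemma star_rep_adjoint:
  assumes R: "star_rep R D wt" and G: "G \<in> SL3"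
  shows "cinner (idx R) (rep_act R (hadj G) x) y = cinner (idx R) x (rep_act R G y)"
proof -
  have "cinner (idx R) (rep_act R (hadj G) x) y = (\<Sum>i\<in>idx R. (\<Sum>j\<in>idx R. entry R G j i * cnj (x j)) * y i)"
    using R G by (simp add: cinner_def rep_act_def star_rep_def)
  also have "\<dots> = (\<Sum>j\<in>idx R. cnj (x j) * (\<Sum>i\<in>idx R. entry R G j i * y i))"
    unfolding sum_distrib_left sum_distrib_right by (subst sum.swap) (simp add: mult_ac)
  finally show ?thesis by (simp add: cinner_def rep_act_def)
qed

text \<open>The points (2, 1, 1/2) and (1, 2, 1/2) recover the differences \<open>a - c\<close> and
  \<open>b - c\<close> of the exponents; the common degree then determines the triple.\<close>

lemma wt_char_separates:
  assumes "wt_deg \<mu> = wt_deg \<nu>" "\<And>x y z. x * y * z = 1 \<Longrightarrow> wt_char \<mu> (x, y, z) = wt_char \<nu> (x, y, z)"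
  shows "\<mu> = \<nu>"
proof -
  obtain a b c a' b' c' where e: "\<mu> = (a, b, c)" "\<nu> = (a', b', c')" by (cases \<mu>; cases \<nu>) auto
  have "(2::complex) ^ a * (1 / 2) ^ c = 2 ^ a' * (1 / 2) ^ c'" "(2::complex) ^ b * (1 / 2) ^ c = 2 ^ b' * (1 / 2) ^ c'"
    using assms(2)[of 2 1 "1/2"] assms(2)[of 1 2 "1/2"] by (simp_all add: e wt_char_def)
  then have "(2::complex) ^ (a + c') = 2 ^ (a' + c)" "(2::complex) ^ (b + c') = 2 ^ (b' + c)"
    by (simp_all add: power_add power_divide field_simps)
  then have "a + c' = a' + c" "b + c' = b' + c" by (simp_all only: two_power_eq_iff)
  then show ?thesis using assms(1) by (simp add: e wt_deg_def)
qed

definition invariant_subspace :: "'i sl3_rep \<Rightarrow> ('i \<Rightarrow> complex) set \<Rightarrow> bool"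
  where "invariant_subspace R S \<longleftrightarrow> S \<subseteq> rep_space R \<and> fun_space.subspace S \<and>
    (\<forall>G\<in>SL3. \<forall>x\<in>S. rep_act R G x \<in> S)"

text \<open>Induction on the number of weights occurring in \<open>x\<close>: an unwanted weight is
  killed by a torus element minus its eigenvalue, divided by the factor by which this scales the
  component of weight \<open>\<mu>\<close>.\<close>

lemma weight_component:
  assumes R: "star_rep R D wt" and S: "invariant_subspace R S" and x: "x \<in> S"
  shows "(\<lambda>i. if wt i = \<mu> then x i else 0) \<in> S"
proof -
  define A where "A x = {wt i | i. i \<in> idx R \<and> x i \<noteq> 0}" for x :: "'a \<Rightarrow> complex"
  have fin: "finite (A x)" for x
    by (rule finite_subset[of _ "wt ` idx R"]) (use R in \<open>auto simp: A_def star_rep_def\<close>)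
  have sub: "fun_space.subspace S" and supp: "x \<in> S \<Longrightarrow> i \<notin> idx R \<Longrightarrow> x i = 0" for x i
    using S by (auto simp: invariant_subspace_def rep_space_def)
  from x show ?thesis
  proof (induction "card (A x)" arbitrary: x rule: less_induct)
    case less
    show ?case
    proof (cases "A x \<subseteq> {\<mu>}")
      case True
      have "(\<lambda>i. if wt i = \<mu> then x i else 0) = x"
        using True supp[OF less.prems] by (fastforce simp: A_def)
      then show ?thesis using less.prems by simp
    next
      case False
      then obtain k where k: "k \<in> idx R" "x k \<noteq> 0" "wt k \<noteq> \<mu>" by (auto simp: A_def)
      show ?thesis
      proof (cases "\<mu> \<in> A x")
        case False
        then have "(\<lambda>i. if wt i = \<mu> then x i else 0) = 0"
          using supp[OF less.prems] by (fastforce simp: A_def)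
        then show ?thesis using fun_space.subspace_0[OF sub] by (simp only:)
      next
        case True
        have "wt_deg \<mu> = wt_deg (wt k)" using True k R by (auto simp: A_def star_rep_def)
        then obtain p q r where t: "p * q * r = 1" "wt_char \<mu> (p, q, r) \<noteq> wt_char (wt k) (p, q, r)"
          using wt_char_separates k(3) by metis
        let ?d = "wt_char \<mu> (p, q, r) - wt_char (wt k) (p, q, r)"
        define y where "y = fscale (1 / ?d) (rep_act R (diagm p q r) x - fscale (wt_char (wt k) (p, q, r)) x)"
        have y: "y \<in> S" unfolding y_def
          using S t(1) less.prems
          by (intro fun_space.subspace_scale[OF sub] fun_space.subspace_diff[OF sub])
             (auto simp: invariant_subspace_def)
        have yi: "y i = (wt_char (wt i) (p, q, r) - wt_char (wt k) (p, q, r)) / ?d * x i" if "i \<in> idx R" for i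
          using star_rep_diag[OF R t(1) that, of x]
          by (simp add: y_def fscale_apply left_diff_distrib diff_divide_distrib)
        have "A y \<subseteq> A x - {wt k}" using yi by (auto simp: A_def)
        moreover have "wt k \<in> A x" using k by (auto simp: A_def)
        ultimately have "card (A y) < card (A x)" using fin by (metis card_Diff1_less card_mono finite_Diff le_less_trans)
        from less.hyps[OF this y] have "(\<lambda>i. if wt i = \<mu> then y i else 0) \<in> S" .
        moreover have "(\<lambda>i. if wt i = \<mu> then y i else 0) = (\<lambda>i. if wt i = \<mu> then x i else 0)"
        proof
          fix i
          show "(if wt i = \<mu> then y i else 0) = (if wt i = \<mu> then x i else 0)"
            using yi[of i] t(2) supp[OF y, of i] supp[OF less.prems, of i] by (cases "i \<in> idx R") auto
        qed
        ultimately show ?thesis by simp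
      qed
    qed
  qed
qed

text \<open>A weight vector whose weight is maximal for the cocharacter \<open>s \<mapsto> diag(s, 1, 1/s)\<close> is a highest
  weight vector, since this cocharacter contracts the upper unipotent group as \<open>s \<rightarrow> 0\<close>; dominance
  comes from applying the two simple reflections.\<close>

lemma hw_exists:
  assumes R: "star_rep R D wt" and S: "invariant_subspace R S" and nz: "S \<noteq> {0}"
  obtains v l1 l2 l3 where "v \<in> S" "l3 \<le> l2" "l2 \<le> l1" "l1 + l2 + l3 = D"
    "highest_weight_vector R (l1 - l2) (l2 - l3) v"
proof -
  have sub: "fun_space.subspace S" and SR: "S \<subseteq> rep_space R"
    and inv: "\<And>G x. G \<in> SL3 \<Longrightarrow> x \<in> S \<Longrightarrow> rep_act R G x \<in> S"
    using S by (auto simp: invariant_subspace_def)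
  have C: "cont_rep R" by (rule star_rep_cont_rep[OF R])
  \<comment> \<open>The pairing of the weight with the cocharacter s to diag(s, 1, 1/s).\<close>
  define deg where "deg i = (case wt i of (a, b, c) \<Rightarrow> int a - int c)" for i
  define I0 where "I0 = {i \<in> idx R. \<exists>x\<in>S. x i \<noteq> 0}"
  have "finite I0" using R by (simp add: I0_def star_rep_def)
  moreover have "I0 \<noteq> {}"
  proof -
    obtain x where x: "x \<in> S" "x \<noteq> 0" using nz fun_space.subspace_0[OF sub] by blast
    then obtain i where "x i \<noteq> 0" by (auto simp: fun_eq_iff)
    then have "i \<in> I0" using x SR by (auto simp: I0_def rep_space_def)
    then show ?thesis by blast
  qed
  ultimately have "Max (deg ` I0) \<in> deg ` I0" by (intro Max_in) auto
  then obtain i0 where i0': "i0 \<in> I0" "deg i0 = Max (deg ` I0)" by auto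
  then have i0: "i0 \<in> I0" "\<And>i. i \<in> I0 \<Longrightarrow> deg i \<le> deg i0" using \<open>finite I0\<close> by auto
  then obtain x where x: "x \<in> S" "x i0 \<noteq> 0" "i0 \<in> idx R" by (auto simp: I0_def)
  obtain l1 l2 l3 where l: "wt i0 = (l1, l2, l3)" by (cases "wt i0") auto
  have D: "l1 + l2 + l3 = D" using R x(3) l by (auto simp: star_rep_def wt_deg_def)
  define v where "v = (\<lambda>i. if wt i = wt i0 then x i else 0)"
  have vS: "v \<in> S" unfolding v_def by (rule weight_component[OF R S x(1)])
  have vR: "v \<in> rep_space R" using vS SR by blast
  have v0: "v \<noteq> 0" using x(2) by (auto simp: v_def fun_eq_iff)
  have vt: "rep_act R (diagm p q r) v = fscale (wt_char (wt i0) (p, q, r)) v" if "p * q * r = 1" for p q r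
  proof
    fix i
    show "rep_act R (diagm p q r) v i = fscale (wt_char (wt i0) (p, q, r)) v i"
      using star_rep_diag[OF R that, of i v] vR
      by (cases "i \<in> idx R") (auto simp: fscale_apply v_def rep_act_def rep_space_def)
  qed
  \<comment> \<open>A matrix \<open>P\<close> permuting the coordinate axes turns \<open>v\<close>
    into a nonzero weight vector of \<open>S\<close> with permuted weight, whose degree cannot
    exceed the maximum. The outer entries are integers to keep their difference from being
    truncated.\<close>
  have refl: "e1 - e3 \<le> deg i0"
    if P: "P \<in> SL3" and wP: "\<And>p q r. p * q * r = 1 \<Longrightarrow> \<exists>p' q' r'. p' * q' * r' = 1 \<and>
      diagm p q r ** P = P ** diagm p' q' r' \<and> wt_char (wt i0) (p', q', r') = wt_char (nat e1, e2, nat e3) (p, q, r)"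
      and e: "nat e1 + e2 + nat e3 = D" "e1 \<ge> 0" "e3 \<ge> 0"
    for P e1 e2 e3
  proof -
    let ?w = "rep_act R P v"
    have wS: "?w \<in> S" by (rule inv[OF P vS])
    have "?w \<noteq> 0"
    proof
      assume "?w = 0"
      then have "rep_act R (adj3 P) ?w = 0" using fun_pair.linear_0[OF linear_rep_act] by simp
      moreover have "rep_act R (adj3 P) ?w = v"
        using cont_repD(3)[OF C SL3_adj3[OF P] P vR] adj3_mult(2)[OF P] cont_repD(2)[OF C vR] by simp
      ultimately show False using v0 by simp
    qed
    then obtain i where i: "?w i \<noteq> 0" by (auto simp: fun_eq_iff)
    then have iR: "i \<in> idx R" using rep_act_closed[of R P v] by (auto simp: rep_space_def)
    have "wt i = (nat e1, e2, nat e3)"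
    proof (rule wt_char_separates)
      show "wt_deg (wt i) = wt_deg (nat e1, e2, nat e3)" using R iR e by (auto simp: star_rep_def wt_deg_def)
      fix p q r :: complex assume t: "p * q * r = 1"
      obtain p' q' r' where t': "p' * q' * r' = 1" "diagm p q r ** P = P ** diagm p' q' r'"
        "wt_char (wt i0) (p', q', r') = wt_char (nat e1, e2, nat e3) (p, q, r)" using wP[OF t] by blast
      have "rep_act R (diagm p q r) ?w = rep_act R (diagm p q r ** P) v"
        using cont_repD(3)[OF C _ P vR, of "diagm p q r"] t by simp
      also have "\<dots> = rep_act R P (rep_act R (diagm p' q' r') v)"
        unfolding t'(2) using cont_repD(3)[OF C P _ vR, of "diagm p' q' r'"] t'(1) by simp
      also have "\<dots> = fscale (wt_char (nat e1, e2, nat e3) (p, q, r)) ?w"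
        unfolding vt[OF t'(1)] t'(3) by (rule fun_pair.linear_scale[OF linear_rep_act])
      finally show "wt_char (wt i) (p, q, r) = wt_char (nat e1, e2, nat e3) (p, q, r)"
        using star_rep_diag[OF R t iR, of ?w] i by (simp add: fscale_apply)
    qed
    moreover have "i \<in> I0" using i wS iR by (auto simp: I0_def)
    ultimately show ?thesis using i0(2)[of i] e by (simp add: deg_def)
  qed
  \<comment> \<open>The reflection in the first two coordinates, with a sign to make the determinant
    1; l2 - l3 cannot exceed l1 - l3.\<close>
  have "int l2 - int l3 \<le> deg i0"
  proof (rule refl[of "mat3 0 1 0 1 0 0 0 0 (-1)" "int l2" l1 "int l3"])
    show "mat3 0 1 0 1 0 0 0 0 (-1) \<in> SL3" by (simp add: SL3_def det_3)
    fix p q r :: complex assume "p * q * r = 1"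
    then show "\<exists>p' q' r'. p' * q' * r' = 1 \<and>
      diagm p q r ** mat3 0 1 0 1 0 0 0 0 (-1) = mat3 0 1 0 1 0 0 0 0 (-1) ** diagm p' q' r' \<and>
      wt_char (wt i0) (p', q', r') = wt_char (nat (int l2), l1, nat (int l3)) (p, q, r)"
      by (intro exI[of _ q] exI[of _ p] exI[of _ r])
         (simp add: mat3_eq_iff matrix_mult_3 diagm_def l wt_char_def mult_ac)
  qed (use D in auto)
  then have l21: "l2 \<le> l1" by (simp add: deg_def l)
  \<comment> \<open>The reflection in the last two coordinates; l1 - l2 cannot exceed l1 -
    l3.\<close>
  have "int l1 - int l2 \<le> deg i0"
  proof (rule refl[of "mat3 (-1) 0 0 0 0 1 0 1 0" "int l1" l3 "int l2"])
    show "mat3 (-1) 0 0 0 0 1 0 1 0 \<in> SL3" by (simp add: SL3_def det_3)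
    fix p q r :: complex assume "p * q * r = 1"
    then show "\<exists>p' q' r'. p' * q' * r' = 1 \<and>
      diagm p q r ** mat3 (-1) 0 0 0 0 1 0 1 0 = mat3 (-1) 0 0 0 0 1 0 1 0 ** diagm p' q' r' \<and>
      wt_char (wt i0) (p', q', r') = wt_char (nat (int l1), l3, nat (int l2)) (p, q, r)"
      by (intro exI[of _ p] exI[of _ r] exI[of _ q])
         (simp add: mat3_eq_iff matrix_mult_3 diagm_def l wt_char_def mult_ac)
  qed (use D in auto)
  then have l32: "l3 \<le> l2" by (simp add: deg_def l)
  have wt_s: "wt_char (wt i) (of_real s, 1, inverse (of_real s)) = of_real s powi deg i" if "s > 0" for s :: real and i
    using that by (cases "wt i") (simp add: wt_char_def deg_def power_int_diff divide_inverse power_inverse)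
  have U: "rep_act R (upper p q r) v = v" for p q r
  proof
    fix i
    let ?w = "rep_act R (upper p q r) v"
    let ?u = "\<lambda>s::real. upper (p * of_real s) (q * (of_real s)\<^sup>2) (r * of_real s)"
    have wS: "?w \<in> S" by (rule inv[OF upper_SL3 vS])
    \<comment> \<open>Coordinate \<open>i\<close> of diag(s, 1, 1/s) applied to the translate of
      \<open>v\<close>, computed directly and by moving the torus element past the unipotent
      one.\<close>
    have eq: "of_real s powi deg i * ?w i = of_real s powi deg i0 * rep_act R (?u s) v i"
      if s: "s > 0" and i: "i \<in> idx R" for s :: real
    proof -
      let ?d = "diagm (of_real s) 1 (inverse (of_real s))"
      have d: "?d \<in> SL3" using s by simp
      have c: "?d ** upper p q r = ?u s ** ?d"
        using s by (simp add: mat3_eq_iff matrix_mult_3 upper_def diagm_def field_simps power2_eq_square)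
      have "rep_act R ?d ?w = rep_act R (?d ** upper p q r) v"
        using cont_repD(3)[OF C d upper_SL3 vR] by simp
      also have "\<dots> = rep_act R (?u s) (rep_act R ?d v)"
        unfolding c by (rule cont_repD(3)[OF C upper_SL3 d vR])
      also have "rep_act R ?d v = fscale (of_real s powi deg i0) v"
        using vt[of "of_real s" 1 "inverse (of_real s)"] wt_s[OF s, of i0] s by simp
      also have "rep_act R (?u s) (fscale (of_real s powi deg i0) v) = fscale (of_real s powi deg i0) (rep_act R (?u s) v)"
        by (rule fun_pair.linear_scale[OF linear_rep_act])
      finally show ?thesis
        using star_rep_diag[OF R _ i, of "of_real s" 1 "inverse (of_real s)" ?w] wt_s[OF s, of i] s
        by (simp add: fscale_apply)
    qed
    have s0: "((\<lambda>s::real. complex_of_real s) \<longlongrightarrow> 0) (at_right 0)"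
      using tendsto_of_real[OF tendsto_ident_at[of "0::real" "{0<..}"], where 'a = complex] by simp
    have lim: "((\<lambda>s. rep_act R (?u s) v i) \<longlongrightarrow> v i) (at_right 0)"
    proof -
      have "((\<lambda>s. ?u s) \<longlongrightarrow> mat 1) (at_right 0)"
      proof (rule mat3_tendsto)
        have "((\<lambda>s::real. c * of_real s) \<longlongrightarrow> c * 0) (at_right 0)" "((\<lambda>s::real. c * (of_real s)\<^sup>2) \<longlongrightarrow> c * 0\<^sup>2) (at_right 0)"
          for c :: complex by (intro tendsto_intros s0)+
        then show "((\<lambda>s. ?u s $ 1 $ 2) \<longlongrightarrow> (mat 1 :: complex^3^3) $ 1 $ 2) (at_right 0)"
          "((\<lambda>s. ?u s $ 1 $ 3) \<longlongrightarrow> (mat 1 :: complex^3^3) $ 1 $ 3) (at_right 0)"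
          "((\<lambda>s. ?u s $ 2 $ 3) \<longlongrightarrow> (mat 1 :: complex^3^3) $ 2 $ 3) (at_right 0)"
          by (simp_all add: upper_def mat_1_nth)
      qed (simp_all add: upper_def mat_1_nth)
      then have "((\<lambda>s. rep_act R (?u s) v i) \<longlongrightarrow> rep_act R (mat 1) v i) (at_right 0)"
        by (rule rep_act_tendsto[OF C]) auto
      then show ?thesis by (simp only: cont_repD(2)[OF C vR])
    qed
    have pos: "eventually (\<lambda>s::real. s > 0) (at_right 0)" by (rule eventually_at_right_less)
    \<comment> \<open>Above the maximal degree no vector of \<open>S\<close> has a coordinate. At
      the maximum the limit gives the coordinate of \<open>v\<close>. Below it a positive power of
      \<open>s\<close> remains and tends to 0, and \<open>v\<close> has no coordinate there.\<close>
    consider "i \<notin> idx R" | "i \<in> idx R" "deg i > deg i0" | "i \<in> idx R" "deg i = deg i0" | "i \<in> idx R" "deg i < deg i0"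
      by linarith
    then show "?w i = v i"
    proof cases
      case 1
      then show ?thesis using vR by (simp add: rep_act_def rep_space_def)
    next
      case 2
      then have "i \<notin> I0" using i0(2) by fastforce
      then have "\<forall>x\<in>S. x i = 0" using 2 by (auto simp: I0_def)
      from bspec[OF this wS] bspec[OF this vS] show ?thesis by simp
    next
      case 3
      have "eventually (\<lambda>s. rep_act R (?u s) v i = ?w i) (at_right 0)"
        using pos by eventually_elim (use eq 3 in auto)
      then have "((\<lambda>s. rep_act R (?u s) v i) \<longlongrightarrow> ?w i) (at_right 0)" by (rule tendsto_eventually)
      then show ?thesis using lim by (rule tendsto_unique[OF trivial_limit_at_right_real])
    next
      case 4
      define m where "m = nat (deg i0 - deg i)"
      have m: "deg i0 = deg i + int m" "m > 0" using 4 by (simp_all add: m_def)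
      have "eventually (\<lambda>s. of_real s ^ m * rep_act R (?u s) v i = ?w i) (at_right 0)"
        using pos
      proof eventually_elim
        case (elim s)
        have "of_real s powi deg i * ?w i = of_real s powi deg i * (of_real s ^ m * rep_act R (?u s) v i)"
          using eq[OF elim 4(1)] elim by (simp add: m(1) power_int_add)
        then show ?case using elim by simp
      qed
      then have "((\<lambda>s. of_real s ^ m * rep_act R (?u s) v i) \<longlongrightarrow> ?w i) (at_right 0)" by (rule tendsto_eventually)
      moreover have "((\<lambda>s. of_real s ^ m * rep_act R (?u s) v i) \<longlongrightarrow> 0 ^ m * v i) (at_right 0)"
        by (intro tendsto_intros s0 lim)
      ultimately have "?w i = 0 ^ m * v i" by (rule tendsto_unique[OF trivial_limit_at_right_real])
      moreover have "v i = 0" using 4 by (auto simp: v_def deg_def)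
      ultimately show ?thesis by simp
    qed
  qed
  have "highest_weight_vector R (l1 - l2) (l2 - l3) v"
    unfolding highest_weight_vector_def
  proof (intro conjI vR v0 ballI allI impI)
    fix G assume G: "G \<in> upper_unipotent"
    then have "G = upper (G$1$2) (G$1$3) (G$2$3)"
      by (simp add: upper_unipotent_def upper_def mat3_eq_iff)
    then show "rep_act R G v = v" using U by metis
  next
    fix t :: "complex^3" assume t: "t $ 1 * t $ 2 * t $ 3 = 1"
    have "diag3 t = diagm (t$1) (t$2) (t$3)" by (simp add: diag3_def diagm_def mat3_eq_iff)
    moreover have "wt_char (wt i0) (t$1, t$2, t$3) = t$1 ^ (l1 - l2) * (t$1 * t$2) ^ (l2 - l3)"
    proof -
      \<comment> \<open>Dominance makes the subtractions exact; the power \<open>l3\<close> of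
        \<open>t $ 1 * t $ 2 * t $ 3\<close> that is left over equals 1.\<close>
      have "l1 = (l1 - l2) + (l2 - l3) + l3" "l2 = (l2 - l3) + l3" using l21 l32 by auto
      then have "wt_char (wt i0) (t$1, t$2, t$3) = t$1 ^ ((l1 - l2) + (l2 - l3) + l3) * t$2 ^ ((l2 - l3) + l3) * t$3 ^ l3"
        by (simp add: l wt_char_def)
      also have "\<dots> = t$1 ^ (l1 - l2) * (t$1 * t$2) ^ (l2 - l3) * (t$1 * t$2 * t$3) ^ l3"
        by (simp add: power_add power_mult_distrib mult_ac)
      finally show ?thesis by (simp add: t)
    qed
    ultimately show "rep_act R (diag3 t) v = fscale (t$1 ^ (l1 - l2) * (t$1 * t$2) ^ (l2 - l3)) v"
      using vt[OF t] by simp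
  qed
  then show thesis using that vS l21 l32 D by blast
qed

text \<open>On the big cell the lower unipotent factor moves to the other side of the inner product,
  where its conjugate transpose is upper unipotent and fixes \<open>v\<close>. The remaining
  \<open>g\<close> are limits along \<open>unip_curve e ** g\<close>.\<close>

lemma star_matrix_coeff:
  assumes R: "star_rep R D wt" and v: "highest_weight_vector R a b v" and g: "g \<in> SL3"
  shows "cinner (idx R) v (rep_act R g v) = hw_coeff a b g * cinner (idx R) v v"
proof -
  note C = star_rep_cont_rep[OF R]
  note vR = highest_weight_vectorD(1)[OF v]
  let ?I = "idx R"
  have big: "cinner ?I v (rep_act R g v) = hw_coeff a b g * cinner ?I v v"
    if g: "g \<in> SL3" "g$1$1 \<noteq> 0" "adj3 g $3$3 \<noteq> 0" for g
  proof -
    obtain x y z where e: "rep_act R g v = fscale (hw_coeff a b g) (rep_act R (lower x y z) v)"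
      using hw_big_cell[OF C v g] by blast
    have "cinner ?I v (rep_act R (lower x y z) v) = cinner ?I (rep_act R (hadj (lower x y z)) v) v"
      by (rule star_rep_adjoint[OF R lower_SL3, symmetric])
    also have "hadj (lower x y z) = upper (cnj x) (cnj y) (cnj z)"
      by (simp add: mat3_eq_iff lower_def upper_def)
    finally show ?thesis by (simp only: e cinner_simps highest_weight_vectorD(3)[OF v])
  qed
  have lim: "((\<lambda>e. cinner ?I v (rep_act R (unip_curve e ** g) v)) \<longlongrightarrow> cinner ?I v (rep_act R g v)) (at 0)"
  proof -
    have "(unip_curve \<longlongrightarrow> mat 1) (at 0)"
    proof (rule mat3_tendsto)
      have "isCont (\<lambda>e::complex. e) 0" "isCont (\<lambda>e::complex. e\<^sup>2 / 2) 0" by (intro continuous_intros; simp)+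
      then show "((\<lambda>e. unip_curve e $ 1 $ 2) \<longlongrightarrow> (mat 1 :: complex^3^3) $ 1 $ 2) (at 0)"
        "((\<lambda>e. unip_curve e $ 1 $ 3) \<longlongrightarrow> (mat 1 :: complex^3^3) $ 1 $ 3) (at 0)"
        "((\<lambda>e. unip_curve e $ 2 $ 3) \<longlongrightarrow> (mat 1 :: complex^3^3) $ 2 $ 3) (at 0)"
        by (simp_all add: unip_curve_def upper_def mat_1_nth isCont_def)
    qed (simp_all add: unip_curve_def upper_def mat_1_nth)
    then have "((\<lambda>e. rep_act R (unip_curve e) (rep_act R g v) i) \<longlongrightarrow> rep_act R (mat 1) (rep_act R g v) i) (at 0)" for i
      by (rule rep_act_tendsto[OF C]) (auto simp: unip_curve_simps(1))
    then show ?thesis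
      unfolding cinner_def cont_repD(3)[OF C unip_curve_simps(1) g vR] cont_repD(2)[OF C rep_act_closed]
      by (intro tendsto_intros)
  qed
  have "((\<lambda>e. hw_coeff a b (unip_curve e ** g) * cinner ?I v v) \<longlongrightarrow> hw_coeff a b g * cinner ?I v v) (at 0)"
    by (intro tendsto_intros hw_coeff_curve g)
  moreover have "eventually (\<lambda>e. hw_coeff a b (unip_curve e ** g) * cinner ?I v v =
      cinner ?I v (rep_act R (unip_curve e ** g) v)) (at 0)"
    using unip_curve_generic[OF g]
    by eventually_elim (rule big[symmetric], use g unip_curve_simps(1) in auto)
  ultimately have "((\<lambda>e. cinner ?I v (rep_act R (unip_curve e ** g) v)) \<longlongrightarrow> hw_coeff a b g * cinner ?I v v) (at 0)"
    by (rule Lim_transform_eventually)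
  then show ?thesis by (rule tendsto_unique[OF at_neq_bot lim])
qed

text \<open>Up to the factor \<open>cinner (idx R) v v\<close>, the values of \<open>L x\<close> at
  orbit points are the inner products of \<open>v\<close> with the translates of \<open>x\<close>.
  If \<open>L x\<close> vanishes, taking adjoints shows that \<open>x\<close> is orthogonal to all
  translates of \<open>v\<close>, hence to \<open>S\<close> and to itself.\<close>

lemma star_hw_iso:
  assumes R: "star_rep R D wt" and v: "highest_weight_vector R a b v"
    and S: "S = fun_space.span ((\<lambda>g. rep_act R g v) ` SL3)"
  obtains L where "Vector_Spaces.linear fscale fscale L" "L ` S = cone_funs a b"
    "\<And>g x. g \<in> SL3 \<Longrightarrow> x \<in> S \<Longrightarrow> L (rep_act R g x) = pull g (L x)"
    "\<And>g. g \<in> SL3 \<Longrightarrow> L (rep_act R g v) = orbit_fun a b g"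
    "\<And>x. x \<in> S \<Longrightarrow> (\<And>h. h \<in> SL3 \<Longrightarrow> cinner (idx R) v (rep_act R h x) = 0) \<Longrightarrow> x = 0"
    "\<And>x. x \<in> S \<Longrightarrow> L x = 0 \<Longrightarrow> x = 0"
proof -
  note C = star_rep_cont_rep[OF R]
  note vR = highest_weight_vectorD(1)[OF v]
  let ?I = "idx R"
  obtain L where L: "Vector_Spaces.linear fscale fscale L" "L ` S = cone_funs a b"
    "\<And>g x. g \<in> SL3 \<Longrightarrow> x \<in> S \<Longrightarrow> L (rep_act R g x) = pull g (L x)"
    "\<And>g. g \<in> SL3 \<Longrightarrow> L (rep_act R g v) = orbit_fun a b g"
    using hw_iso[OF C v S] by blast
  have perp: "x = 0" if x: "x \<in> S" and 0: "\<And>h. h \<in> SL3 \<Longrightarrow> cinner ?I v (rep_act R h x) = 0" for x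
  proof -
    have "cinner ?I z x = 0" if "z \<in> S" for z
      using that unfolding S
    proof (induction rule: fun_space.span_induct_alt)
      case base
      then show ?case by (simp only: cinner_simps)
    next
      case (step c y z)
      then obtain g where g: "g \<in> SL3" "y = rep_act R g v" by blast
      have "cinner ?I y x = 0"
        using star_rep_adjoint[OF R hadj_SL3[OF g(1)], of v x] 0[OF hadj_SL3[OF g(1)]] by (simp add: g(2))
      then show ?case using step by (simp only: cinner_simps) simp
    qed
    from this[OF x] have "x i = 0" if "i \<in> ?I" for i
      using cinner_self_eq_0[OF cont_repD(1)[OF C]] that by blast
    moreover have "x i = 0" if "i \<notin> ?I" for i
      using x rep_act_span_subset[of R v] that unfolding S rep_space_def by blast
    ultimately show ?thesis by (metis zero_fun_apply ext)
  qed
  have key: "cinner ?I v (rep_act R h x) = cinner ?I v v * L x (flag_of (transpose h))"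
    if x: "x \<in> S" and h: "h \<in> SL3" for x h
    using x unfolding S
  proof (induction rule: fun_space.span_induct_alt)
    case base
    then show ?case
      by (simp only: fun_pair.linear_0[OF linear_rep_act] fun_pair.linear_0[OF L(1)] cinner_simps) simp
  next
    case (step c y z)
    then obtain g where g: "g \<in> SL3" "y = rep_act R g v" by blast
    have "cinner ?I v (rep_act R h y) = hw_coeff a b (h ** g) * cinner ?I v v"
      using star_matrix_coeff[OF R v SL3_mult[OF h g(1)]] cont_repD(3)[OF C h g(1) vR] by (simp add: g(2))
    also have "hw_coeff a b (h ** g) = L y (flag_of (transpose h))"
      using orbit_fun_hw_coeff[OF g(1) h, of a b] L(4)[OF g(1)] by (simp add: g(2))
    finally have y: "cinner ?I v (rep_act R h y) = cinner ?I v v * L y (flag_of (transpose h))"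
      by (simp only: mult.commute)
    have e1: "rep_act R h (fscale c y + z) = fscale c (rep_act R h y) + rep_act R h z"
      and e2: "L (fscale c y + z) = fscale c (L y) + L z"
      by (simp_all only: fun_pair.linear_add[OF linear_rep_act] fun_pair.linear_scale[OF linear_rep_act]
          fun_pair.linear_add[OF L(1)] fun_pair.linear_scale[OF L(1)])
    have "cinner ?I v (rep_act R h (fscale c y + z)) = c * cinner ?I v (rep_act R h y) + cinner ?I v (rep_act R h z)"
      by (subst e1, subst cinner_simps(2), subst cinner_simps(6), rule refl)
    moreover have "L (fscale c y + z) w = c * L y w + L z w" for w
      by (subst e2, subst plus_fun_apply, subst fscale_apply, rule refl)
    ultimately show ?case unfolding y step.IH by (simp only: distrib_left mult.left_commute)
  qed
  have "x = 0" if "x \<in> S" "L x = 0" for x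
    using perp[OF that(1)] key[OF that(1)] that(2) by simp
  then show thesis using that L perp by blast
qed

section \<open>Decomposition into highest weight summands\<close>

definition hw_family :: "(nat \<times> nat \<times> nat) list \<Rightarrow> (nat \<times> nat \<times> nat \<times> nat) set"
  where "hw_family \<Lambda> = Sigma {..<length \<Lambda>} (\<lambda>i. case \<Lambda> ! i of (l1, l2, l3) \<Rightarrow> gt (l1 - l3) (l2 - l3) 0)"

text \<open>Shapes differing by a multiple of (1, 1, 1) give the same representation of
  \<open>SL3\<close>, so patterns are taken for the shape lowered by \<open>l3\<close>. Adding
  \<open>l3\<close> back gives the weight its full degree.\<close>

definition hw_wt :: "nat \<times> nat \<times> nat \<Rightarrow> nat \<times> nat \<times> nat \<Rightarrow> nat \<times> nat \<times> nat"
  where "hw_wt = (\<lambda>(l1, l2, l3) \<tau>. case gt_weight (l1 - l3) (l2 - l3) 0 \<tau> of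
    (a, b, c) \<Rightarrow> (a + l3, b + l3, c + l3))"

lemma wt_char_shift:
  assumes "x * y * z = 1" shows "wt_char (a + c, b + c, d + c) (x, y, z) = wt_char (a, b, d) (x, y, z)"
proof -
  have "wt_char (a + c, b + c, d + c) (x, y, z) = wt_char (a, b, d) (x, y, z) * (x * y * z) ^ c"
    by (simp add: wt_char_def power_add power_mult_distrib mult_ac)
  then show ?thesis by (simp add: assms)
qed

definition fixed_vectors :: "'i sl3_rep \<Rightarrow> ('i \<Rightarrow> complex) set \<Rightarrow> ('i \<Rightarrow> complex) set"
  where "fixed_vectors R S = {x \<in> S. \<forall>G\<in>SL3. rep_act R G x = x}"

lemma fixed_vectors_subspace: "fun_space.subspace S \<Longrightarrow> fun_space.subspace (fixed_vectors R S)"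
  unfolding fun_space.subspace_def fixed_vectors_def
  by (simp add: fun_pair.linear_0[OF linear_rep_act]
      fun_pair.linear_add[OF linear_rep_act] fun_pair.linear_scale[OF linear_rep_act])

lemma std_basis_pullback:
  assumes L: "Vector_Spaces.linear fscale fscale L" "L ` S = cone_funs a b" "\<And>x. x \<in> S \<Longrightarrow> L x = 0 \<Longrightarrow> x = 0"
    and S: "fun_space.subspace S"
  obtains g where "is_basis (gt (a + b) b 0) g S" "\<And>\<tau>. \<tau> \<in> gt (a + b) b 0 \<Longrightarrow> L (g \<tau>) = std_fun a b \<tau>"
proof -
  have "inj_on L S" using L(3) by (simp add: fun_pair.linear_inj_on_iff_eq_0[OF L(1) S])
  then obtain M where M: "Vector_Spaces.linear fscale fscale M" "\<And>x. x \<in> S \<Longrightarrow> M (L x) = x"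
    using fun_pair.linear_exists_left_inverse_on[OF L(1) S] by metis
  have im: "M ` cone_funs a b = S" unfolding L(2)[symmetric] image_image using M(2) by simp
  have M0: "y = 0" if "y \<in> cone_funs a b" "M y = 0" for y
    using that M(2) fun_pair.linear_0[OF L(1)] unfolding L(2)[symmetric] by auto
  have "is_basis (gt (a + b) b 0) (\<lambda>\<tau>. M (std_fun a b \<tau>)) S"
    using is_basis_image[of "gt (a + b) b 0" "std_fun a b" "cone_funs a b" M, OF std_basis M(1)] M0
    unfolding im by blast
  moreover have "L (M (std_fun a b \<tau>)) = std_fun a b \<tau>" if "\<tau> \<in> gt (a + b) b 0" for \<tau>
    using std_fun_mem[OF that] M(2) unfolding L(2)[symmetric] by auto
  ultimately show thesis using that by blast
qed

text \<open>The map of \<open>star_hw_iso\<close> pulls the standard monomials back to weight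
  vectors of \<open>S\<close>. For the fixed vectors, the case of equal parts is the trivial
  representation, and otherwise a fixed vector is orthogonal to \<open>v\<close>, hence to all its
  translates.\<close>

lemma star_hw_summand:
  assumes R: "star_rep R D wt" and v: "highest_weight_vector R (l1 - l2) (l2 - l3) v"
    and l: "l3 \<le> l2" "l2 \<le> l1"
    and S: "S = fun_space.span ((\<lambda>g. rep_act R g v) ` SL3)"
  obtains g where "is_basis (gt (l1 - l3) (l2 - l3) 0) g S"
    "\<And>\<tau> x y z. \<tau> \<in> gt (l1 - l3) (l2 - l3) 0 \<Longrightarrow> x * y * z = 1 \<Longrightarrow>
      rep_act R (diagm x y z) (g \<tau>) = fscale (wt_char (hw_wt (l1, l2, l3) \<tau>) (x, y, z)) (g \<tau>)"
    "fun_space.dim (fixed_vectors R S) = (if l1 = l2 \<and> l2 = l3 then 1 else 0)"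
proof -
  note C = star_rep_cont_rep[OF R]
  note vR = highest_weight_vectorD(1,2)[OF v]
  let ?I = "idx R" and ?a = "l1 - l2" and ?b = "l2 - l3"
  have ab: "?a + ?b = l1 - l3" using l by simp
  have sub: "fun_space.subspace S" by (simp add: S)
  obtain L where L: "Vector_Spaces.linear fscale fscale L" "L ` S = cone_funs ?a ?b"
    "\<And>g x. g \<in> SL3 \<Longrightarrow> x \<in> S \<Longrightarrow> L (rep_act R g x) = pull g (L x)"
    "\<And>g. g \<in> SL3 \<Longrightarrow> L (rep_act R g v) = orbit_fun ?a ?b g"
    "\<And>x. x \<in> S \<Longrightarrow> (\<And>h. h \<in> SL3 \<Longrightarrow> cinner ?I v (rep_act R h x) = 0) \<Longrightarrow> x = 0"
    "\<And>x. x \<in> S \<Longrightarrow> L x = 0 \<Longrightarrow> x = 0"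
    using star_hw_iso[OF R v S] by blast
  have inv: "rep_act R h x \<in> S" if "h \<in> SL3" "x \<in> S" for h x
    using orbit_span_invariant[OF C vR(1) that(1)] that(2) unfolding S by blast
  have L_inj: "x = y" if "x \<in> S" "y \<in> S" "L x = L y" for x y
    using L(6)[of "x - y"] that fun_space.subspace_diff[OF sub] by (simp add: fun_pair.linear_diff[OF L(1)])
  obtain g where g: "is_basis (gt (l1 - l3) ?b 0) g S" "\<And>\<tau>. \<tau> \<in> gt (l1 - l3) ?b 0 \<Longrightarrow> L (g \<tau>) = std_fun ?a ?b \<tau>"
    using std_basis_pullback[OF L(1,2,6) sub] unfolding ab by blast
  have wt: "rep_act R (diagm x y z) (g \<tau>) = fscale (wt_char (hw_wt (l1, l2, l3) \<tau>) (x, y, z)) (g \<tau>)"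
    if \<tau>: "\<tau> \<in> gt (l1 - l3) ?b 0" and t: "x * y * z = 1" for \<tau> x y z
  proof (rule L_inj)
    have d: "diagm x y z \<in> SL3" using t by simp
    have gS: "g \<tau> \<in> S" by (rule is_basis_mem[OF g(1) \<tau>])
    show "rep_act R (diagm x y z) (g \<tau>) \<in> S" by (rule inv[OF d gS])
    show "fscale (wt_char (hw_wt (l1, l2, l3) \<tau>) (x, y, z)) (g \<tau>) \<in> S"
      by (rule fun_space.subspace_scale[OF sub gS])
    have "wt_char (hw_wt (l1, l2, l3) \<tau>) (x, y, z) = wt_char (gt_weight (l1 - l3) ?b 0 \<tau>) (x, y, z)"
      by (simp add: hw_wt_def wt_char_shift[OF t] split: prod.splits)
    moreover have "L (rep_act R (diagm x y z) (g \<tau>)) = fscale (wt_char (gt_weight (l1 - l3) ?b 0 \<tau>) (x, y, z)) (L (g \<tau>))"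
      unfolding L(3)[OF d gS] g(2)[OF \<tau>] using std_fun_weight[OF t, of \<tau> ?a ?b] \<tau> unfolding ab by blast
    ultimately show "L (rep_act R (diagm x y z) (g \<tau>)) = L (fscale (wt_char (hw_wt (l1, l2, l3) \<tau>) (x, y, z)) (g \<tau>))"
      by (simp only: fun_pair.linear_scale[OF L(1)])
  qed
  have "fun_space.dim (fixed_vectors R S) = (if l1 = l2 \<and> l2 = l3 then 1 else 0)"
  proof (cases "l1 = l2 \<and> l2 = l3")
    case True
    \<comment> \<open>Both exponents are 0, so the orbit functions are all the same constant on the
      cone.\<close>
    have "rep_act R h v = v" if h: "h \<in> SL3" for h
    proof (rule L_inj)
      have "v = rep_act R (mat 1) v" using cont_repD(2)[OF C vR(1)] by simp
      then show vS: "v \<in> S" unfolding S by (intro fun_space.span_base image_eqI[of _ _ "mat 1"]) auto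
      show "rep_act R h v \<in> S" by (rule inv[OF h vS])
      have "L (rep_act R h v) = L (rep_act R (mat 1) v)"
        unfolding L(4)[OF h] L(4)[OF SL3_one] using True by (simp add: orbit_fun_def kernel_fun_def fun_eq_iff)
      then show "L (rep_act R h v) = L v" using cont_repD(2)[OF C vR(1)] by simp
    qed
    then have "(\<lambda>g. rep_act R g v) ` SL3 \<subseteq> {v}" by auto
    then have "S \<subseteq> fun_space.span {v}" unfolding S by (rule fun_space.span_mono)
    then have "rep_act R h x = x" if "x \<in> S" "h \<in> SL3" for x h
    proof -
      have "x \<in> fun_space.span ((\<lambda>_. v) ` {()})" using \<open>S \<subseteq> _\<close> that by auto
      then obtain c where "x = (\<Sum>j\<in>{()}. fscale (c j) v)" by (rule span_fam[rotated]) auto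
      then show ?thesis using \<open>\<And>h. h \<in> SL3 \<Longrightarrow> rep_act R h v = v\<close>[OF that(2)]
        by (simp add: fun_pair.linear_scale[OF linear_rep_act])
    qed
    then have "fixed_vectors R S = S" by (auto simp: fixed_vectors_def)
    moreover have "gt (l1 - l3) (l2 - l3) 0 = {(0, 0, 0)}" using True by (auto simp: gt_def)
    ultimately show ?thesis using is_basis_dim[OF g(1)] True by simp
  next
    case False
    have "x = 0" if x: "x \<in> fixed_vectors R S" for x
    proof (rule L(5))
      show "x \<in> S" using x by (simp add: fixed_vectors_def)
      have fix_x: "rep_act R h x = x" if "h \<in> SL3" for h using x that by (simp add: fixed_vectors_def)
      \<comment> \<open>This element is its own conjugate transpose, fixes \<open>x\<close>, and
        scales \<open>v\<close> by \<open>2 ^ (l1 - l3)\<close>, which differs from 1.\<close>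
      let ?d = "diagm 2 1 (1/2)"
      have d: "?d \<in> SL3" by simp
      have hd: "hadj ?d = ?d" by (simp add: mat3_eq_iff diagm_def)
      have "cinner ?I (rep_act R ?d v) x = cinner ?I v x"
        using star_rep_adjoint[OF R d, of v x] fix_x[OF d] by (simp only: hd)
      then have "cinner ?I (fscale (2 ^ (?a + ?b)) v) x = cinner ?I v x"
        using highest_weight_vectorD(4)[OF v, of 2 1 "1/2"] by (simp add: power_add)
      then have "2 ^ (?a + ?b) * cinner ?I v x = 2 ^ 0 * cinner ?I v x" by (simp add: cinner_simps(5))
      moreover have "(2::complex) ^ (?a + ?b) \<noteq> 2 ^ 0" using False l by (subst two_power_eq_iff) auto
      ultimately have "cinner ?I v x = 0" by (metis mult_right_cancel)
      then show "cinner ?I v (rep_act R h x) = 0" if "h \<in> SL3" for h by (simp only: fix_x[OF that])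
    qed
    then have "fixed_vectors R S = {0}"
      using fun_space.subspace_0[OF fixed_vectors_subspace[OF sub]] by blast
    then have "is_basis ({} :: nat set) (\<lambda>_. 0) (fixed_vectors R S)" by (simp add: is_basis_def indep_fam_def)
    from is_basis_dim[OF this] show ?thesis using False by simp
  qed
  then show thesis using that g(1) wt by blast
qed

text \<open>The numerical trace of a decomposition: the highest weights listed with multiplicity, a
  weight basis indexed by their patterns, and the number of trivial summands as the dimension of the
  fixed vectors.\<close>

definition decomposes :: "'i sl3_rep \<Rightarrow> nat \<Rightarrow> ('i \<Rightarrow> complex) set \<Rightarrow> (nat \<times> nat \<times> nat) list \<Rightarrow>
    (nat \<times> nat \<times> nat \<times> nat \<Rightarrow> 'i \<Rightarrow> complex) \<Rightarrow> bool"
  where "decomposes R D S \<Lambda> g \<longleftrightarrow>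
    (\<forall>(l1, l2, l3)\<in>set \<Lambda>. l3 \<le> l2 \<and> l2 \<le> l1 \<and> l1 + l2 + l3 = D) \<and>
    is_basis (hw_family \<Lambda>) g S \<and>
    (\<forall>(i, \<tau>)\<in>hw_family \<Lambda>. \<forall>x y z. x * y * z = 1 \<longrightarrow>
      rep_act R (diagm x y z) (g (i, \<tau>)) = fscale (wt_char (hw_wt (\<Lambda> ! i) \<tau>) (x, y, z)) (g (i, \<tau>))) \<and>
    fun_space.dim (fixed_vectors R S) = length (filter (\<lambda>(l1, l2, l3). l1 = l2 \<and> l2 = l3) \<Lambda>)"

text \<open>Induction on the dimension: the orbit span \<open>S1\<close> of a highest weight vector
  is split off, and the induction hypothesis applies to its complement \<open>S2\<close> inside
  \<open>S\<close>. The weight bases are joined and the dimensions of the fixed vectors add.\<close>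

lemma star_decomposition:
  assumes R: "star_rep R D wt"
  shows "invariant_subspace R S \<Longrightarrow> \<exists>\<Lambda> g. decomposes R D S \<Lambda> g"
proof (induction "fun_space.dim S" arbitrary: S rule: less_induct)
  case less
  note S = less.prems
  note C = star_rep_cont_rep[OF R]
  let ?I = "idx R"
  have fin: "finite ?I" by (rule cont_repD(1)[OF C])
  have sub: "fun_space.subspace S" and SR: "S \<subseteq> supported ?I"
    and inv: "\<And>G x. G \<in> SL3 \<Longrightarrow> x \<in> S \<Longrightarrow> rep_act R G x \<in> S"
    using S by (auto simp: invariant_subspace_def rep_space_supported)
  show ?case
  proof (cases "S = {0}")
    case True
    have b: "is_basis {} (\<lambda>_. 0) {0}" by (simp add: is_basis_def indep_fam_def)
    have "fixed_vectors R S = {0}" using True fun_space.subspace_0[OF fixed_vectors_subspace[OF sub]]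
      by (auto simp: fixed_vectors_def)
    then have "fun_space.dim (fixed_vectors R S) = 0" using is_basis_dim[OF b] by simp
    then show ?thesis
      by (intro exI[of _ "[]"] exI[of _ "\<lambda>_. 0"]) (use True b in \<open>simp add: decomposes_def hw_family_def is_basis_def indep_fam_def\<close>)
  next
    case False
    obtain v l1 l2 l3 where v: "v \<in> S" and l: "l3 \<le> l2" "l2 \<le> l1" "l1 + l2 + l3 = D"
      and hw: "highest_weight_vector R (l1 - l2) (l2 - l3) v"
      by (rule hw_exists[OF R S False])
    note vR = highest_weight_vectorD(1)[OF hw]
    define S1 where "S1 = fun_space.span ((\<lambda>g. rep_act R g v) ` SL3)"
    define S2 where "S2 = {x \<in> S. \<forall>z\<in>S1. cinner ?I z x = 0}"
    have sub1: "fun_space.subspace S1" by (simp add: S1_def)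
    have S1S: "S1 \<subseteq> S" unfolding S1_def by (rule fun_space.span_minimal[OF _ sub]) (use inv v in auto)
    have inv1: "rep_act R h x \<in> S1" if "h \<in> SL3" "x \<in> S1" for h x
      using orbit_span_invariant[OF C vR that(1)] that(2) unfolding S1_def by blast
    have sub2: "fun_space.subspace S2"
      using sub unfolding fun_space.subspace_def S2_def by (simp add: cinner_simps)
    have inv2: "rep_act R h x \<in> S2" if h: "h \<in> SL3" and x: "x \<in> S2" for h x
      unfolding S2_def
    proof (intro CollectI conjI ballI)
      show "rep_act R h x \<in> S" using inv h x by (simp add: S2_def)
      fix z assume z: "z \<in> S1"
      have "cinner ?I z (rep_act R h x) = cinner ?I (rep_act R (hadj h) z) x"
        by (rule star_rep_adjoint[OF R h, symmetric])
      then show "cinner ?I z (rep_act R h x) = 0" using inv1[OF hadj_SL3[OF h] z] x by (simp add: S2_def)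
    qed
    have S2: "invariant_subspace R S2"
      using sub2 inv2 SR by (auto simp: invariant_subspace_def rep_space_supported S2_def)
    have disj: "x = 0" if x: "x \<in> S1" and y: "y \<in> S2" and 0: "x + y = 0" for x y
    proof
      fix i
      have "cinner ?I x (x + y) = 0" by (simp only: 0 cinner_simps)
      then have "cinner ?I x x = 0" using x y by (simp add: cinner_simps(2) S2_def)
      then show "x i = 0 i"
        using cinner_self_eq_0[OF fin] x S1S SR by (cases "i \<in> ?I") (auto simp: supported_def)
    qed
    have split: "\<exists>y z. x = y + z \<and> y \<in> S1 \<and> z \<in> S2" if x: "x \<in> S" for x
    proof -
      obtain y where y: "y \<in> S1" "\<And>z. z \<in> S1 \<Longrightarrow> cinner ?I z (x - y) = 0"
        using orth_proj[OF fin sub1, of x] S1S SR by blast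
      have "x - y \<in> S2" using y x S1S fun_space.subspace_diff[OF sub] by (auto simp: S2_def)
      then show ?thesis using y(1) by (intro exI[of _ y] exI[of _ "x - y"]) auto
    qed
    have S_eq: "S = {x + y | x y. x \<in> S1 \<and> y \<in> S2}"
      using split S1S fun_space.subspace_add[OF sub] by (auto simp: S2_def)
    obtain g1 where g1: "is_basis (gt (l1 - l3) (l2 - l3) 0) g1 S1"
      "\<And>\<tau> x y z. \<tau> \<in> gt (l1 - l3) (l2 - l3) 0 \<Longrightarrow> x * y * z = 1 \<Longrightarrow>
        rep_act R (diagm x y z) (g1 \<tau>) = fscale (wt_char (hw_wt (l1, l2, l3) \<tau>) (x, y, z)) (g1 \<tau>)"
      "fun_space.dim (fixed_vectors R S1) = (if l1 = l2 \<and> l2 = l3 then 1 else 0)"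
      using star_hw_summand[OF R hw l(1,2) S1_def] by blast
    have "S2 \<subseteq> supported ?I" using SR by (auto simp: S2_def)
    then obtain B2 where B2: "is_basis B2 (\<lambda>b. b) S2"
      using supported_subspace_basis[OF fin sub2] by blast
    have "fun_space.dim S = card (gt (l1 - l3) (l2 - l3) 0 <+> B2)"
      by (rule is_basis_dim[OF is_basis_direct[OF g1(1) B2 disj S_eq]])
    also have "\<dots> = card (gt (l1 - l3) (l2 - l3) 0) + fun_space.dim S2"
      using B2 is_basis_dim[OF B2] by (simp add: card_Plus is_basis_def)
    finally have "fun_space.dim S = card (gt (l1 - l3) (l2 - l3) 0) + fun_space.dim S2" .
    \<comment> \<open>A pattern exists, so the split-off summand is nonzero and the dimension
      drops.\<close>
    moreover have "(l2 - l3, l2 - l3, 0) \<in> gt (l1 - l3) (l2 - l3) 0" using l by (simp add: gt_def)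
    then have "card (gt (l1 - l3) (l2 - l3) 0) > 0" by (metis card_gt_0_iff empty_iff finite_gt)
    ultimately have "fun_space.dim S2 < fun_space.dim S" by linarith
    from less.hyps[OF this S2] obtain \<Lambda> g where "decomposes R D S2 \<Lambda> g" by blast
    note IH = this[unfolded decomposes_def, THEN conjunct1]
      this[unfolded decomposes_def, THEN conjunct2, THEN conjunct1]
      this[unfolded decomposes_def, THEN conjunct2, THEN conjunct2, THEN conjunct1]
      this[unfolded decomposes_def, THEN conjunct2, THEN conjunct2, THEN conjunct2]
    define f :: "nat \<times> nat \<times> nat \<times> nat \<Rightarrow> (nat \<times> nat \<times> nat) + (nat \<times> nat \<times> nat \<times> nat)"
      where "f = (\<lambda>(i, \<tau>). case i of 0 \<Rightarrow> Inl \<tau> | Suc i \<Rightarrow> Inr (i, \<tau>))"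
    let ?L = "(l1, l2, l3) # \<Lambda>"
    have f: "bij_betw f (hw_family ?L) (gt (l1 - l3) (l2 - l3) 0 <+> hw_family \<Lambda>)"
    proof (rule bij_betwI[where g = "case_sum (\<lambda>\<tau>. (0, \<tau>)) (\<lambda>(i, \<tau>). (Suc i, \<tau>))"])
      show "f \<in> hw_family ?L \<rightarrow> gt (l1 - l3) (l2 - l3) 0 <+> hw_family \<Lambda>"
        by (auto simp: f_def hw_family_def split: nat.splits)
      show "case_sum (\<lambda>\<tau>. (0, \<tau>)) (\<lambda>(i, \<tau>). (Suc i, \<tau>)) \<in> gt (l1 - l3) (l2 - l3) 0 <+> hw_family \<Lambda> \<rightarrow> hw_family ?L"
        by (auto simp: hw_family_def)
    qed (auto simp: f_def split: nat.splits)
    let ?g = "\<lambda>j. case_sum g1 g (f j)"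
    have "is_basis (hw_family ?L) ?g S"
      by (rule is_basis_reindex[OF is_basis_direct[OF g1(1) IH(2) disj S_eq] f])
    moreover have "\<forall>(i, \<tau>)\<in>hw_family ?L. \<forall>x y z. x * y * z = 1 \<longrightarrow>
        rep_act R (diagm x y z) (?g (i, \<tau>)) = fscale (wt_char (hw_wt (?L ! i) \<tau>) (x, y, z)) (?g (i, \<tau>))"
    proof (clarify)
      fix i s p q and x y z :: complex assume j: "(i, s, p, q) \<in> hw_family ?L" and t: "x * y * z = 1"
      show "rep_act R (diagm x y z) (?g (i, s, p, q)) =
        fscale (wt_char (hw_wt (?L ! i) (s, p, q)) (x, y, z)) (?g (i, s, p, q))"
      proof (cases i)
        case 0
        then show ?thesis using j g1(2)[OF _ t, of "(s, p, q)"] by (simp add: f_def hw_family_def)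
      next
        case (Suc k)
        then have "(k, s, p, q) \<in> hw_family \<Lambda>" using j by (simp add: hw_family_def)
        then show ?thesis using Suc IH(3) t by (auto simp: f_def)
      qed
    qed
    moreover have "fun_space.dim (fixed_vectors R S) = length (filter (\<lambda>(l1, l2, l3). l1 = l2 \<and> l2 = l3) ?L)"
    proof -
      have fsub: "fixed_vectors R S1 \<subseteq> supported ?I" "fixed_vectors R S2 \<subseteq> supported ?I"
        using S1S SR by (auto simp: fixed_vectors_def S2_def)
      obtain F1 where F1: "is_basis F1 (\<lambda>b. b) (fixed_vectors R S1)"
        using supported_subspace_basis[OF fin fixed_vectors_subspace[OF sub1] fsub(1)] by blast
      obtain F2 where F2: "is_basis F2 (\<lambda>b. b) (fixed_vectors R S2)"
        using supported_subspace_basis[OF fin fixed_vectors_subspace[OF sub2] fsub(2)] by blast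
      have "fixed_vectors R S = {x + y | x y. x \<in> fixed_vectors R S1 \<and> y \<in> fixed_vectors R S2}"
      proof (intro subset_antisym subsetI)
        fix x assume x: "x \<in> fixed_vectors R S"
        then have "x \<in> S" by (simp add: fixed_vectors_def)
        then obtain y z where yz: "x = y + z" "y \<in> S1" "z \<in> S2" using split by blast
        \<comment> \<open>The components of a vector in \<open>S1\<close> and \<open>S2\<close> are
          unique and both spaces are invariant, so the components of a fixed vector are
          fixed.\<close>
        have "rep_act R h y = y \<and> rep_act R h z = z" if h: "h \<in> SL3" for h
        proof -
          have e: "rep_act R h y + rep_act R h z = y + z"
            using x h yz(1) fun_pair.linear_add[OF linear_rep_act, of R h y z] by (simp add: fixed_vectors_def)
          then have "(rep_act R h y - y) + (rep_act R h z - z) = 0" by (simp add: algebra_simps)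
          moreover have "rep_act R h y - y \<in> S1" "rep_act R h z - z \<in> S2"
            using inv1[OF h yz(2)] inv2[OF h yz(3)] yz fun_space.subspace_diff sub1 sub2 by blast+
          ultimately have "rep_act R h y - y = 0" using disj by blast
          then have "rep_act R h y = y" by simp
          then show ?thesis using e by simp
        qed
        then show "x \<in> {x + y | x y. x \<in> fixed_vectors R S1 \<and> y \<in> fixed_vectors R S2}"
          using yz by (auto simp: fixed_vectors_def)
      next
        fix x assume "x \<in> {x + y | x y. x \<in> fixed_vectors R S1 \<and> y \<in> fixed_vectors R S2}"
        then show "x \<in> fixed_vectors R S"
          using S_eq by (auto simp: fixed_vectors_def fun_pair.linear_add[OF linear_rep_act])
      qed
      from is_basis_dim[OF is_basis_direct[OF F1 F2 _ this]] disj
      have "fun_space.dim (fixed_vectors R S) = card (F1 <+> F2)" by (auto simp: fixed_vectors_def)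
      also have "\<dots> = fun_space.dim (fixed_vectors R S1) + fun_space.dim (fixed_vectors R S2)"
        using F1 F2 is_basis_dim[OF F1] is_basis_dim[OF F2] by (simp add: card_Plus is_basis_def)
      finally show ?thesis using g1(3) IH(4) by simp
    qed
    moreover have "\<forall>(l1, l2, l3)\<in>set ?L. l3 \<le> l2 \<and> l2 \<le> l1 \<and> l1 + l2 + l3 = D" using IH(1) l by auto
    ultimately have "decomposes R D S ?L ?g" unfolding decomposes_def by (intro conjI)
    then show ?thesis by blast
  qed
qed

section \<open>Multiplicities in the multihomogeneous components\<close>

definition std_rep :: "3 sl3_rep"
  where "std_rep = \<lparr>idx = UNIV, entry = (\<lambda>G i j. G $ i $ j)\<rparr>"

definition dual_rep :: "3 sl3_rep"
  where "dual_rep = \<lparr>idx = UNIV, entry = (\<lambda>G i j. adj3 G $ j $ i)\<rparr>"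

definition std_wt :: "3 \<Rightarrow> nat \<times> nat \<times> nat"
  where "std_wt i = (if i = 1 then (1, 0, 0) else if i = 2 then (0, 1, 0) else (0, 0, 1))"

text \<open>The inverse of \<open>x\<close> on the torus is \<open>y * z\<close>, and similarly for
  the others; the dual thereby gets nonnegative weights of degree 2.\<close>

definition dual_wt :: "3 \<Rightarrow> nat \<times> nat \<times> nat"
  where "dual_wt i = (if i = 1 then (0, 1, 1) else if i = 2 then (1, 0, 1) else (1, 1, 0))"

lemma star_rep_std: "star_rep std_rep 1 std_wt"
  unfolding star_rep_def
proof (intro conjI ballI allI impI)
  fix x y z :: complex and i j :: 3
  show "entry std_rep (diagm x y z) i j = (if i = j then wt_char (std_wt i) (x, y, z) else 0)"
    using exhaust_3[of i] exhaust_3[of j] by (auto simp: std_rep_def diagm_def std_wt_def wt_char_def)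
next
  fix i j :: 3
  show "continuous_on SL3 (\<lambda>G. entry std_rep G i j)"
    by (simp add: std_rep_def continuous_intros)
qed (auto simp: std_rep_def matrix_mult_3 sum_3 std_wt_def wt_deg_def)

lemma star_rep_dual: "star_rep dual_rep 2 dual_wt"
  unfolding star_rep_def
proof (intro conjI ballI allI impI)
  fix x y z :: complex and i j :: 3 assume "x * y * z = 1"
  then show "entry dual_rep (diagm x y z) i j = (if i = j then wt_char (dual_wt i) (x, y, z) else 0)"
    using exhaust_3[of i] exhaust_3[of j]
    by (auto simp: dual_rep_def adj3_diagm) (auto simp: diagm_def dual_wt_def wt_char_def)
next
  fix i j :: 3
  show "continuous_on SL3 (\<lambda>G. entry dual_rep G i j)"
    using exhaust_3[of i] exhaust_3[of j]
    by (elim disjE) (simp_all add: dual_rep_def adj3_def, (intro continuous_intros)+)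
qed (auto simp: dual_rep_def adj3_mat_mult adj3_hadj matrix_mult_3 sum_3 dual_wt_def wt_deg_def mult.commute)

definition tensor_wt :: "nat \<Rightarrow> (nat \<Rightarrow> 'i \<Rightarrow> nat \<times> nat \<times> nat) \<Rightarrow> (nat \<Rightarrow> 'i) \<Rightarrow> nat \<times> nat \<times> nat"
  where "tensor_wt n w I = (\<Sum>i<n. fst (w i (I i)), \<Sum>i<n. fst (snd (w i (I i))), \<Sum>i<n. snd (snd (w i (I i))))"

lemma wt_char_tensor: "wt_char (tensor_wt n w I) t = (\<Prod>i<n. wt_char (w i (I i)) t)"
  by (cases t) (simp add: wt_char_def tensor_wt_def split_beta power_sum prod.distrib)

lemma wt_deg_tensor: "wt_deg (tensor_wt n w I) = (\<Sum>i<n. wt_deg (w i (I i)))"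
  by (simp add: wt_deg_def tensor_wt_def split_beta sum.distrib)

lemma star_rep_tensor:
  assumes R: "\<And>i. i < n \<Longrightarrow> star_rep (R i) (D i) (w i)"
  shows "star_rep (tensor_rep n R) (\<Sum>i<n. D i) (tensor_wt n w)"
proof -
  let ?T = "tensor_rep n R"
  have idx: "idx ?T = (\<Pi>\<^sub>E i\<in>{..<n}. idx (R i))" and ent: "entry ?T G I J = (\<Prod>i<n. entry (R i) G (I i) (J i))" for G I J
    by (simp_all add: tensor_rep_def)
  have fin: "finite (idx (R i))" if "i < n" for i using R[OF that] by (simp add: star_rep_def)
  have mem: "I i \<in> idx (R i)" if "I \<in> idx ?T" "i < n" for I i using that by (auto simp: idx)
  show ?thesis
    unfolding star_rep_def
  proof (intro conjI ballI allI impI)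
    show "finite (idx ?T)" unfolding idx by (intro finite_PiE) (use fin in auto)
  next
    fix G H I J assume GH: "G \<in> SL3" "H \<in> SL3" and IJ: "I \<in> idx ?T" "J \<in> idx ?T"
    have "entry ?T (G ** H) I J = (\<Prod>i<n. \<Sum>k\<in>idx (R i). entry (R i) G (I i) k * entry (R i) H k (J i))"
      unfolding ent
    proof (intro prod.cong refl)
      fix i assume "i \<in> {..<n}"
      then show "entry (R i) (G ** H) (I i) (J i) = (\<Sum>k\<in>idx (R i). entry (R i) G (I i) k * entry (R i) H k (J i))"
        using R[of i] GH mem[OF IJ(1), of i] mem[OF IJ(2), of i] by (simp add: star_rep_def)
    qed
    also have "\<dots> = (\<Sum>K\<in>idx ?T. \<Prod>i<n. entry (R i) G (I i) (K i) * entry (R i) H (K i) (J i))"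
      unfolding idx by (rule prod_sum_PiE) (use fin in auto)
    finally show "entry ?T (G ** H) I J = (\<Sum>K\<in>idx ?T. entry ?T G I K * entry ?T H K J)"
      by (simp add: ent prod.distrib)
  next
    fix I J assume IJ: "I \<in> idx ?T" "J \<in> idx ?T"
    have "continuous_on SL3 (\<lambda>G. entry (R i) G (I i) (J i))" if "i < n" for i
      using R[OF that] mem[OF IJ(1) that] mem[OF IJ(2) that] by (simp add: star_rep_def)
    then show "continuous_on SL3 (\<lambda>G. entry ?T G I J)" unfolding ent by (intro continuous_on_prod) auto
  next
    fix G I J assume G: "G \<in> SL3" and IJ: "I \<in> idx ?T" "J \<in> idx ?T"
    have "entry (R i) (hadj G) (I i) (J i) = cnj (entry (R i) G (J i) (I i))" if "i < n" for i
      using R[OF that] G mem[OF IJ(1) that] mem[OF IJ(2) that] by (simp add: star_rep_def)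
    then show "entry ?T (hadj G) I J = cnj (entry ?T G J I)" unfolding ent cnj_prod by (intro prod.cong) auto
  next
    fix x y z :: complex and I J assume t: "x * y * z = 1" and IJ: "I \<in> idx ?T" "J \<in> idx ?T"
    have e: "entry (R i) (diagm x y z) (I i) (J i) = (if I i = J i then wt_char (w i (I i)) (x, y, z) else 0)"
      if "i < n" for i
      using R[OF that] t mem[OF IJ(1) that] mem[OF IJ(2) that] by (simp add: star_rep_def)
    show "entry ?T (diagm x y z) I J = (if I = J then wt_char (tensor_wt n w I) (x, y, z) else 0)"
    proof (cases "I = J")
      case True
      then show ?thesis unfolding ent wt_char_tensor using e by (auto intro!: prod.cong)
    next
      case False
      have "\<exists>i<n. I i \<noteq> J i"
      proof (rule ccontr)
        assume "\<not> ?thesis"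
        then have "I = J" using IJ unfolding idx by (intro PiE_ext[of I "{..<n}" _ J]) auto
        then show False using False by simp
      qed
      then have "(\<Prod>i<n. entry (R i) (diagm x y z) (I i) (J i)) = 0" using e by (intro prod_zero) auto
      then show ?thesis using False by (simp add: ent)
    qed
  next
    fix I assume "I \<in> idx ?T"
    then have "wt_deg (w i (I i)) = D i" if "i < n" for i
      using R[OF that] mem that by (simp add: star_rep_def)
    then show "wt_deg (tensor_wt n w I) = (\<Sum>i<n. D i)" unfolding wt_deg_tensor by (intro sum.cong) auto
  qed
qed

text \<open>The tensor product of \<open>r + 3\<close> standard representations with
  \<open>r\<close> dual ones. It maps onto \<open>cone_funs (r + 3) r\<close>, and the conjugate
  transpose acts on it as the adjoint, which is not known for the given irreducibles.\<close>

definition slot_rep :: "nat \<Rightarrow> (nat \<Rightarrow> 3) sl3_rep"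
  where "slot_rep r = tensor_rep (2 * r + 3) (\<lambda>k. if k < r + 3 then std_rep else dual_rep)"

definition slot_wt :: "nat \<Rightarrow> (nat \<Rightarrow> 3) \<Rightarrow> nat \<times> nat \<times> nat"
  where "slot_wt r = tensor_wt (2 * r + 3) (\<lambda>k. if k < r + 3 then std_wt else dual_wt)"

lemma star_rep_slot: "star_rep (slot_rep r) (3 * r + 3) (slot_wt r)"
proof -
  have "(\<Sum>k<a + b. if k < a then 1 else 2) = a + 2 * b" for a b :: nat
    by (induction b) simp_all
  from this[of "r + 3" r] have "(\<Sum>k<2 * r + 3. if k < r + 3 then 1 else 2) = 3 * r + 3"
    by (simp only: top_row)
  moreover have "star_rep (if k < r + 3 then std_rep else dual_rep) (if k < r + 3 then 1 else 2)
      (if k < r + 3 then std_wt else dual_wt)" for k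
    using star_rep_std star_rep_dual by (cases "k < r + 3") (simp_all only: if_True if_False)
  ultimately show ?thesis
    using star_rep_tensor[of "2 * r + 3" "\<lambda>k. if k < r + 3 then std_rep else dual_rep"
        "\<lambda>k. if k < r + 3 then 1 else 2" "\<lambda>k. if k < r + 3 then std_wt else dual_wt"]
    unfolding slot_rep_def slot_wt_def by metis
qed

text \<open>Under \<open>pull\<close>, covector coordinates transform by the standard representation
  and vector coordinates by its dual, so the first \<open>r + 3\<close> slots hold letters of the
  covector.\<close>

definition slot_fun :: "nat \<Rightarrow> (nat \<Rightarrow> 3) \<Rightarrow> (complex^3) \<times> (complex^3) \<Rightarrow> complex"
  where "slot_fun r I z = (if z \<in> flag_cone then \<Prod>k<2 * r + 3. (if k < r + 3 then snd z else fst z) $ I k else 0)"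

lemma idx_slot_rep: "idx (slot_rep r) = {..<2 * r + 3} \<rightarrow>\<^sub>E UNIV"
proof -
  have "idx (if k < r + 3 then std_rep else dual_rep) = UNIV" for k by (simp add: std_rep_def dual_rep_def)
  then show ?thesis by (simp add: slot_rep_def tensor_rep_def)
qed

lemma pull_slot_fun:
  assumes G: "G \<in> SL3"
  shows "pull G (slot_fun r I') = (\<Sum>I\<in>idx (slot_rep r). fscale (entry (slot_rep r) G I I') (slot_fun r I))"
proof
  fix z :: "(complex^3) \<times> (complex^3)"
  let ?R = "\<lambda>k. if k < r + 3 then std_rep else dual_rep"
  let ?z = "\<lambda>k. if k < r + 3 then snd z else fst z"
  show "pull G (slot_fun r I') z = (\<Sum>I\<in>idx (slot_rep r). fscale (entry (slot_rep r) G I I') (slot_fun r I)) z"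
  proof (cases "z \<in> flag_cone")
    case False
    then show ?thesis using pair_act_cone[OF SL3_adj3[OF G], of z]
      by (simp add: pull_def slot_fun_def sum_fun_apply fscale_apply)
  next
    case True
    have "(\<Prod>k<2 * r + 3. (if k < r + 3 then snd (pair_act (adj3 G) z) else fst (pair_act (adj3 G) z)) $ I' k)
      = (\<Prod>k<2 * r + 3. \<Sum>c\<in>UNIV. entry (?R k) G c (I' k) * ?z k $ c)"
      by (intro prod.cong refl)
         (simp add: pair_act_simps adj3_adj3[OF G] sum_3 std_rep_def dual_rep_def mult.commute)
    also have "\<dots> = (\<Sum>I\<in>{..<2 * r + 3} \<rightarrow>\<^sub>E UNIV. \<Prod>k<2 * r + 3. entry (?R k) G (I k) (I' k) * ?z k $ I k)"
      by (rule prod_sum_PiE) auto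
    finally show ?thesis using True pair_act_cone[OF SL3_adj3[OF G], of z]
      unfolding idx_slot_rep
      by (simp add: pull_def slot_fun_def sum_fun_apply fscale_apply prod.distrib)
         (simp add: slot_rep_def tensor_rep_def)
  qed
qed

lemma prod_lessThan_add: "(\<Prod>k<a + b. f k) = (\<Prod>k<a. f k) * (\<Prod>k<b. f (a + k))" for f :: "nat \<Rightarrow> complex"
  by (induction b) (simp_all add: mult_ac)

lemma slot_fun_span: "cone_funs (r + 3) r = fun_space.span (slot_fun r ` idx (slot_rep r))"
proof -
  have e: "slot_fun r I z = (if z \<in> flag_cone then (\<Prod>k<r + 3. snd z $ I k) * (\<Prod>k<r. fst z $ I (r + 3 + k)) else 0)" for I z
    using prod_lessThan_add[where a = "r + 3" and b = r and f = "\<lambda>k. (if k < r + 3 then snd z else fst z) $ I k"]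
    unfolding top_row slot_fun_def by simp
  have "(\<lambda>i z. if z \<in> flag_cone then index_fun (r + 3) r i z else 0) ` indices (r + 3) r = slot_fun r ` idx (slot_rep r)"
  proof (intro subset_antisym image_subsetI)
    fix i assume "i \<in> indices (r + 3) r"
    then obtain I J where i: "i = (I, J)" by auto
    let ?K = "restrict (\<lambda>k. if k < r + 3 then I k else J (k - (r + 3))) {..<2 * r + 3}"
    have "(\<lambda>z. if z \<in> flag_cone then index_fun (r + 3) r i z else 0) = slot_fun r ?K"
      by (intro ext) (simp add: e i index_fun_def)
    moreover have "?K \<in> idx (slot_rep r)" by (simp add: idx_slot_rep)
    ultimately show "(\<lambda>z. if z \<in> flag_cone then index_fun (r + 3) r i z else 0) \<in> slot_fun r ` idx (slot_rep r)"
      by (rule image_eqI)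
  next
    fix K assume "K \<in> idx (slot_rep r)"
    let ?i = "(restrict K {..<r + 3}, restrict (\<lambda>k. K (r + 3 + k)) {..<r})"
    have "slot_fun r K = (\<lambda>z. if z \<in> flag_cone then index_fun (r + 3) r ?i z else 0)"
      by (intro ext) (simp add: e index_fun_def)
    moreover have "?i \<in> indices (r + 3) r" by simp
    ultimately show "slot_fun r K \<in> (\<lambda>i z. if z \<in> flag_cone then index_fun (r + 3) r i z else 0) ` indices (r + 3) r"
      by (rule image_eqI)
  qed
  then show ?thesis unfolding cone_funs_indices by simp
qed

definition shift :: "complex^3^3 \<Rightarrow> (config \<Rightarrow> complex) \<Rightarrow> config \<Rightarrow> complex"
  where "shift G f = (\<lambda>z. f (SL3_act (adj3 G) z))"

lemma linear_shift: "Vector_Spaces.linear fscale fscale (shift G)"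
  by (rule fscale_linearI) (simp_all add: shift_def fun_eq_iff fscale_apply)

definition multi_wt :: "nat \<Rightarrow> (nat \<Rightarrow> nat) \<Rightarrow> (nat \<Rightarrow> nat \<times> nat \<times> nat) \<Rightarrow> nat \<times> nat \<times> nat"
  where "multi_wt n r = tensor_wt n (\<lambda>i. gt_weight (2 * r i + 3) (r i) 0)"

lemma gt_weight_deg: "\<tau> \<in> gt l1 l2 l3 \<Longrightarrow> wt_deg (gt_weight l1 l2 l3 \<tau>) = l1 + l2 + l3"
  by (auto simp: gt_def gt_weight_def wt_deg_def)

lemma shift_std:
  assumes t: "x * y * z = 1" and \<tau>: "\<tau> \<in> (\<Pi>\<^sub>E i\<in>{..<n}. gt (2 * r i + 3) (r i) 0)"
  shows "shift (diagm x y z) (prod_family n (\<lambda>i. std_fun (r i + 3) (r i)) \<tau>) =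
    fscale (wt_char (multi_wt n r \<tau>) (x, y, z)) (prod_family n (\<lambda>i. std_fun (r i + 3) (r i)) \<tau>)"
proof
  fix w
  let ?d = "diagm x y z"
  have d: "?d \<in> SL3" using t by simp
  have "(\<Prod>i<n. std_fun (r i + 3) (r i) (\<tau> i) (pair_act (adj3 ?d) (w i))) =
    (\<Prod>i<n. wt_char (gt_weight (2 * r i + 3) (r i) 0 (\<tau> i)) (x, y, z) * std_fun (r i + 3) (r i) (\<tau> i) (w i))"
  proof (intro prod.cong refl)
    fix i assume "i \<in> {..<n}"
    then have "\<tau> i \<in> gt (2 * r i + 3) (r i) 0" using \<tau> by auto
    then have "pull ?d (std_fun (r i + 3) (r i) (\<tau> i)) =
        fscale (wt_char (gt_weight (2 * r i + 3) (r i) 0 (\<tau> i)) (x, y, z)) (std_fun (r i + 3) (r i) (\<tau> i))"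
      using std_fun_weight[OF t, of "\<tau> i" "r i + 3" "r i"] unfolding top_row by blast
    from fun_cong[OF this, of "w i"]
    show "std_fun (r i + 3) (r i) (\<tau> i) (pair_act (adj3 ?d) (w i)) =
      wt_char (gt_weight (2 * r i + 3) (r i) 0 (\<tau> i)) (x, y, z) * std_fun (r i + 3) (r i) (\<tau> i) (w i)"
      by (simp only: pull_def fscale_apply)
  qed
  then show "shift ?d (prod_family n (\<lambda>i. std_fun (r i + 3) (r i)) \<tau>) w =
    fscale (wt_char (multi_wt n r \<tau>) (x, y, z)) (prod_family n (\<lambda>i. std_fun (r i + 3) (r i)) \<tau>) w"
    using SL3_act_M_iff[OF SL3_adj3[OF d], of w n]
    by (simp add: shift_def prod_fun_def fscale_apply multi_wt_def wt_char_tensor prod.distrib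
        SL3_act_pair_act[OF SL3_adj3[OF d]])
qed

text \<open>The functions \<open>slot_fun\<close> satisfy relations, so the map
  \<open>\<Phi>\<close> from the tensor product to \<open>multi_funs n r\<close> has a kernel
  \<open>K\<close>. The orthogonal complement \<open>S\<close> of \<open>K\<close> is invariant and
  is mapped isomorphically. Decomposing \<open>S\<close> yields a second weight basis of
  \<open>multi_funs n r\<close>, to be compared with the standard monomials.\<close>

lemma inv_funs_multiplicity:
  obtains \<Lambda> where
    "\<And>l1 l2 l3. (l1, l2, l3) \<in> set \<Lambda> \<Longrightarrow> l3 \<le> l2 \<and> l2 \<le> l1 \<and> l1 + l2 + l3 = (\<Sum>i<n. 3 * r i + 3)"
    "\<And>\<mu>. card {\<tau> \<in> (\<Pi>\<^sub>E i\<in>{..<n}. gt (2 * r i + 3) (r i) 0). multi_wt n r \<tau> = \<mu>} =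
      card {j \<in> hw_family \<Lambda>. (case j of (i, \<tau>) \<Rightarrow> hw_wt (\<Lambda> ! i) \<tau>) = \<mu>}"
    "fun_space.dim (inv_funs n r) = length (filter (\<lambda>(l1, l2, l3). l1 = l2 \<and> l2 = l3) \<Lambda>)"
proof -
  define T where "T = tensor_rep n (\<lambda>i. slot_rep (r i))"
  let ?D = "\<Sum>i<n. 3 * r i + 3"
  let ?w = "tensor_wt n (\<lambda>i. slot_wt (r i))"
  have star: "star_rep T ?D ?w" unfolding T_def by (rule star_rep_tensor) (rule star_rep_slot)
  note C = star_rep_cont_rep[OF star]
  have fin1: "finite (idx (slot_rep k))" for k by (simp add: idx_slot_rep finite_PiE)
  have idx: "idx T = (\<Pi>\<^sub>E i\<in>{..<n}. idx (slot_rep (r i)))" by (simp add: T_def tensor_rep_def)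
  have fin: "finite (idx T)" by (rule cont_repD(1)[OF C])
  let ?g = "\<lambda>i. slot_fun (r i)"
  define \<Phi> where "\<Phi> u = (\<Sum>J\<in>idx T. fscale (u J) (prod_family n ?g J))" for u
  have lin: "Vector_Spaces.linear fscale fscale \<Phi>"
    by (rule fscale_linearI)
       (simp_all add: \<Phi>_def fun_eq_iff sum_fun_apply fscale_apply algebra_simps sum.distrib sum_distrib_left)
  have span: "multi_funs n r = fun_space.span (prod_family n ?g ` idx T)"
    unfolding idx by (rule prod_family_span[symmetric]) (auto simp: fin1 slot_fun_span)
  have \<Phi>_mem: "\<Phi> u \<in> multi_funs n r" for u unfolding \<Phi>_def span by (rule fam_in_span)
  have \<Phi>_act: "\<Phi> (rep_act T G u) = shift G (\<Phi> u)" if G: "G \<in> SL3" for G u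
  proof
    fix z
    show "\<Phi> (rep_act T G u) z = shift G (\<Phi> u) z"
    proof (cases "z \<in> M_variety n")
      case True
      show ?thesis unfolding \<Phi>_def shift_def T_def
        by (rule prod_map_act[OF fin1 pull_slot_fun[OF G] G True])
    next
      case False
      then have "SL3_act (adj3 G) z \<notin> M_variety n" using SL3_act_M_iff[OF SL3_adj3[OF G]] by simp
      then show ?thesis using False multi_funs_zero[OF \<Phi>_mem] by (simp add: shift_def)
    qed
  qed
  define K where "K = {u \<in> rep_space T. \<Phi> u = 0}"
  define S where "S = {u \<in> rep_space T. \<forall>z\<in>K. cinner (idx T) z u = 0}"
  have subR: "fun_space.subspace (rep_space T)" unfolding rep_space_supported by (rule subspace_supported)
  have subK: "fun_space.subspace K"
    using subR unfolding K_def fun_space.subspace_def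
    by (simp add: fun_pair.linear_0[OF lin] fun_pair.linear_add[OF lin] fun_pair.linear_scale[OF lin])
  have invK: "rep_act T G u \<in> K" if "G \<in> SL3" "u \<in> K" for G u
    using that \<Phi>_act[OF that(1), of u] fun_pair.linear_0[OF linear_shift, of G] by (simp add: K_def rep_act_closed)
  have subS: "fun_space.subspace S"
    using subR unfolding S_def fun_space.subspace_def by (simp add: cinner_simps)
  have invS: "rep_act T G u \<in> S" if G: "G \<in> SL3" and u: "u \<in> S" for G u
    unfolding S_def
  proof (intro CollectI conjI ballI rep_act_closed)
    fix z assume z: "z \<in> K"
    have "cinner (idx T) z (rep_act T G u) = cinner (idx T) (rep_act T (hadj G) z) u"
      by (rule star_rep_adjoint[OF star G, symmetric])
    then show "cinner (idx T) z (rep_act T G u) = 0" using invK[OF hadj_SL3[OF G] z] u by (simp add: S_def)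
  qed
  have S: "invariant_subspace T S" using subS invS by (auto simp: invariant_subspace_def S_def)
  have inj: "u = 0" if u: "u \<in> S" "\<Phi> u = 0" for u
  proof
    fix J
    have "u \<in> K" using u by (simp add: K_def S_def)
    then have "cinner (idx T) u u = 0" using u by (simp add: S_def)
    then show "u J = 0 J"
      using cinner_self_eq_0[OF fin] u by (cases "J \<in> idx T") (auto simp: S_def rep_space_def)
  qed
  have im: "\<Phi> ` S = multi_funs n r"
  proof (intro subset_antisym subsetI)
    fix f assume "f \<in> multi_funs n r"
    then obtain c where c: "f = (\<Sum>J\<in>idx T. fscale (c J) (prod_family n ?g J))"
      unfolding span by (rule span_fam[OF fin])
    define u where "u = (\<lambda>J. if J \<in> idx T then c J else 0)"
    have uR: "u \<in> rep_space T" by (simp add: u_def rep_space_def)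
    have f: "f = \<Phi> u" unfolding c \<Phi>_def by (rule sum.cong) (auto simp: u_def)
    \<comment> \<open>Subtracting the projection to \<open>K\<close> leaves the image under
      \<open>\<Phi>\<close> unchanged and lands in \<open>S\<close>.\<close>
    have "K \<subseteq> supported (idx T)" by (auto simp: K_def rep_space_supported)
    then obtain y where y: "y \<in> K" "\<And>z. z \<in> K \<Longrightarrow> cinner (idx T) z (u - y) = 0"
      using orth_proj[OF fin subK, of u] by blast
    have "u - y \<in> S" using y uR fun_space.subspace_diff[OF subR] by (simp add: S_def K_def)
    moreover have "\<Phi> (u - y) = f" using y(1) by (simp add: f K_def fun_pair.linear_diff[OF lin])
    ultimately show "f \<in> \<Phi> ` S" by blast
  qed (use \<Phi>_mem in auto)
  have fixed: "\<Phi> ` fixed_vectors T S = inv_funs n r"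
  proof (intro subset_antisym subsetI)
    fix f assume "f \<in> \<Phi> ` fixed_vectors T S"
    then obtain u where u: "f = \<Phi> u" "u \<in> S" "\<And>G. G \<in> SL3 \<Longrightarrow> rep_act T G u = u"
      by (auto simp: fixed_vectors_def)
    have "f (SL3_act G z) = f z" if G: "G \<in> SL3" for G z
    proof -
      have "shift (adj3 G) f = f" using \<Phi>_act[OF SL3_adj3[OF G], of u] u(3)[OF SL3_adj3[OF G]] by (simp add: u(1))
      then have "shift (adj3 G) f z = f z" by (rule fun_cong)
      then show ?thesis by (simp add: shift_def adj3_adj3[OF G])
    qed
    then show "f \<in> inv_funs n r" using \<Phi>_mem by (simp add: inv_funs_def u(1))
  next
    fix f assume f: "f \<in> inv_funs n r"
    then have "f \<in> \<Phi> ` S" by (simp add: im inv_funs_def)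
    then obtain u where u: "u \<in> S" "f = \<Phi> u" by blast
    have "rep_act T G u = u" if G: "G \<in> SL3" for G
    proof -
      have "shift G f = f"
      proof
        fix z
        show "shift G f z = f z"
        proof (cases "z \<in> M_variety n")
          case True
          then show ?thesis using f SL3_adj3[OF G] by (simp add: shift_def inv_funs_def)
        next
          case False
          then have "SL3_act (adj3 G) z \<notin> M_variety n" using SL3_act_M_iff[OF SL3_adj3[OF G]] by simp
          then show ?thesis using False multi_funs_zero[of f n r] f by (simp add: shift_def inv_funs_def)
        qed
      qed
      then have "\<Phi> (rep_act T G u - u) = 0" using \<Phi>_act[OF G, of u] u(2) by (simp add: fun_pair.linear_diff[OF lin])
      then have "rep_act T G u - u = 0"
        using inj fun_space.subspace_diff[OF subS invS[OF G u(1)] u(1)] by blast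
      then show ?thesis by simp
    qed
    then show "f \<in> \<Phi> ` fixed_vectors T S" using u by (auto simp: fixed_vectors_def)
  qed
  obtain \<Lambda> g where "decomposes T ?D S \<Lambda> g"
    using star_decomposition[OF star S] by blast
  note \<Lambda> = this[unfolded decomposes_def, THEN conjunct1]
    this[unfolded decomposes_def, THEN conjunct2, THEN conjunct1]
    this[unfolded decomposes_def, THEN conjunct2, THEN conjunct2, THEN conjunct1]
    this[unfolded decomposes_def, THEN conjunct2, THEN conjunct2, THEN conjunct2]
  have "S \<subseteq> supported (idx T)" by (auto simp: S_def rep_space_supported)
  then have "fixed_vectors T S \<subseteq> fun_space.span (unit_fun ` idx T)"
    using supported_span[OF fin] by (auto simp: fixed_vectors_def)
  then have dim: "fun_space.dim (inv_funs n r) = fun_space.dim (fixed_vectors T S)"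
    unfolding fixed[symmetric]
    by (rule dim_linear_image[OF fixed_vectors_subspace[OF subS] _ finite_imageI[OF fin] lin])
       (auto intro: inj simp: fixed_vectors_def)
  have basis: "is_basis (hw_family \<Lambda>) (\<lambda>j. \<Phi> (g j)) (multi_funs n r)"
    using is_basis_image[OF \<Lambda>(2) lin inj] unfolding im by blast
  \<comment> \<open>The standard monomials and the images of the decomposed basis are weight bases
    of the same space, with all weights of degree \<open>?D\<close>; hence torus characters
    determine the weights.\<close>
  have count: "card {\<tau> \<in> (\<Pi>\<^sub>E i\<in>{..<n}. gt (2 * r i + 3) (r i) 0). multi_wt n r \<tau> = \<mu>} =
      card {j \<in> hw_family \<Lambda>. (case j of (i, \<tau>) \<Rightarrow> hw_wt (\<Lambda> ! i) \<tau>) = \<mu>}" for \<mu>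
  proof (rule weight_count[OF std_multi_basis basis,
        where L = "\<lambda>(x, y, z). shift (diagm x y z)" and T = "{(x, y, z). x * y * z = 1}" and ch = wt_char])
    fix t :: "complex \<times> complex \<times> complex" and \<tau>
    assume t: "t \<in> {(x, y, z). x * y * z = 1}" and \<tau>: "\<tau> \<in> (\<Pi>\<^sub>E i\<in>{..<n}. gt (2 * r i + 3) (r i) 0)"
    obtain x y z where xyz: "t = (x, y, z)" by (cases t) auto
    show "(case t of (x, y, z) \<Rightarrow> shift (diagm x y z)) (prod_family n (\<lambda>i. std_fun (r i + 3) (r i)) \<tau>) =
      fscale (wt_char (multi_wt n r \<tau>) t) (prod_family n (\<lambda>i. std_fun (r i + 3) (r i)) \<tau>)"
      using shift_std[OF _ \<tau>, of x y z] t by (simp add: xyz)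
  next
    fix t :: "complex \<times> complex \<times> complex" and j
    assume t: "t \<in> {(x, y, z). x * y * z = 1}" and j: "j \<in> hw_family \<Lambda>"
    obtain x y z where xyz: "t = (x, y, z)" by (cases t) auto
    obtain i \<tau> where i: "j = (i, \<tau>)" by (cases j) auto
    have p: "x * y * z = 1" using t xyz by simp
    then have d: "diagm x y z \<in> SL3" by simp
    have "shift (diagm x y z) (\<Phi> (g (i, \<tau>))) = \<Phi> (rep_act T (diagm x y z) (g (i, \<tau>)))"
      by (rule \<Phi>_act[OF d, symmetric])
    also have "rep_act T (diagm x y z) (g (i, \<tau>)) = fscale (wt_char (hw_wt (\<Lambda> ! i) \<tau>) (x, y, z)) (g (i, \<tau>))"
      using \<Lambda>(3) j p unfolding i by blast
    finally show "(case t of (x, y, z) \<Rightarrow> shift (diagm x y z)) (\<Phi> (g j)) =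
      fscale (wt_char (case j of (i, \<tau>) \<Rightarrow> hw_wt (\<Lambda> ! i) \<tau>) t) (\<Phi> (g j))"
      by (simp only: xyz i fun_pair.linear_scale[OF lin] prod.case)
  next
    fix \<tau> j assume \<tau>: "\<tau> \<in> (\<Pi>\<^sub>E i\<in>{..<n}. gt (2 * r i + 3) (r i) 0)" and j: "j \<in> hw_family \<Lambda>"
      and eq: "\<And>t. t \<in> {(x, y, z). x * y * z = 1} \<Longrightarrow> wt_char (multi_wt n r \<tau>) t =
        wt_char (case j of (i, \<tau>) \<Rightarrow> hw_wt (\<Lambda> ! i) \<tau>) t"
    obtain i \<sigma> where i: "j = (i, \<sigma>)" by (cases j) auto
    obtain l1 l2 l3 where l: "\<Lambda> ! i = (l1, l2, l3)" by (cases "\<Lambda> ! i") auto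
    have il: "i < length \<Lambda>" "\<sigma> \<in> gt (l1 - l3) (l2 - l3) 0" using j by (auto simp: hw_family_def i l)
    have "(l1, l2, l3) \<in> set \<Lambda>" using il(1) l by (metis nth_mem)
    then have ll: "l3 \<le> l2" "l2 \<le> l1" "l1 + l2 + l3 = ?D" using \<Lambda>(1) by auto
    have "wt_deg (multi_wt n r \<tau>) = ?D"
      unfolding multi_wt_def wt_deg_tensor
    proof (intro sum.cong refl)
      fix i assume "i \<in> {..<n}"
      then have "\<tau> i \<in> gt (2 * r i + 3) (r i) 0" using \<tau> by auto
      then show "wt_deg (gt_weight (2 * r i + 3) (r i) 0 (\<tau> i)) = 3 * r i + 3" by (simp add: gt_weight_deg)
    qed
    moreover have "wt_deg (hw_wt (l1, l2, l3) \<sigma>) = ?D"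
      using gt_weight_deg[OF il(2)] ll by (simp add: hw_wt_def wt_deg_def split: prod.splits)
    ultimately show "multi_wt n r \<tau> = (case j of (i, \<tau>) \<Rightarrow> hw_wt (\<Lambda> ! i) \<tau>)"
      using eq by (intro wt_char_separates) (auto simp: i l)
  qed (auto simp: linear_shift)
  show thesis
    by (rule that[of \<Lambda>]) (use \<Lambda>(1,4) count dim in auto)
qed

section \<open>Schur polynomials\<close>

definition wt_monom :: "nat \<times> nat \<times> nat \<Rightarrow> nat \<Rightarrow>\<^sub>0 nat"
  where "wt_monom = (\<lambda>(a, b, c). Poly_Mapping.single 1 a + Poly_Mapping.single 2 b + Poly_Mapping.single 3 c)"

lemma wt_monom_inj: "wt_monom \<mu> = wt_monom \<nu> \<longleftrightarrow> \<mu> = \<nu>"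
proof
  assume e: "wt_monom \<mu> = wt_monom \<nu>"
  have "Poly_Mapping.lookup (wt_monom (a, b, c)) 1 = a" "Poly_Mapping.lookup (wt_monom (a, b, c)) 2 = b"
    "Poly_Mapping.lookup (wt_monom (a, b, c)) 3 = c" for a b c
    by (simp_all add: wt_monom_def lookup_add lookup_single)
  then show "\<mu> = \<nu>" using e by (cases \<mu>; cases \<nu>) metis
qed simp

lemma single_sum: "Poly_Mapping.single k (\<Sum>i\<in>A. f i) = (\<Sum>i\<in>A. Poly_Mapping.single k (f i))"
  by (induction A rule: infinite_finite_induct) (simp_all add: single_add)

lemma wt_monom_tensor: "wt_monom (tensor_wt n w I) = (\<Sum>i<n. wt_monom (w i (I i)))"
  by (simp add: wt_monom_def tensor_wt_def split_beta single_sum sum.distrib)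

lemma sum_single_const: "finite A \<Longrightarrow> (\<Sum>j\<in>A. Poly_Mapping.single k (1::nat)) = Poly_Mapping.single k (card A)"
  by (induction A rule: finite_induct) (simp_all add: single_add[symmetric])

text \<open>Applied to a weakly increasing row: the entries bounded by a given value fill an initial
  segment, whose length is their number.\<close>

lemma down_closed_card:
  assumes "\<And>i j. i \<le> j \<Longrightarrow> j < l \<Longrightarrow> P j \<Longrightarrow> P i" "j < (l::nat)"
  shows "P j \<longleftrightarrow> j < card {j. j < l \<and> P j}"
proof -
  define m where "m = (LEAST m. m = l \<or> \<not> P m)"
  have m: "m = l \<or> \<not> P m" unfolding m_def by (rule LeastI[of _ l]) simp
  have ml: "m \<le> l" unfolding m_def by (rule Least_le) simp
  have lt: "P i" if "i < m" for i using not_less_Least[of i "\<lambda>m. m = l \<or> \<not> P m"] that by (simp add: m_def)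
  have "{j. j < l \<and> P j} = {..<m}"
  proof (intro subset_antisym subsetI)
    fix i assume i: "i \<in> {j. j < l \<and> P j}"
    show "i \<in> {..<m}"
    proof (rule ccontr)
      assume "i \<notin> {..<m}"
      then have "m \<le> i" by simp
      then have "P m" "m \<noteq> l" using assms(1)[of m i] i by auto
      then show False using m by blast
    qed
  qed (use lt ml in auto)
  moreover have "P j \<longleftrightarrow> j < m"
    using lt m assms(1)[of m j] assms(2) by (metis linorder_not_less order_le_less_trans order_less_irrefl)
  ultimately show ?thesis by simp
qed

lemma cells_3: "cells [l1, l2, l3] = Pair 0 ` {..<l1} \<union> Pair 1 ` {..<l2} \<union> Pair 2 ` {..<l3}"
proof (rule set_eqI)
  fix c :: "nat \<times> nat"
  obtain i j where c: "c = (i, j)" by (cases c) auto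
  consider "i = 0" | "i = 1" | "i = 2" | "i \<ge> 3" by linarith
  then show "c \<in> cells [l1, l2, l3] \<longleftrightarrow> c \<in> Pair 0 ` {..<l1} \<union> Pair 1 ` {..<l2} \<union> Pair 2 ` {..<l3}"
    by cases (auto simp: c cells_def)
qed

lemma mem_cells_3 [simp]:
  "(i, j) \<in> cells [l1, l2, l3] \<longleftrightarrow> i = 0 \<and> j < l1 \<or> i = 1 \<and> j < l2 \<or> i = 2 \<and> j < l3"
  by (auto simp: cells_3)

text \<open>In a semistandard tableau with entries in \<open>{1, 2, 3}\<close>, \<open>s\<close> and \<open>p\<close> count the entries \<open>\<le> 1\<close>
  and \<open>\<le> 2\<close> of the first row, \<open>q\<close> those \<open>\<le> 2\<close> of the second.\<close>

definition gt_tableau :: "nat \<Rightarrow> nat \<Rightarrow> nat \<Rightarrow> nat \<times> nat \<times> nat \<Rightarrow> nat \<times> nat \<Rightarrow> nat"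
  where "gt_tableau l1 l2 l3 = (\<lambda>(s, p, q). restrict (\<lambda>(i, j).
    if i = 0 then (if j < s then 1 else if j < p then 2 else 3)
    else if i = 1 then (if j < q then 2 else 3) else 3) (cells [l1, l2, l3]))"

definition tableau_gt :: "nat \<Rightarrow> nat \<Rightarrow> (nat \<times> nat \<Rightarrow> nat) \<Rightarrow> nat \<times> nat \<times> nat"
  where "tableau_gt l1 l2 T = (card {j. j < l1 \<and> T (0, j) \<le> 1}, card {j. j < l1 \<and> T (0, j) \<le> 2},
    card {j. j < l2 \<and> T (1, j) \<le> 2})"

text \<open>The interlacing inequalities come from strict columns: a cell in the third row forces an
  entry at most 2 above it, a cell in the second row does so for the first, and a 2 in the second
  row forces a 1 above it. Each is tested at the first column that would violate it.\<close>

lemma gt_tableau_inverse: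
  assumes l: "l3 \<le> l2" "l2 \<le> l1" and T: "T \<in> semistandard_tableaux [l1, l2, l3]"
  shows "tableau_gt l1 l2 T \<in> gt l1 l2 l3" "gt_tableau l1 l2 l3 (tableau_gt l1 l2 T) = T"
proof -
  have ext: "T \<in> cells [l1, l2, l3] \<rightarrow>\<^sub>E {1, 2, 3}"
    and row: "\<And>i j. (i, j) \<in> cells [l1, l2, l3] \<Longrightarrow> (i, Suc j) \<in> cells [l1, l2, l3] \<Longrightarrow> T (i, j) \<le> T (i, Suc j)"
    and col: "\<And>i j. (i, j) \<in> cells [l1, l2, l3] \<Longrightarrow> (Suc i, j) \<in> cells [l1, l2, l3] \<Longrightarrow> T (i, j) < T (Suc i, j)"
    using T by (auto simp: semistandard_tableaux_def)
  have vals: "T (i, j) = 1 \<or> T (i, j) = 2 \<or> T (i, j) = 3" if "(i, j) \<in> cells [l1, l2, l3]" for i j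
    using PiE_mem[OF ext that] by auto
  have mono0: "T (0, i) \<le> T (0, j)" if "i \<le> j" "j < l1" for i j
    using that by (induction rule: dec_induct) (auto intro: order_trans[OF _ row])
  have mono1: "T (1, i) \<le> T (1, j)" if "i \<le> j" "j < l2" for i j
    using that by (induction rule: dec_induct) (auto intro: order_trans[OF _ row])
  define s p q where spq: "s = card {j. j < l1 \<and> T (0, j) \<le> 1}" "p = card {j. j < l1 \<and> T (0, j) \<le> 2}"
    "q = card {j. j < l2 \<and> T (1, j) \<le> 2}"
  have s: "T (0, j) \<le> 1 \<longleftrightarrow> j < s" if "j < l1" for j
    unfolding spq by (rule down_closed_card[OF _ that]) (use mono0 order_trans in blast)
  have p: "T (0, j) \<le> 2 \<longleftrightarrow> j < p" if "j < l1" for j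
    unfolding spq by (rule down_closed_card[OF _ that]) (use mono0 order_trans in blast)
  have q: "T (1, j) \<le> 2 \<longleftrightarrow> j < q" if "j < l2" for j
    unfolding spq by (rule down_closed_card[OF _ that]) (use mono1 order_trans in blast)
  have bounds: "p \<le> l1" "q \<le> l2" "s \<le> p"
  proof -
    have "card {j. j < l1 \<and> T (0, j) \<le> 2} \<le> card {..<l1}" by (rule card_mono) auto
    then show "p \<le> l1" by (simp add: spq)
    have "card {j. j < l2 \<and> T (1, j) \<le> 2} \<le> card {..<l2}" by (rule card_mono) auto
    then show "q \<le> l2" by (simp add: spq)
    show "s \<le> p" unfolding spq by (rule card_mono) auto
  qed
  have c01: "T (0, j) < T (1, j)" if "j < l2" for j using col[of 0 j] that l by simp
  have c12: "T (1, j) < T (2, j)" if "j < l3" for j using col[of 1 j] that l by (simp add: numeral_2_eq_2)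
  have q3: "l3 \<le> q"
  proof (rule ccontr)
    assume "\<not> l3 \<le> q"
    then have "q < l3" "q < l2" using l by auto
    then show False using q[of q] c12[of q] vals[of 1 q] vals[of 2 q] by auto
  qed
  have p2: "l2 \<le> p"
  proof (rule ccontr)
    assume "\<not> l2 \<le> p"
    then have "p < l2" "p < l1" using l by auto
    then show False using p[of p] c01[of p] vals[of 0 p] vals[of 1 p] by auto
  qed
  have qs: "q \<le> s"
  proof (rule ccontr)
    assume "\<not> q \<le> s"
    then have "s < q" "s < l2" "s < l1" using bounds l by auto
    then show False using q[of s] s[of s] c01[of s] vals[of 0 s] vals[of 1 s] by auto
  qed
  have e: "tableau_gt l1 l2 T = (s, p, q)" by (simp add: tableau_gt_def spq)
  show "tableau_gt l1 l2 T \<in> gt l1 l2 l3" using bounds q3 p2 qs by (simp add: e gt_def)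
  show "gt_tableau l1 l2 l3 (tableau_gt l1 l2 T) = T"
  proof
    fix c :: "nat \<times> nat"
    obtain i j where c: "c = (i, j)" by (cases c) auto
    show "gt_tableau l1 l2 l3 (tableau_gt l1 l2 T) c = T c"
    proof (cases "c \<in> cells [l1, l2, l3]")
      case False
      then show ?thesis using PiE_arb[OF ext False] by (simp add: gt_tableau_def e)
    next
      case True
      then consider "i = 0" "j < l1" | "i = 1" "j < l2" | "i = 2" "j < l3" by (auto simp: c)
      then show ?thesis
      proof cases
        case 1
        then show ?thesis using s[of j] p[of j] vals[of 0 j] True by (auto simp: gt_tableau_def e c)
      next
        case 2
        then show ?thesis using q[of j] c01[of j] vals[of 0 j] vals[of 1 j] l True by (auto simp: gt_tableau_def e c)
      next
        case 3
        then show ?thesis using c01[of j] c12[of j] vals[of 0 j] vals[of 1 j] vals[of 2 j] l True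
          by (auto simp: gt_tableau_def e c)
      qed
    qed
  qed
qed

lemma gt_tableau_bij:
  assumes l: "l3 \<le> l2" "l2 \<le> l1"
  shows "bij_betw (gt_tableau l1 l2 l3) (gt l1 l2 l3) (semistandard_tableaux [l1, l2, l3])"
proof (rule bij_betwI[where g = "tableau_gt l1 l2"])
  show "gt_tableau l1 l2 l3 \<in> gt l1 l2 l3 \<rightarrow> semistandard_tableaux [l1, l2, l3]"
  proof
    fix \<tau> assume \<tau>: "\<tau> \<in> gt l1 l2 l3"
    obtain s p q where e: "\<tau> = (s, p, q)" by (cases \<tau>) auto
    have c: "l3 \<le> q" "q \<le> l2" "l2 \<le> p" "p \<le> l1" "q \<le> s" "s \<le> p" using \<tau> by (auto simp: e gt_def)
    have mem: "gt_tableau l1 l2 l3 \<tau> \<in> cells [l1, l2, l3] \<rightarrow>\<^sub>E {1, 2, 3}"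
      by (auto simp: gt_tableau_def e split: if_splits)
    show "gt_tableau l1 l2 l3 \<tau> \<in> semistandard_tableaux [l1, l2, l3]"
      unfolding semistandard_tableaux_def
      by (intro CollectI conjI allI impI mem) (use c l in \<open>auto simp: gt_tableau_def e split: if_splits\<close>)
  qed
next
  show "tableau_gt l1 l2 (gt_tableau l1 l2 l3 \<tau>) = \<tau>" if \<tau>: "\<tau> \<in> gt l1 l2 l3" for \<tau>
  proof -
    obtain s p q where e: "\<tau> = (s, p, q)" by (cases \<tau>) auto
    have c: "l3 \<le> q" "q \<le> l2" "l2 \<le> p" "p \<le> l1" "q \<le> s" "s \<le> p" using \<tau> by (auto simp: e gt_def)
    let ?T = "gt_tableau l1 l2 l3 \<tau>"
    have "{j. j < l1 \<and> ?T (0, j) \<le> 1} = {..<s}" "{j. j < l1 \<and> ?T (0, j) \<le> 2} = {..<p}"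
      "{j. j < l2 \<and> ?T (1, j) \<le> 2} = {..<q}"
      using c by (auto simp: gt_tableau_def e split: if_splits)
    then show ?thesis by (simp add: tableau_gt_def e)
  qed
qed (use gt_tableau_inverse[OF l] in auto)

lemma sum_split3: "a \<le> b \<Longrightarrow> b \<le> c \<Longrightarrow> (\<Sum>j<c. f j) = (\<Sum>j\<in>{..<a}. f j) + (\<Sum>j\<in>{a..<b}. f j) + (\<Sum>j\<in>{b..<c}. f j)"
  for f :: "nat \<Rightarrow> 'b::comm_monoid_add"
  using sum.atLeastLessThan_concat[of 0 a b f] sum.atLeastLessThan_concat[of 0 b c f]
  by (simp add: atLeast0LessThan)

lemma gt_tableau_monom:
  assumes "\<tau> \<in> gt l1 l2 l3"
  shows "(\<Sum>c\<in>cells [l1, l2, l3]. Poly_Mapping.single (gt_tableau l1 l2 l3 \<tau> c) 1) = wt_monom (gt_weight l1 l2 l3 \<tau>)"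
proof -
  obtain s p q where e: "\<tau> = (s, p, q)" by (cases \<tau>) auto
  have c: "l3 \<le> q" "q \<le> l2" "l2 \<le> p" "p \<le> l1" "q \<le> s" "s \<le> p" using assms by (auto simp: e gt_def)
  let ?s = "\<lambda>i j. Poly_Mapping.single (gt_tableau l1 l2 l3 \<tau> (i, j)) (1::nat)"
  have "(\<Sum>c\<in>cells [l1, l2, l3]. Poly_Mapping.single (gt_tableau l1 l2 l3 \<tau> c) (1::nat)) =
      (\<Sum>j<l1. ?s 0 j) + (\<Sum>j<l2. ?s 1 j) + (\<Sum>j<l3. ?s 2 j)"
    unfolding cells_3
    by (subst sum.union_disjoint, simp, simp, force)+ (simp add: sum.reindex inj_on_def)
  also have "(\<Sum>j<l1. ?s 0 j) = Poly_Mapping.single 1 s + Poly_Mapping.single 2 (p - s) + Poly_Mapping.single 3 (l1 - p)"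
  proof -
    have eqs: "(\<Sum>j\<in>{..<s}. ?s 0 j) = (\<Sum>j\<in>{..<s}. Poly_Mapping.single 1 1)"
      "(\<Sum>j\<in>{s..<p}. ?s 0 j) = (\<Sum>j\<in>{s..<p}. Poly_Mapping.single 2 1)"
      "(\<Sum>j\<in>{p..<l1}. ?s 0 j) = (\<Sum>j\<in>{p..<l1}. Poly_Mapping.single 3 1)"
      by (rule sum.cong; use c in \<open>auto simp: gt_tableau_def e\<close>)+
    show ?thesis
      unfolding sum_split3[OF c(6) c(4)] eqs sum_single_const[OF finite_lessThan]
        sum_single_const[OF finite_atLeastLessThan] by simp
  qed
  also have "(\<Sum>j<l2. ?s 1 j) = Poly_Mapping.single 2 q + Poly_Mapping.single 3 (l2 - q)"
  proof -
    have eqs: "(\<Sum>j\<in>{..<q}. ?s 1 j) = (\<Sum>j\<in>{..<q}. Poly_Mapping.single 2 1)"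
      "(\<Sum>j\<in>{q..<l2}. ?s 1 j) = (\<Sum>j\<in>{q..<l2}. Poly_Mapping.single 3 1)"
      by (rule sum.cong; use c in \<open>auto simp: gt_tableau_def e\<close>)+
    show ?thesis
      unfolding sum_split3[OF order_refl c(2)] eqs sum_single_const[OF finite_lessThan]
        sum_single_const[OF finite_atLeastLessThan] by simp
  qed
  also have "(\<Sum>j<l3. ?s 2 j) = Poly_Mapping.single 3 l3"
  proof -
    have "(\<Sum>j<l3. ?s 2 j) = (\<Sum>j<l3. Poly_Mapping.single 3 1)"
      by (rule sum.cong) (auto simp: gt_tableau_def e)
    then show ?thesis by (simp only: sum_single_const[OF finite_lessThan] card_lessThan)
  qed
  finally show ?thesis by (simp add: gt_weight_def e wt_monom_def single_add add_ac)
qed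

lemma schur_gt:
  assumes "l3 \<le> l2" "l2 \<le> l1"
  shows "schur [l1, l2, l3] = (\<Sum>\<tau>\<in>gt l1 l2 l3. Poly_Mapping.single (wt_monom (gt_weight l1 l2 l3 \<tau>)) 1)"
  unfolding schur_def
  by (subst sum.reindex_bij_betw[OF gt_tableau_bij[OF assms], symmetric], rule sum.cong[OF refl])
     (simp only: gt_tableau_monom)

text \<open>Lowering all entries of a pattern by \<open>l3\<close> removes the full columns of the
  tableau; \<open>hw_wt\<close> restores their contribution to the weight.\<close>

lemma schur_hw_wt:
  assumes "l3 \<le> l2" "l2 \<le> l1"
  shows "schur [l1, l2, l3] =
    (\<Sum>\<tau>\<in>gt (l1 - l3) (l2 - l3) 0. Poly_Mapping.single (wt_monom (hw_wt (l1, l2, l3) \<tau>)) 1)"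
proof -
  let ?f = "\<lambda>(s, p, q). (s + l3, p + l3, q + l3)"
  have "bij_betw ?f (gt (l1 - l3) (l2 - l3) 0) (gt l1 l2 l3)"
    by (rule bij_betwI[where g = "\<lambda>(s, p, q). (s - l3, p - l3, q - l3)"]) (use assms in \<open>auto simp: gt_def\<close>)
  from sum.reindex_bij_betw[OF this, symmetric]
  show ?thesis unfolding schur_gt[OF assms]
  proof (rule trans, intro sum.cong refl)
    fix \<tau> assume "\<tau> \<in> gt (l1 - l3) (l2 - l3) 0"
    then have "gt_weight l1 l2 l3 (?f \<tau>) = hw_wt (l1, l2, l3) \<tau>"
      by (auto simp: gt_def gt_weight_def hw_wt_def)
    then show "Poly_Mapping.single (wt_monom (gt_weight l1 l2 l3 (?f \<tau>))) 1 =
      Poly_Mapping.single (wt_monom (hw_wt (l1, l2, l3) \<tau>)) (1::int)" by simp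
  qed
qed

section \<open>Independence of Schur polynomials and comparison of coefficients\<close>

definition partition_triples :: "(nat \<times> nat \<times> nat) set"
  where "partition_triples = {(l1, l2, l3). l2 \<le> l1 \<and> l3 \<le> l2}"

definition schur3 :: "nat \<times> nat \<times> nat \<Rightarrow> (nat, int) mpolynomial"
  where "schur3 = (\<lambda>(l1, l2, l3). schur [l1, l2, l3])"

lemma schur_partitions3: "schur ` partitions3 = schur3 ` partition_triples"
proof -
  have e: "partitions3 = (\<lambda>(a, b, c). [a, b, c]) ` partition_triples"
    by (force simp: partitions3_def partition_triples_def)
  show ?thesis unfolding e image_image by (simp add: schur3_def split_beta)
qed

lemma lookup_schur3:
  assumes "l \<in> partition_triples"
  shows "Poly_Mapping.lookup (schur3 l) (wt_monom \<mu>) =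
    int (card {\<tau> \<in> (case l of (l1, l2, l3) \<Rightarrow> gt l1 l2 l3). (case l of (l1, l2, l3) \<Rightarrow> gt_weight l1 l2 l3 \<tau>) = \<mu>})"
proof -
  obtain l1 l2 l3 where l: "l = (l1, l2, l3)" "l3 \<le> l2" "l2 \<le> l1" using assms by (auto simp: partition_triples_def)
  have "Poly_Mapping.lookup (schur3 l) (wt_monom \<mu>) = (\<Sum>\<tau>\<in>gt l1 l2 l3. if gt_weight l1 l2 l3 \<tau> = \<mu> then 1 else 0)"
    by (simp add: l schur3_def schur_gt lookup_sum lookup_single when_def wt_monom_inj eq_commute[of \<mu>])
  also have "\<dots> = int (card {\<tau> \<in> gt l1 l2 l3. gt_weight l1 l2 l3 \<tau> = \<mu>})"
    by (simp add: sum.If_cases Int_def)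
  finally show ?thesis by (simp add: l)
qed

text \<open>A partition of maximal first part, and among these of maximal second part, occurs as a weight only
  in its own Schur polynomial.\<close>

lemma schur3_independent:
  assumes P: "finite P" "P \<subseteq> partition_triples" and 0: "(\<Sum>l\<in>P. frag_cmul (u l) (schur3 l)) = 0" and l: "l \<in> P"
  shows "u l = 0"
proof (rule ccontr)
  assume "u l \<noteq> 0"
  define Q where "Q = {l \<in> P. u l \<noteq> 0}"
  have "l \<in> Q" using l \<open>u l \<noteq> 0\<close> by (simp add: Q_def)
  then have "Q \<noteq> {}" by blast
  moreover have "finite Q" using P(1) by (simp add: Q_def)
  ultimately have Q: "finite Q" "Q \<noteq> {}" by blast+
  define a where "a = Max (fst ` Q)"
  define Q' where "Q' = {l \<in> Q. fst l = a}"
  have "a \<in> fst ` Q" unfolding a_def using Q by (intro Max_in) auto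
  then have Q': "finite Q'" "Q' \<noteq> {}" using Q by (auto simp: Q'_def)
  define b where "b = Max ((\<lambda>l. fst (snd l)) ` Q')"
  have "b \<in> (\<lambda>l. fst (snd l)) ` Q'" unfolding b_def using Q' by (intro Max_in) auto
  then obtain c where c: "(a, b, c) \<in> Q" by (auto simp: Q'_def)
  have a_max: "l1 \<le> a" if "(l1, l2, l3) \<in> Q" for l1 l2 l3
    unfolding a_def using Q that by (intro Max_ge) (auto intro: rev_image_eqI)
  have b_max: "l2 \<le> b" if "(a, l2, l3) \<in> Q" for l2 l3
    unfolding b_def using Q' that by (intro Max_ge) (auto simp: Q'_def intro: rev_image_eqI)
  have cP: "(a, b, c) \<in> partition_triples" "(a, b, c) \<in> P" "u (a, b, c) \<noteq> 0" using c P by (auto simp: Q_def)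
  have other: "Poly_Mapping.lookup (schur3 l) (wt_monom (a, b, c)) = 0" if lQ: "l \<in> Q" "l \<noteq> (a, b, c)" for l
  proof -
    obtain l1 l2 l3 where l: "l = (l1, l2, l3)" by (cases l) auto
    have lP: "l \<in> partition_triples" using lQ P by (auto simp: Q_def)
    have "gt_weight l1 l2 l3 \<tau> \<noteq> (a, b, c)" if \<tau>: "\<tau> \<in> gt l1 l2 l3" for \<tau>
    proof
      assume w: "gt_weight l1 l2 l3 \<tau> = (a, b, c)"
      obtain s p q where t: "\<tau> = (s, p, q)" by (cases \<tau>) auto
      have g: "s = a" "p - s + q = b" "(l1 - p) + (l2 - q) + l3 = c" "q \<le> l2" "p \<le> l1" "s \<le> p"
        using w \<tau> by (auto simp: t gt_weight_def gt_def)
      \<comment> \<open>The chain \<open>a = s \<le> p \<le> l1 \<le> a\<close> collapses, then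
        \<open>b = q \<le> l2 \<le> b\<close> does, and the last weight entry gives the third
        part.\<close>
      have "l1 \<le> a" using a_max lQ(1) l by auto
      then have la: "l1 = a" "p = a" using g by auto
      then have "l2 \<le> b" using b_max lQ(1) l by auto
      then have "l2 = b" "l3 = c" using g la by auto
      then show False using lQ(2) la by (simp add: l)
    qed
    then have "{\<tau> \<in> gt l1 l2 l3. gt_weight l1 l2 l3 \<tau> = (a, b, c)} = {}" by blast
    then show ?thesis using lookup_schur3[OF lP, of "(a, b, c)"] by (simp add: l)
  qed
  have own: "Poly_Mapping.lookup (schur3 (a, b, c)) (wt_monom (a, b, c)) \<noteq> 0"
  proof -
    define X where "X = {\<tau> \<in> gt a b c. gt_weight a b c \<tau> = (a, b, c)}"
    \<comment> \<open>The pattern of highest weight: every row is the row above without its last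
      entry.\<close>
    have "(a, a, b) \<in> X" using cP(1) by (auto simp: X_def partition_triples_def gt_def gt_weight_def)
    moreover have "finite X" unfolding X_def by (rule finite_subset[OF _ finite_gt]) auto
    ultimately have "card X \<noteq> 0" by auto
    then have "card {\<tau> \<in> gt a b c. gt_weight a b c \<tau> = (a, b, c)} \<noteq> 0" unfolding X_def .
    then show ?thesis
      unfolding lookup_schur3[OF cP(1)] prod.case of_nat_eq_0_iff .
  qed
  have "0 = Poly_Mapping.lookup (\<Sum>l\<in>P. frag_cmul (u l) (schur3 l)) (wt_monom (a, b, c))" by (simp add: 0)
  also have "\<dots> = (\<Sum>l\<in>P. u l * Poly_Mapping.lookup (schur3 l) (wt_monom (a, b, c)))" by (simp add: lookup_sum)
  also have "\<dots> = (\<Sum>l\<in>{(a, b, c)}. u l * Poly_Mapping.lookup (schur3 l) (wt_monom (a, b, c)))"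
    by (rule sum.mono_neutral_right) (use P cP other in \<open>auto simp: Q_def\<close>)
  finally show False using own cP(3) by simp
qed

lemma schur3_inj: "inj_on schur3 partition_triples"
proof (rule inj_onI, rule ccontr)
  fix l m assume lm: "l \<in> partition_triples" "m \<in> partition_triples" "schur3 l = schur3 m" "l \<noteq> m"
  have "(\<Sum>k\<in>{l, m}. frag_cmul (if k = l then 1 else -1) (schur3 k)) = 0" using lm by simp
  from schur3_independent[OF _ _ this, of l] lm show False by simp
qed

lemma schur_independent: "int_poly.independent (schur ` partitions3)"
  unfolding schur_partitions3 int_poly.independent_explicit_module
proof (intro allI impI)
  fix t u v assume t: "finite t" "t \<subseteq> schur3 ` partition_triples" "(\<Sum>v\<in>t. frag_cmul (u v) v) = 0" "v \<in> t"
  obtain P where P: "P \<subseteq> partition_triples" "t = schur3 ` P" using t(2) by (rule subset_imageE)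
  have inj: "inj_on schur3 P" using schur3_inj P(1) by (rule inj_on_subset)
  have fin: "finite P" using t(1) P(2) inj by (simp add: finite_image_iff)
  obtain l where l: "l \<in> P" "v = schur3 l" using t(4) P(2) by blast
  have "(\<Sum>l\<in>P. frag_cmul (u (schur3 l)) (schur3 l)) = 0" using t(3) unfolding P(2) by (simp add: sum.reindex[OF inj])
  from schur3_independent[OF fin P(1) this l(1)] show "u v = 0" by (simp add: l(2))
qed

lemma schur_coeff_sum:
  fixes m :: nat
  assumes \<Lambda>: "\<And>i. i < m \<Longrightarrow> \<Lambda> i \<in> partition_triples" and l: "(l1, l2, l3) \<in> partition_triples"
  shows "schur_coeff [l1, l2, l3] (\<Sum>i<m. schur3 (\<Lambda> i)) = int (card {i. i < m \<and> \<Lambda> i = (l1, l2, l3)})"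
proof -
  let ?B = "schur ` partitions3"
  have B: "schur3 (\<Lambda> i) \<in> ?B" if "i < m" for i using \<Lambda>[OF that] by (simp add: schur_partitions3)
  have "int_poly.representation ?B (\<Sum>i<m. schur3 (\<Lambda> i)) = (\<lambda>b. \<Sum>i<m. int_poly.representation ?B (schur3 (\<Lambda> i)) b)"
    by (rule int_poly.representation_sum[OF schur_independent]) (use B in \<open>auto intro: int_poly.span_base\<close>)
  then have "schur_coeff [l1, l2, l3] (\<Sum>i<m. schur3 (\<Lambda> i)) =
      (\<Sum>i<m. int_poly.representation ?B (schur3 (\<Lambda> i)) (schur [l1, l2, l3]))"
    by (simp add: schur_coeff_def)
  also have "\<dots> = (\<Sum>i<m. if \<Lambda> i = (l1, l2, l3) then 1 else 0)"
  proof (intro sum.cong refl)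
    fix i assume "i \<in> {..<m}"
    then have i: "i < m" by simp
    have "schur [l1, l2, l3] = schur3 (\<Lambda> i) \<longleftrightarrow> \<Lambda> i = (l1, l2, l3)"
      using inj_on_eq_iff[OF schur3_inj l \<Lambda>[OF i]] by (auto simp: schur3_def)
    then show "int_poly.representation ?B (schur3 (\<Lambda> i)) (schur [l1, l2, l3]) = (if \<Lambda> i = (l1, l2, l3) then 1 else 0)"
      using int_poly.representation_basis[OF schur_independent B[OF i]] by simp
  qed
  also have "\<dots> = (\<Sum>i\<in>{i \<in> {..<m}. \<Lambda> i = (l1, l2, l3)}. 1)"
    by (rule sum.inter_filter[symmetric]) simp
  finally show ?thesis by simp
qed

lemma prod_single: "(\<Prod>i\<in>A. Poly_Mapping.single (m i) (1::int)) = Poly_Mapping.single (\<Sum>i\<in>A. m i) 1"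
  by (induction A rule: infinite_finite_induct) (simp_all add: mult_single)

lemma prod_schur:
  "(\<Prod>i<n. schur [2 * r i + 3, r i, 0]) =
    (\<Sum>\<tau>\<in>(\<Pi>\<^sub>E i\<in>{..<n}. gt (2 * r i + 3) (r i) 0). Poly_Mapping.single (wt_monom (multi_wt n r \<tau>)) 1)"
proof -
  have "(\<Prod>i<n. schur [2 * r i + 3, r i, 0]) = (\<Prod>i<n. \<Sum>\<tau>\<in>gt (2 * r i + 3) (r i) 0.
      Poly_Mapping.single (wt_monom (gt_weight (2 * r i + 3) (r i) 0 \<tau>)) 1)"
    by (intro prod.cong refl schur_gt) auto
  also have "\<dots> = (\<Sum>\<tau>\<in>(\<Pi>\<^sub>E i\<in>{..<n}. gt (2 * r i + 3) (r i) 0).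
      \<Prod>i<n. Poly_Mapping.single (wt_monom (gt_weight (2 * r i + 3) (r i) 0 (\<tau> i))) 1)"
    by (rule prod_sum_PiE) auto
  finally show ?thesis by (simp add: prod_single multi_wt_def wt_monom_tensor)
qed

lemma sum_eq_of_counts:
  fixes F :: "'w \<Rightarrow> 'r::comm_semiring_1"
  assumes "finite A" "finite B" "\<And>\<mu>. card {a \<in> A. f a = \<mu>} = card {b \<in> B. g b = \<mu>}"
  shows "(\<Sum>a\<in>A. F (f a)) = (\<Sum>b\<in>B. F (g b))"
proof -
  have *: "(\<Sum>a\<in>A. F (f a)) = (\<Sum>\<mu>\<in>C. of_nat (card {a \<in> A. f a = \<mu>}) * F \<mu>)"
    if "finite A" "finite C" "f ` A \<subseteq> C" for A :: "'z set" and f and C :: "'w set"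
  proof -
    have "(\<Sum>a\<in>A. F (f a)) = (\<Sum>\<mu>\<in>C. \<Sum>a\<in>{a \<in> A. f a = \<mu>}. F (f a))"
      by (rule sum.group[symmetric]) (use that in auto)
    then show ?thesis by simp
  qed
  let ?C = "f ` A \<union> g ` B"
  have "(\<Sum>a\<in>A. F (f a)) = (\<Sum>\<mu>\<in>?C. of_nat (card {a \<in> A. f a = \<mu>}) * F \<mu>)"
    "(\<Sum>b\<in>B. F (g b)) = (\<Sum>\<mu>\<in>?C. of_nat (card {b \<in> B. g b = \<mu>}) * F \<mu>)"
    by (rule *; use assms in auto)+
  then show ?thesis by (simp only: assms(3))
qed

text \<open>Equal weight counts turn the product of Schur polynomials into the sum of the Schur
  polynomials of the list \<open>\<Lambda>\<close>. The coefficient of the rectangular shape is then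
  the number of its occurrences in \<open>\<Lambda>\<close>, which is the number of trivial
  summands.\<close>

lemma inv_funs_dim:
  assumes r: "r \<in> compositions n k"
  shows "int (fun_space.dim (inv_funs n r)) = schur_coeff [k + n, k + n, k + n] (\<Prod>i<n. schur [2 * r i + 3, r i, 0])"
proof (rule inv_funs_multiplicity[where n = n and r = r])
  fix \<Lambda> assume \<Lambda>:
    "\<And>l1 l2 l3. (l1, l2, l3) \<in> set \<Lambda> \<Longrightarrow> l3 \<le> l2 \<and> l2 \<le> l1 \<and> l1 + l2 + l3 = (\<Sum>i<n. 3 * r i + 3)"
    "\<And>\<mu>. card {\<tau> \<in> (\<Pi>\<^sub>E i\<in>{..<n}. gt (2 * r i + 3) (r i) 0). multi_wt n r \<tau> = \<mu>} =
      card {j \<in> hw_family \<Lambda>. (case j of (i, \<tau>) \<Rightarrow> hw_wt (\<Lambda> ! i) \<tau>) = \<mu>}"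
    "fun_space.dim (inv_funs n r) = length (filter (\<lambda>(l1, l2, l3). l1 = l2 \<and> l2 = l3) \<Lambda>)"
  have D: "(\<Sum>i<n. 3 * r i + 3) = 3 * (k + n)"
    using r by (simp add: compositions_def sum.distrib sum_distrib_left[symmetric])
  have P: "\<Lambda> ! i \<in> partition_triples" if "i < length \<Lambda>" for i
    using \<Lambda>(1)[of "fst (\<Lambda> ! i)" "fst (snd (\<Lambda> ! i))" "snd (snd (\<Lambda> ! i))"] nth_mem[OF that]
    by (auto simp: partition_triples_def split_beta)
  have fin: "finite (hw_family \<Lambda>)" unfolding hw_family_def by (rule finite_SigmaI) (auto split: prod.splits)
  have "(\<Prod>i<n. schur [2 * r i + 3, r i, 0]) =
      (\<Sum>j\<in>hw_family \<Lambda>. Poly_Mapping.single (wt_monom (case j of (i, \<tau>) \<Rightarrow> hw_wt (\<Lambda> ! i) \<tau>)) 1)"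
    unfolding prod_schur
    by (rule sum_eq_of_counts[where F = "\<lambda>\<mu>. Poly_Mapping.single (wt_monom \<mu>) 1", OF _ fin \<Lambda>(2)])
       (auto intro: finite_PiE)
  also have "\<dots> = (\<Sum>i<length \<Lambda>. schur3 (\<Lambda> ! i))"
  proof -
    have "(\<Sum>j\<in>hw_family \<Lambda>. Poly_Mapping.single (wt_monom (case j of (i, \<tau>) \<Rightarrow> hw_wt (\<Lambda> ! i) \<tau>)) (1::int)) =
      (\<Sum>i<length \<Lambda>. \<Sum>\<tau>\<in>(case \<Lambda> ! i of (l1, l2, l3) \<Rightarrow> gt (l1 - l3) (l2 - l3) 0).
        Poly_Mapping.single (wt_monom (hw_wt (\<Lambda> ! i) \<tau>)) 1)"
      unfolding hw_family_def by (subst sum.Sigma) (auto split: prod.splits intro!: sum.cong)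
    also have "\<dots> = (\<Sum>i<length \<Lambda>. schur3 (\<Lambda> ! i))"
    proof (intro sum.cong refl)
      fix i assume "i \<in> {..<length \<Lambda>}"
      then have i: "\<Lambda> ! i \<in> partition_triples" using P by simp
      obtain l1 l2 l3 where l: "\<Lambda> ! i = (l1, l2, l3)" by (cases "\<Lambda> ! i") auto
      show "(\<Sum>\<tau>\<in>(case \<Lambda> ! i of (l1, l2, l3) \<Rightarrow> gt (l1 - l3) (l2 - l3) 0).
        Poly_Mapping.single (wt_monom (hw_wt (\<Lambda> ! i) \<tau>)) 1) = schur3 (\<Lambda> ! i)"
        using schur_hw_wt[of l3 l2 l1] i by (simp add: l schur3_def partition_triples_def)
    qed
    finally show ?thesis .
  qed
  finally have "schur_coeff [k + n, k + n, k + n] (\<Prod>i<n. schur [2 * r i + 3, r i, 0]) =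
      int (card {i. i < length \<Lambda> \<and> \<Lambda> ! i = (k + n, k + n, k + n)})"
    using schur_coeff_sum[of "length \<Lambda>" "\<lambda>i. \<Lambda> ! i" "k + n" "k + n" "k + n", OF P]
    by (simp add: partition_triples_def)
  \<comment> \<open>All shapes in \<open>\<Lambda>\<close> have size \<open>3 * (k + n)\<close>, so
    three equal parts must each be \<open>k + n\<close>.\<close>
  also have "{i. i < length \<Lambda> \<and> \<Lambda> ! i = (k + n, k + n, k + n)} =
      {i. i < length \<Lambda> \<and> (case \<Lambda> ! i of (l1, l2, l3) \<Rightarrow> l1 = l2 \<and> l2 = l3)}"
  proof (intro Collect_cong conj_cong refl)
    fix i assume i: "i < length \<Lambda>"
    obtain l1 l2 l3 where l: "\<Lambda> ! i = (l1, l2, l3)" by (cases "\<Lambda> ! i") auto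
    have "l1 + l2 + l3 = 3 * (k + n)" using \<Lambda>(1)[of l1 l2 l3] nth_mem[OF i] by (simp add: l D)
    then show "\<Lambda> ! i = (k + n, k + n, k + n) \<longleftrightarrow> (case \<Lambda> ! i of (l1, l2, l3) \<Rightarrow> l1 = l2 \<and> l2 = l3)"
      by (auto simp: l)
  qed
  also have "card \<dots> = fun_space.dim (inv_funs n r)"
    by (simp add: \<Lambda>(3) length_filter_conv_card)
  finally show ?thesis by simp
qed

theorem theorem3p4:
  fixes n k :: nat
  assumes "n \<ge> 3"
  shows "(\<forall>V :: nat \<Rightarrow> nat \<Rightarrow> nat sl3_rep.
            (\<forall>a b. irrep_with_highest_weight (V a b) a b) \<longrightarrow>
            W_graded n k \<cong>\<^sub>l
              direct_sum (compositions n k)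
                (\<lambda>r. rep_invariants (tensor_rep n (\<lambda>i. V (r i + 3) (r i))))) \<and>
         finite_dimensional (W_graded n k) \<and>
         int (fun_space.dim (W_graded n k)) =
           (\<Sum>r\<in>compositions n k.
              schur_coeff [k + n, k + n, k + n] (\<Prod>i<n. schur [2 * r i + 3, r i, 0]))"
proof (intro conjI allI impI)
  fix V :: "nat \<Rightarrow> nat \<Rightarrow> nat sl3_rep"
  assume V: "\<forall>a b. irrep_with_highest_weight (V a b) a b"
  let ?T = "\<lambda>r. tensor_rep n (\<lambda>i. V (r i + 3) (r i))"
  have "\<forall>r. \<exists>X. Vector_Spaces.linear fscale fscale X \<and> X ` rep_invariants (?T r) = inv_funs n r \<and>
    (\<forall>x\<in>rep_invariants (?T r). X x = 0 \<longrightarrow> x = 0)"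
  proof
    fix r
    show "\<exists>X. Vector_Spaces.linear fscale fscale X \<and> X ` rep_invariants (?T r) = inv_funs n r \<and>
      (\<forall>x\<in>rep_invariants (?T r). X x = 0 \<longrightarrow> x = 0)"
      by (rule tensor_invariants_iso[of n "\<lambda>i. V (r i + 3) (r i)" r]) (use V in auto)
  qed
  from choice[OF this] obtain X where X: "\<forall>r. Vector_Spaces.linear fscale fscale (X r) \<and>
    X r ` rep_invariants (?T r) = inv_funs n r \<and> (\<forall>x\<in>rep_invariants (?T r). X r x = 0 \<longrightarrow> x = 0)"
    by (rule exE)
  show "W_graded n k \<cong>\<^sub>l direct_sum (compositions n k) (\<lambda>r. rep_invariants (?T r))"
    by (rule W_graded_iso_direct_sum[where X = X]) (use X in \<open>auto intro: rep_invariants_subspace\<close>)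
next
  show "finite_dimensional (W_graded n k)" by (rule W_graded_dim)
  show "int (fun_space.dim (W_graded n k)) =
    (\<Sum>r\<in>compositions n k. schur_coeff [k + n, k + n, k + n] (\<Prod>i<n. schur [2 * r i + 3, r i, 0]))"
    unfolding W_graded_dim(2) of_nat_sum by (intro sum.cong refl inv_funs_dim)
qed

end
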